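(* Let $t>0$ and $\theta,\varphi\in[0,\pi]$. All double integrals below are over $(u,v)\in[-1,1]^2$. (i) If $\alpha,\beta\ge-1/2$, then $$\mathbb{H}_t^{\alpha,\beta}(\theta,\varphi)=\iint\Psi^{\alpha,\beta}(t,\theta,\varphi,u,v)\,d\Pi_\alpha(u)\,d\Pi_\beta(v).$$ (ii) If $-1<\alpha<-1/2\le\beta$, then $$\mathbb{H}_t^{\alpha,\beta}(\theta,\varphi)=\iint\Big\{-\partial_u\Psi^{\alpha,\beta}(t,\theta,\varphi,u,v)\,\Pi_\alpha(u)\,du\,d\Pi_\beta(v)+\Psi^{\alpha,\beta}(t,\theta,\varphi,u,v)\,d\Pi_{-1/2}(u)\,d\Pi_\beta(v)\Big\}.$$ (iii) If $-1<\beta<-1/2\le\alpha$, then $$\mathbb{H}_t^{\alpha,\beta}(\theta,\varphi)=\iint\Big\{-\partial_v\Psi^{\alpha,\beta}(t,\theta,\varphi,u,v)\,d\Pi_\alpha(u)\,\Pi_\beta(v)\,dv+\Psi^{\alpha,\beta}(t,\theta,\varphi,u,v)\,d\Pi_\alpha(u)\,d\Pi_{-1/2}(v)\Big\}.$$ (iv) If $-1<\alpha,\beta<-1/2$, then \begin{align*} \mathbb{H}_t^{\alpha,\beta}(\theta,\varphi)=\iint\Big\{&\partial_u\partial_v\Psi^{\alpha,\beta}(t,\theta,\varphi,u,v)\,\Pi_\alpha(u)\,du\,\Pi_\beta(v)\,dv\\ &-\partial_u\Psi^{\alpha,\beta}(t,\theta,\varphi,u,v)\,\Pi_\alpha(u)\,du\,d\Pi_{-1/2}(v)\\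 &-\partial_v\Psi^{\alpha,\beta}(t,\theta,\varphi,u,v)\,d\Pi_{-1/2}(u)\,\Pi_\beta(v)\,dv\\ &+\Psi^{\alpha,\beta}(t,\theta,\varphi,u,v)\,d\Pi_{-1/2}(u)\,d\Pi_{-1/2}(v)\Big\}. \end{align*}
   Context: For $\alpha,\beta>-1$ let $d\mu_{\alpha,\beta}(\theta)=(\sin\frac{\theta}{2})^{2\alpha+1}(\cos\frac{\theta}{2})^{2\beta+1}\,d\theta$ on $[0,\pi]$. Let $\mathcal{P}_n^{\alpha,\beta}(\theta)$, $n\ge 0$, be the classical Jacobi trigonometric polynomials (the Jacobi polynomial of degree $n$ and type $(\alpha,\beta)$ evaluated at $\cos\theta$), normalized in $L^2(d\mu_{\alpha,\beta})$. Define $$\mathbb{H}_t^{\alpha,\beta}(\theta,\varphi)=\sum_{n=0}^\infty e^{-t\left(n+\frac{\alpha+\beta+1}{2}\right)}\mathcal{P}_n^{\alpha,\beta}(\theta)\mathcal{P}_n^{\alpha,\beta}(\varphi),\qquad t>0,\ \theta,\varphi\in[0,\pi].$$ Let $c_{\alpha,\beta}=\dfrac{\Gamma(\alpha+\beta+2)}{2^{\alpha+\beta+1}\Gamma(\alpha+1)\Gamma(\beta+1)}$, $q(\theta,\varphi,u,v)=1-u\sin\frac{\theta}{2}\sin\frac{\varphi}{2}-v\cos\frac{\theta}{2}\cos\frac{\varphi}{2}$, and $$\Psi^{\alpha,\beta}(t,\theta,\varphi,u,v)=\frac{c_{\alpha,\beta}\sinh\frac t2}{(\cosh\frac t2-1+q(\theta,\varphi,u,v))^{\alpha+\beta+2}}.$$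 For $\alpha>-1$, $\alpha\ne-1/2$, define the odd function $$\Pi_\alpha(u)=\frac{\Gamma(\alpha+1)}{\sqrt\pi\,\Gamma(\alpha+1/2)}\int_0^u(1-w^2)^{\alpha-1/2}\,dw,\qquad -1<u<1.$$ For $\alpha>-1/2$, $d\Pi_\alpha$ is the probability measure on $[-1,1]$ with density $\Pi_\alpha'(u)$; for $\alpha=-1/2$, $d\Pi_{-1/2}=\frac12(\delta_{-1}+\delta_1)$, with $\delta_{\pm1}$ the point mass at $\pm1$. For $-1<\alpha<-1/2$ the function $\Pi_\alpha(u)$ is integrable on $(-1,1)$, and $\Pi_\alpha(u)\,du$ denotes the corresponding finite signed measure. *)

theory Defs
  imports "HOL-Analysis.Analysis"
begin

definition jacobi_measure :: "real \<Rightarrow> real \<Rightarrow> real measure" where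
  "jacobi_measure \<alpha> \<beta> = density lborel
     (\<lambda>\<theta>. ennreal (indicator {0..pi} \<theta> *
        (sin (\<theta> / 2) powr (2 * \<alpha> + 1) * cos (\<theta> / 2) powr (2 * \<beta> + 1))))"

(* The classical Jacobi polynomial with Szego's normalization P_n(1) = (n + alpha) gchoose n.
   This explicit form comes from expanding Rodrigues' formula by the Leibniz rule; unlike the
   form with Gamma (alpha + beta + n + 1) it has no exceptional parameters, in particular
   none at alpha + beta = -1. *)
definition jacobi_poly :: "real \<Rightarrow> real \<Rightarrow> nat \<Rightarrow> real \<Rightarrow> real" where
  "jacobi_poly \<alpha> \<beta> n x =
     (\<Sum>s\<le>n. ((real n + \<alpha>) gchoose (n - s)) * ((real n + \<beta>) gchoose s) *
            ((x - 1) / 2) ^ s * ((x + 1) / 2) ^ (n - s))"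

definition jacobi_trig :: "real \<Rightarrow> real \<Rightarrow> nat \<Rightarrow> real \<Rightarrow> real" where
  "jacobi_trig \<alpha> \<beta> n \<theta> =
     jacobi_poly \<alpha> \<beta> n (cos \<theta>) /
     sqrt (\<integral>\<phi>. (jacobi_poly \<alpha> \<beta> n (cos \<phi>))\<^sup>2 \<partial>jacobi_measure \<alpha> \<beta>)"

definition jacobi_poisson :: "real \<Rightarrow> real \<Rightarrow> real \<Rightarrow> real \<Rightarrow> real \<Rightarrow> real" where
  "jacobi_poisson \<alpha> \<beta> t \<theta> \<phi> =
     (\<Sum>n. exp (- t * (real n + (\<alpha> + \<beta> + 1) / 2)) * jacobi_trig \<alpha> \<beta> n \<theta> * jacobi_trig \<alpha> \<beta> n \<phi>)"

definition c_const :: "real \<Rightarrow> real \<Rightarrow> real" where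
  "c_const \<alpha> \<beta> =
     Gamma (\<alpha> + \<beta> + 2) / (2 powr (\<alpha> + \<beta> + 1) * Gamma (\<alpha> + 1) * Gamma (\<beta> + 1))"

definition q_fun :: "real \<Rightarrow> real \<Rightarrow> real \<Rightarrow> real \<Rightarrow> real" where
  "q_fun \<theta> \<phi> u v =
     1 - u * sin (\<theta> / 2) * sin (\<phi> / 2) - v * cos (\<theta> / 2) * cos (\<phi> / 2)"

definition Psi ::
  "real \<Rightarrow> real \<Rightarrow> real \<Rightarrow> real \<Rightarrow> real \<Rightarrow> real \<Rightarrow> real \<Rightarrow> real" where
  "Psi \<alpha> \<beta> t \<theta> \<phi> u v =
     c_const \<alpha> \<beta> * sinh (t / 2) /
     (cosh (t / 2) - 1 + q_fun \<theta> \<phi> u v) powr (\<alpha> + \<beta> + 2)"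

definition Psi_u ::
  "real \<Rightarrow> real \<Rightarrow> real \<Rightarrow> real \<Rightarrow> real \<Rightarrow> real \<Rightarrow> real \<Rightarrow> real" where
  "Psi_u \<alpha> \<beta> t \<theta> \<phi> u v = deriv (\<lambda>x. Psi \<alpha> \<beta> t \<theta> \<phi> x v) u"

definition Psi_v ::
  "real \<Rightarrow> real \<Rightarrow> real \<Rightarrow> real \<Rightarrow> real \<Rightarrow> real \<Rightarrow> real \<Rightarrow> real" where
  "Psi_v \<alpha> \<beta> t \<theta> \<phi> u v = deriv (\<lambda>y. Psi \<alpha> \<beta> t \<theta> \<phi> u y) v"

definition Psi_uv ::
  "real \<Rightarrow> real \<Rightarrow> real \<Rightarrow> real \<Rightarrow> real \<Rightarrow> real \<Rightarrow> real \<Rightarrow> real" where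
  "Psi_uv \<alpha> \<beta> t \<theta> \<phi> u v = deriv (\<lambda>x. Psi_v \<alpha> \<beta> t \<theta> \<phi> x v) u"

(* The interval integral is oriented, so this is odd. Meaningful for alpha > -1,
   alpha \<noteq> -1/2 and -1 < u < 1. *)
definition Pi_fun :: "real \<Rightarrow> real \<Rightarrow> real" where
  "Pi_fun \<alpha> u =
     Gamma (\<alpha> + 1) / (sqrt pi * Gamma (\<alpha> + 1 / 2)) *
     (LBINT w=ereal 0..ereal u. (1 - w\<^sup>2) powr (\<alpha> - 1 / 2))"

(* Meaningful for alpha \<ge> -1/2. For alpha = -1/2 this is (delta_{-1} + delta_1) / 2, written
   as the image on the Borel line of the uniform measure on the two points. *)
definition dPi :: "real \<Rightarrow> real measure" where
  "dPi \<alpha> =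
     (if \<alpha> = - 1 / 2 then distr (uniform_count_measure {- 1, 1}) borel (\<lambda>x. x)
      else density lborel (\<lambda>u. ennreal (indicator {- 1<..<1} u * deriv (Pi_fun \<alpha>) u)))"

(* The signed measure Pi_alpha(u) du is handled by integrating against this measure with
   the factor Pi_fun alpha u in the integrand. *)
definition lborel_I :: "real measure" where
  "lborel_I = restrict_space lborel {- 1<..<1}"

lemma emeasure_dPi_half:
  assumes "A \<in> sets borel"
  shows "emeasure (dPi (- 1 / 2)) A =
    (indicator A (- 1) + indicator A 1) / 2"
proof -
  have "emeasure (dPi (- 1 / 2)) A = emeasure (uniform_count_measure {- 1, 1 :: real}) (A \<inter> {- 1, 1})"
    using assms by (simp add: dPi_def emeasure_distr space_uniform_count_measure
        sets_uniform_count_measure measurable_def)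
  also have "\<dots> = ennreal (real (card (A \<inter> {- 1, 1})) / 2)"
    by (subst emeasure_uniform_count_measure) auto
  also have "\<dots> = ennreal ((indicator A (- 1) + indicator A 1) / 2)"
    by (cases "- 1 \<in> A"; cases "1 \<in> A") (auto simp: Int_insert_right)
  also have "\<dots> = (indicator A (- 1) + indicator A 1) / 2"
    by (simp add: divide_ennreal[symmetric] ennreal_plus ennreal_indicator flip: ennreal_numeral)
  finally show ?thesis .
qed

end

theory Submission
  imports Defs
begin

text \<open>
  Put \<open>z = exp (- t / 2)\<close>, \<open>s = \<alpha> + \<beta> + 2\<close> and \<open>w = a u + b v\<close> with \<open>a = sin (\<theta>/2) sin (\<phi>/2)\<close>,
  \<open>b = cos (\<theta>/2) cos (\<phi>/2)\<close>. Then \<open>Psi\<close> is a constant times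
  \<open>z^(s-1) (1 - z^2) (1 - 2 z w + z^2)^(-s)\<close>, a power series in \<open>z\<close> whose coefficients are Gegenbauer
  polynomials in \<open>w\<close>, dominated uniformly in \<open>|w| \<le> 1\<close> together with their derivatives; hence every
  integral may be taken termwise. In all cases of the theorem the resulting functional in \<open>u\<close> maps
  \<open>u^(2m)\<close> to \<open>(1/2)_m / (\<alpha>+1)_m\<close> and odd powers to \<open>0\<close>. The coefficient of
  \<open>z^(2n)\<close> thus becomes a terminating Appell \<open>F4\<close> sum in \<open>sin^2 (\<theta>/2)\<close> and \<open>sin^2 (\<phi>/2)\<close>. This sum
  is an eigenfunction of the Jacobi operator in each of the two variables, so it is a multiple of the
  product of two Jacobi polynomials, and the multiple is found by evaluating at \<open>(1, 0)\<close>.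
\<close>

section \<open>Moments of the measures and of the odd functions \<open>Pi_fun\<close>\<close>

text \<open>Cases (ii)-(iv) are formal integrations by parts of (i). For \<alpha> > -1/2 the odd
  function \<open>Pi_fun \<alpha>\<close> tends to 1/2 at 1, so the boundary terms form exactly an
  integral against \<open>dPi (- 1 / 2)\<close>. For -1 < \<alpha> < -1/2 the density (1 -
  u^2)^(\<alpha> - 1/2) is no longer integrable, but the integrated form still makes sense and gives
  the same rational function of \<alpha> on powers. Hence one series identity serves all four cases.
  The factor 1 - z^2 is essential. The coefficient of z^(2n) in the Gegenbauer series alone
  accumulates the contributions of all degrees up to n. Multiplication by 1 - z^2 replaces it by the
  difference of two consecutive even coefficients, and it is this difference that carries the
  parameters -n and n+\<alpha>+\<beta>+1 of the F4 sum. The resulting constant must match the L^2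
  norms; these come from Beta integrals, whose alternating sum is an n-th finite difference of a
  Pochhammer symbol.\<close>

lemma has_bochner_integral_Beta:
  fixes a b :: real
  assumes "a > 0" "b > 0"
  shows "has_bochner_integral lborel (\<lambda>t. indicator {0..1} t * (t powr (a - 1) * (1 - t) powr (b - 1))) (Beta a b)"
proof -
  let ?f = "\<lambda>t::real. t powr (a - 1) * (1 - t) powr (b - 1)"
  have H: "(?f has_integral Beta a b) {0..1}" using has_integral_Beta_real[OF assms] .
  \<comment> \<open>\<open>H\<close> is a gauge integral; nonnegativity of the integrand makes it a
    Lebesgue integral.\<close>
  have "?f absolutely_integrable_on {0..1}"
    using H by (intro nonnegative_absolutely_integrable_1) (auto simp: integrable_on_def)
  then have I: "set_integrable lborel {0..1} ?f"
    unfolding set_integrable_def by (subst (asm) integrable_completion) auto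
  have "(LINT t:{0..1}|lborel. ?f t) = Beta a b"
    using set_borel_integral_eq_integral(2)[OF I] H by (simp add: integral_unique)
  then show ?thesis
    using I by (simp add: has_bochner_integral_iff set_integrable_def set_lebesgue_integral_def)
qed

text \<open>The unnormalized density, extended by 0 to the line so that u -> -u is an affine
  substitution in all moment integrals.\<close>

definition rho :: "real \<Rightarrow> real \<Rightarrow> real" where
  "rho \<gamma> u = indicator {-1<..<1} u * (1 - u\<^sup>2) powr (\<gamma> - 1 / 2)"

lemma rho_measurable [measurable]: "rho \<gamma> \<in> borel_measurable borel"
  unfolding rho_def by measurable

lemma rho_nonneg: "rho \<gamma> u \<ge> 0" by (simp add: rho_def)

text \<open>The substitution t = u^2 in the Beta integral gives the half over [0, 1]; evenness gives
  the other half.\<close>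

lemma has_bochner_integral_rho_even:
  assumes "\<gamma> > - 1 / 2"
  shows "has_bochner_integral lborel (\<lambda>u. rho \<gamma> u * u ^ (2 * m)) (Beta (real m + 1 / 2) (\<gamma> + 1 / 2))"
proof -
  let ?B = "Beta (real m + 1 / 2) (\<gamma> + 1 / 2)"
  let ?f = "\<lambda>t::real. t powr (real m - 1 / 2) * (1 - t) powr (\<gamma> - 1 / 2)"
  have f: "has_bochner_integral lborel (\<lambda>t. indicator {0..1} t * ?f t) ?B"
    using has_bochner_integral_Beta[of "real m + 1 / 2" "\<gamma> + 1 / 2"] assms by simp
  then have sf: "set_integrable lborel {(0::real)\<^sup>2..1\<^sup>2} ?f"
    by (simp add: has_bochner_integral_iff set_integrable_def)
  have 1: "set_integrable lborel {0..1} (\<lambda>u. ?f (u\<^sup>2) * (2 * u))"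
     "(LBINT t. ?f t * indicator {0\<^sup>2..1\<^sup>2} t) = (LBINT u. ?f (u\<^sup>2) * (2 * u) * indicator {0..1} u)"
    by (rule integral_substitution[where g = "\<lambda>u::real. u\<^sup>2" and g' = "\<lambda>u. 2 * u" and a = 0 and b = 1, OF sf]; auto intro!: derivative_eq_intros continuous_intros)+
  \<comment> \<open>On (0, 1) this is twice the wanted integrand and it vanishes for u < 0;
    averaging with its reflection restores the even integrand.\<close>
  define h where "h u = indicator {0..1} u * (?f (u\<^sup>2) * (2 * u))" for u :: real
  have h: "has_bochner_integral lborel h ?B"
    using f 1 by (simp add: has_bochner_integral_iff set_integrable_def h_def[abs_def] mult_ac)
  have "has_bochner_integral lborel (\<lambda>u. h (0 + (-1) * u)) (?B /\<^sub>R \<bar>-1\<bar>)"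
    using h by (subst lborel_has_bochner_integral_real_affine_iff[symmetric]) auto
  then have h': "has_bochner_integral lborel (\<lambda>u. h (- u)) ?B" by simp
  have hh: "has_bochner_integral lborel (\<lambda>u. (h u + h (- u)) / 2) ?B"
    using has_bochner_integral_divide_zero[OF has_bochner_integral_add[OF h h'], of 2] by simp
  have eq: "(h u + h (- u)) / 2 = rho \<gamma> u * u ^ (2 * m)" if "u \<noteq> 0" for u
  proof -
    have "h u = rho \<gamma> u * u ^ (2 * m) * 2" if "u > 0" for u
    proof -
      have "(u\<^sup>2) powr (real m - 1 / 2) * u = u ^ (2 * m)"
      proof -
        have "(u\<^sup>2) powr (real m - 1 / 2) = u powr (2 * real m - 1)"
          using that powr_powr[of u 2 "real m - 1 / 2"] by (simp add: algebra_simps)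
        then have "(u\<^sup>2) powr (real m - 1 / 2) * u = u powr (2 * real m)"
          using that by (simp add: powr_diff)
        then show ?thesis using that powr_realpow[of u "2 * m"] by simp
      qed
      then show ?thesis using that
        by (auto simp: h_def rho_def indicator_def mult_ac)
    qed
    note pos = this
    have neg: "h u = 0" if "u < 0" for u using that by (simp add: h_def)
    show ?thesis using that pos[of u] pos[of "-u"] neg[of u] neg[of "-u"]
      by (cases "u > 0") (auto simp: rho_def indicator_def)
  qed
  \<comment> \<open>At u = 0 with m = 0 the two sides are 0 and 1, hence equality only almost
    everywhere.\<close>
  have "AE u in lborel. (h u + h (- u)) / 2 = rho \<gamma> u * u ^ (2 * m)"
    using AE_lborel_singleton[of 0] by eventually_elim (use eq in auto)
  then show ?thesis using hh
    by (subst has_bochner_integral_cong_AE[symmetric, where f = "\<lambda>u. (h u + h (- u)) / 2"]) (auto simp: h_def)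
qed

lemma integrable_rho: "\<gamma> > - 1 / 2 \<Longrightarrow> integrable lborel (rho \<gamma>)"
  using has_bochner_integral_rho_even[of \<gamma> 0] by (simp add: has_bochner_integral_iff)

lemma integrable_rho_mult:
  assumes "\<gamma> > - 1 / 2" "f \<in> borel_measurable borel" "\<And>u. \<bar>u\<bar> < 1 \<Longrightarrow> \<bar>f u\<bar> \<le> B"
  shows "integrable lborel (\<lambda>u. rho \<gamma> u * f u)"
proof (rule Bochner_Integration.integrable_bound)
  show "integrable lborel (\<lambda>u. B * rho \<gamma> u)" using integrable_rho[OF assms(1)] by simp
  show "AE u in lborel. norm (rho \<gamma> u * f u) \<le> norm (B * rho \<gamma> u)"
  proof (rule AE_I2)
    fix u
    show "norm (rho \<gamma> u * f u) \<le> norm (B * rho \<gamma> u)"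
    proof (cases "\<bar>u\<bar> < 1")
      case True
      then have "rho \<gamma> u * \<bar>f u\<bar> \<le> rho \<gamma> u * \<bar>B\<bar>"
        using assms(3)[of u] rho_nonneg[of \<gamma> u] by (intro mult_left_mono) auto
      then show ?thesis using rho_nonneg[of \<gamma> u] by (simp add: abs_mult mult.commute)
    qed (auto simp: rho_def indicator_def)
  qed
qed (use assms(2) in measurable)

lemma has_bochner_integral_rho_odd:
  assumes "\<gamma> > - 1 / 2" "odd i"
  shows "has_bochner_integral lborel (\<lambda>u. rho \<gamma> u * u ^ i) 0"
proof -
  have I: "integrable lborel (\<lambda>u. rho \<gamma> u * u ^ i)"
    by (rule integrable_rho_mult[of _ _ 1]) (use assms in \<open>auto simp: power_abs power_le_one\<close>)
  have "(\<integral>u. rho \<gamma> u * u ^ i \<partial>lborel) = (\<integral>u. rho \<gamma> (- u) * (- u) ^ i \<partial>lborel)"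
    using lborel_integral_real_affine[of "-1" "\<lambda>u. rho \<gamma> u * u ^ i" 0] by simp
  also have "\<dots> = (\<integral>u. - (rho \<gamma> u * u ^ i) \<partial>lborel)"
    using assms(2) by (intro Bochner_Integration.integral_cong refl) (auto simp: rho_def indicator_def)
  finally show ?thesis using I by (simp add: has_bochner_integral_iff)
qed

definition Pi_const :: "real \<Rightarrow> real" where
  "Pi_const \<alpha> = Gamma (\<alpha> + 1) / (sqrt pi * Gamma (\<alpha> + 1 / 2))"

text \<open>The moments of \<open>dPi \<alpha>\<close> for \<alpha> \<ge> -1/2. As a function of
  \<alpha> the formula has no pole for \<alpha> > -1, so it also makes sense below -1/2; at \<alpha>
  = -1/2 every even moment is 1.\<close>

definition Pi_moment :: "real \<Rightarrow> nat \<Rightarrow> real" where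
  "Pi_moment \<alpha> i = (if even i then pochhammer (1 / 2) (i div 2) / pochhammer (\<alpha> + 1) (i div 2) else 0)"

lemma Pi_const_Beta:
  assumes "\<gamma> > - 1 / 2"
  shows "Pi_const \<gamma> * Beta (real m + 1 / 2) (\<gamma> + 1 / 2) = Pi_moment \<gamma> (2 * m)"
proof -
  have pos: "Gamma (\<gamma> + 1) > 0" "Gamma (\<gamma> + 1 / 2) > 0" "Gamma (\<gamma> + 1 + real m) > 0"
    using assms by (auto intro!: Gamma_real_pos)
  have 1: "pochhammer (1 / 2 :: real) m = Gamma (real m + 1 / 2) / sqrt pi"
    by (subst pochhammer_Gamma) (auto simp: Gamma_one_half_real add.commute)
  have 2: "pochhammer (\<gamma> + 1) m = Gamma (\<gamma> + 1 + real m) / Gamma (\<gamma> + 1)"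
    using assms by (subst pochhammer_Gamma) (auto elim!: nonpos_Ints_cases)
  have 3: "real m + 1 / 2 + (\<gamma> + 1 / 2) = \<gamma> + 1 + real m" by simp
  show ?thesis
    unfolding Pi_const_def Pi_moment_def Beta_def 3 using pos by (simp add: 1 2)
qed

lemma has_bochner_integral_rho_moment:
  assumes "\<gamma> > - 1 / 2"
  shows "has_bochner_integral lborel (\<lambda>u. Pi_const \<gamma> * rho \<gamma> u * u ^ i) (Pi_moment \<gamma> i)"
proof (cases "even i")
  case True
  then obtain m where "i = 2 * m" by blast
  then show ?thesis
    using has_bochner_integral_mult_right[OF has_bochner_integral_rho_even[OF assms, of m], of "Pi_const \<gamma>"]
      Pi_const_Beta[OF assms, of m] by (simp add: mult_ac)
next
  case False
  then show ?thesis
    using has_bochner_integral_mult_right[OF has_bochner_integral_rho_odd[OF assms False], of "Pi_const \<gamma>"]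
    by (simp add: mult_ac Pi_moment_def)
qed

section \<open>The primitive \<open>Pi_fun\<close>: derivative, oddness, boundary value, parameter
  shift\<close>

lemma DERIV_Pi_fun:
  assumes "\<bar>u\<bar> < 1"
  shows "(Pi_fun \<alpha> has_real_derivative Pi_const \<alpha> * (1 - u\<^sup>2) powr (\<alpha> - 1 / 2)) (at u)"
proof -
  let ?f = "\<lambda>w::real. (1 - w\<^sup>2) powr (\<alpha> - 1 / 2)"
  \<comment> \<open>Any b strictly between |u| and 1 keeps the possible endpoint singularities of
    the integrand away.\<close>
  define b where "b = (1 + \<bar>u\<bar>) / 2"
  have b: "\<bar>u\<bar> < b" "b < 1" using assms by (auto simp: b_def)
  have c: "continuous_on {-b..b} ?f"
  proof (intro continuous_intros ballI)
    fix w assume "w \<in> {-b..b}"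
    then have "\<bar>w\<bar> < 1" using b by auto
    then show "1 - w\<^sup>2 \<noteq> 0" using abs_square_less_1[of w] by simp
  qed
  have "((\<lambda>u. LBINT w=ereal 0..ereal u. ?f w) has_vector_derivative ?f u) (at u within {-b..b})"
    using b by (intro interval_integral_FTC2 c) auto
  then have "((\<lambda>u. LBINT w=ereal 0..ereal u. ?f w) has_real_derivative ?f u) (at u)"
    using b by (subst (asm) at_within_Icc_at) (auto simp: has_real_derivative_iff_has_vector_derivative)
  then show ?thesis
    unfolding Pi_fun_def[abs_def] Pi_const_def[symmetric] by (rule DERIV_cmult)
qed

lemma Pi_fun_0: "Pi_fun \<alpha> 0 = 0"
  by (simp add: Pi_fun_def)

text \<open>Identities for \<open>Pi_fun\<close> are proved by comparing derivatives on the open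
  interval, because these may blow up at its ends; the base point is 0, where \<open>Pi_fun\<close>
  vanishes.\<close>

lemma eq_on_unit_interval:
  fixes f g :: "real \<Rightarrow> real"
  assumes "\<And>u. \<bar>u\<bar> < 1 \<Longrightarrow> (f has_real_derivative d u) (at u)"
    "\<And>u. \<bar>u\<bar> < 1 \<Longrightarrow> (g has_real_derivative d u) (at u)" "f 0 = g 0" "\<bar>u\<bar> < 1"
  shows "f u = g u"
proof -
  let ?S = "{-1<..<1} :: real set"
  have "((\<lambda>u. f u - g u) has_real_derivative 0) (at x within ?S)" if "x \<in> ?S" for x
    using DERIV_diff[OF assms(1)[of x] assms(2)[of x]] that by (auto intro: has_field_derivative_at_within)
  then have "\<exists>c. \<forall>x\<in>?S. f x - g x = c"
    by (intro has_field_derivative_zero_constant) auto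
  then obtain c where c: "\<And>x. x \<in> ?S \<Longrightarrow> f x - g x = c" by blast
  have "u \<in> ?S" using assms(4) by auto
  from c[OF this] c[of 0] assms(3) show ?thesis by simp
qed

lemma Pi_fun_minus:
  assumes "\<bar>u\<bar> < 1"
  shows "Pi_fun \<alpha> (- u) = - Pi_fun \<alpha> u"
  using _ _ _ assms
proof (rule eq_on_unit_interval[where d = "\<lambda>u. - (Pi_const \<alpha> * (1 - u\<^sup>2) powr (\<alpha> - 1 / 2))"])
  fix u :: real assume u: "\<bar>u\<bar> < 1"
  show "((\<lambda>u. Pi_fun \<alpha> (- u)) has_real_derivative - (Pi_const \<alpha> * (1 - u\<^sup>2) powr (\<alpha> - 1 / 2))) (at u)"
    using DERIV_chain2[OF DERIV_Pi_fun[of "-u" \<alpha>] DERIV_minus[OF DERIV_ident]] u by simp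
  show "((\<lambda>u. - Pi_fun \<alpha> u) has_real_derivative - (Pi_const \<alpha> * (1 - u\<^sup>2) powr (\<alpha> - 1 / 2))) (at u)"
    using u by (intro DERIV_minus DERIV_Pi_fun)
qed (simp_all add: Pi_fun_0)

lemma Pi_const_pos: "\<gamma> > - 1 / 2 \<Longrightarrow> Pi_const \<gamma> > 0"
  unfolding Pi_const_def by (intro divide_pos_pos mult_pos_pos Gamma_real_pos) auto

lemma dPi_density:
  assumes "\<gamma> \<noteq> - 1 / 2"
  shows "dPi \<gamma> = density lborel (\<lambda>u. ennreal (Pi_const \<gamma> * rho \<gamma> u))"
proof -
  have "indicator {- 1<..<1} u * deriv (Pi_fun \<gamma>) u = Pi_const \<gamma> * rho \<gamma> u" for u
    using DERIV_imp_deriv[OF DERIV_Pi_fun[of u \<gamma>]] by (cases "\<bar>u\<bar> < 1") (auto simp: rho_def indicator_def)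
  then show ?thesis using assms by (simp add: dPi_def)
qed

lemma sets_dPi [measurable_cong]: "sets (dPi \<gamma>) = sets borel"
  by (simp add: dPi_def)

lemma space_dPi [simp]: "space (dPi \<gamma>) = UNIV"
  by (simp add: dPi_def)

lemma has_bochner_integral_dPi_power:
  assumes "\<gamma> > - 1 / 2"
  shows "has_bochner_integral (dPi \<gamma>) (\<lambda>u. u ^ i) (Pi_moment \<gamma> i)"
  using assms has_bochner_integral_rho_moment[OF assms, of i] Pi_const_pos[OF assms]
  by (subst dPi_density) (auto intro!: has_bochner_integral_density simp: rho_nonneg)

lemma has_bochner_integral_dPi_half:
  fixes f :: "real \<Rightarrow> real"
  assumes [measurable]: "f \<in> borel_measurable borel"
  shows "has_bochner_integral (dPi (- 1 / 2)) f ((f (- 1) + f 1) / 2)"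
proof -
  let ?M = "uniform_count_measure {- 1, 1 :: real}"
  have "?M = point_measure {- 1, 1 :: real} (\<lambda>x. ennreal (1 / 2))"
    by (simp add: uniform_count_measure_def)
  moreover have "integrable (point_measure {- 1, 1 :: real} (\<lambda>x. ennreal (1 / 2))) f"
    by (rule integrable_point_measure_finite) simp
  moreover have "integral\<^sup>L (point_measure {- 1, 1 :: real} (\<lambda>x. ennreal (1 / 2))) f = (f (- 1) + f 1) / 2"
    by (subst lebesgue_integral_point_measure_finite) simp_all
  ultimately have "has_bochner_integral ?M f ((f (- 1) + f 1) / 2)"
    by (simp only: has_bochner_integral_iff simp_thms)
  moreover have "(\<lambda>x. x) \<in> measurable ?M borel"
    by (auto simp: measurable_def sets_uniform_count_measure space_uniform_count_measure)
  ultimately show ?thesis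
    unfolding dPi_def using assms by (auto intro: has_bochner_integral_distr)
qed

lemma integrable_dPi_power: "\<gamma> \<ge> - 1 / 2 \<Longrightarrow> integrable (dPi \<gamma>) (\<lambda>u. u ^ i)"
  and integral_dPi_power: "\<gamma> \<ge> - 1 / 2 \<Longrightarrow> (\<integral>u. u ^ i \<partial>dPi \<gamma>) = Pi_moment \<gamma> i"
proof -
  assume \<gamma>: "\<gamma> \<ge> - 1 / 2"
  have "has_bochner_integral (dPi \<gamma>) (\<lambda>u. u ^ i) (Pi_moment \<gamma> i)"
  proof (cases "\<gamma> = - 1 / 2")
    case True
    have M: "Pi_moment (- 1 / 2) i = ((- 1) ^ i + 1 ^ i) / 2"
      by (auto simp: Pi_moment_def pochhammer_eq_0_iff)
    show ?thesis unfolding True M using has_bochner_integral_dPi_half[of "\<lambda>u. u ^ i"] by simp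
  next
    case False
    then show ?thesis using \<gamma> by (intro has_bochner_integral_dPi_power) simp
  qed
  then show "integrable (dPi \<gamma>) (\<lambda>u. u ^ i)" "(\<integral>u. u ^ i \<partial>dPi \<gamma>) = Pi_moment \<gamma> i"
    by (simp_all add: has_bochner_integral_iff)
qed

lemma finite_measure_dPi:
  assumes "\<gamma> \<ge> - 1 / 2"
  shows "finite_measure (dPi \<gamma>)"
proof
  have "integrable (dPi \<gamma>) (indicator UNIV :: real \<Rightarrow> real)" using integrable_dPi_power[OF assms, of 0] by simp
  then have "emeasure (dPi \<gamma>) (space (dPi \<gamma>)) < \<infinity>" by (subst (asm) integrable_indicator_iff) auto
  then show "emeasure (dPi \<gamma>) (space (dPi \<gamma>)) \<noteq> \<infinity>" by simp
qed

text \<open>\<open>dPi\<close> is a measure on the whole Borel line; this confines the estimates to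
  the square |u|, |v| \<le> 1.\<close>

lemma AE_dPi: "AE u in dPi \<gamma>. \<bar>u\<bar> \<le> 1"
proof (cases "\<gamma> = - 1 / 2")
  case True
  have "(AE u in dPi (- 1 / 2). \<bar>u\<bar> \<le> 1) \<longleftrightarrow> (AE u in uniform_count_measure {- 1, 1 :: real}. \<bar>u\<bar> \<le> 1)"
    unfolding dPi_def by (simp, subst AE_distr_iff) (auto simp: measurable_def sets_uniform_count_measure space_uniform_count_measure)
  then show ?thesis unfolding True by (auto intro!: AE_I2 simp: space_uniform_count_measure)
next
  case False
  then show ?thesis
    by (subst dPi_density) (auto simp: AE_density rho_def indicator_def intro!: AE_I2)
qed

text \<open>Total mass 1 and evenness leave mass 1/2 on [0, 1]. This limit later produces the
  weights of the point masses.\<close>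

lemma Pi_fun_tendsto:
  assumes "\<gamma> > - 1 / 2"
  shows "(Pi_fun \<gamma> \<longlongrightarrow> 1 / 2) (at_left 1)"
proof -
  have I: "has_bochner_integral lborel (\<lambda>u. Pi_const \<gamma> * rho \<gamma> u) 1"
    using has_bochner_integral_rho_moment[OF assms, of 0] by (simp add: Pi_moment_def)
  let ?r = "\<lambda>u. Pi_const \<gamma> * rho \<gamma> u"
  have "integrable lborel ?r" using I by (simp add: has_bochner_integral_iff)
  then have S: "set_integrable lborel A ?r" if "A \<in> sets borel" for A
    unfolding set_integrable_def using that by (intro integrable_mult_indicator) auto
  have half: "integral {0..1} ?r = 1 / 2"
  proof -
    \<comment> \<open>The point 0 is excluded because it lies in both halves.\<close>
    have split: "?r u = indicator {0..1} u * ?r u + indicator {0..1} (- u) * ?r (- u)" if "u \<noteq> 0" for u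
      using that by (auto simp: rho_def indicator_def)
    have J: "has_bochner_integral lborel (\<lambda>u. indicator {0..1} u * ?r u) (integral {0..1} ?r)"
      using S[of "{0..1}"] set_borel_integral_eq_integral(2)[OF S[of "{0..1}"]]
      unfolding has_bochner_integral_iff set_integrable_def set_lebesgue_integral_def real_scaleR_def
      by simp_all
    then have "has_bochner_integral lborel (\<lambda>u. indicator {0..1} (0 + (-1) * u) * ?r (0 + (-1) * u)) (integral {0..1} ?r /\<^sub>R \<bar>-1\<bar>)"
      by (subst lborel_has_bochner_integral_real_affine_iff[symmetric, where f = "\<lambda>u. indicator {0..1} u * ?r u"]) auto
    then have "has_bochner_integral lborel (\<lambda>u. indicator {0..1} (- u) * ?r (- u)) (integral {0..1} ?r)" by simp
    from has_bochner_integral_add[OF J this]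
    have "has_bochner_integral lborel (\<lambda>u. indicator {0..1} u * ?r u + indicator {0..1} (- u) * ?r (- u)) (integral {0..1} ?r + integral {0..1} ?r)" .
    moreover have "AE u in lborel. ?r u = indicator {0..1} u * ?r u + indicator {0..1} (- u) * ?r (- u)"
      using AE_lborel_singleton[of 0] by eventually_elim (rule split)
    ultimately have "has_bochner_integral lborel ?r (integral {0..1} ?r + integral {0..1} ?r)"
      by (subst has_bochner_integral_cong_AE) auto
    from has_bochner_integral_eq[OF I this] show ?thesis by simp
  qed
  have eq: "integral {0..u} ?r = Pi_fun \<gamma> u" if "0 < u" "u < 1" for u
  proof -
    have "Pi_fun \<gamma> u = Pi_const \<gamma> * (LBINT w:{0..u}. (1 - w\<^sup>2) powr (\<gamma> - 1 / 2))"
      using that by (simp add: Pi_fun_def Pi_const_def interval_integral_Icc)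
    also have "\<dots> = (LBINT w:{0..u}. Pi_const \<gamma> * (1 - w\<^sup>2) powr (\<gamma> - 1 / 2))" by simp
    also have "\<dots> = (LBINT w:{0..u}. ?r w)"
      using that by (intro set_lebesgue_integral_cong) (auto simp: rho_def)
    also have "\<dots> = integral {0..u} ?r"
      by (rule set_borel_integral_eq_integral) (rule S, simp)
    finally show ?thesis by simp
  qed
  \<comment> \<open>An indefinite integral is continuous up to the endpoint even when the density is
    unbounded there.\<close>
  have "continuous_on {0..1} (\<lambda>u. integral {0..u} ?r)"
    by (rule indefinite_integral_continuous_1) (rule set_borel_integral_eq_integral, rule S, simp)
  then have "((\<lambda>u. integral {0..u} ?r) \<longlongrightarrow> 1 / 2) (at 1 within {0..1})"
    unfolding continuous_on_def half[symmetric] by auto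
  then have "((\<lambda>u. integral {0..u} ?r) \<longlongrightarrow> 1 / 2) (at_left 1)"
    by (subst (asm) at_within_Icc_at_left) auto
  moreover have "\<forall>\<^sub>F u in at_left 1. integral {0..u} ?r = Pi_fun \<gamma> u"
    by (rule eventually_mono[OF eventually_at_left_real[of 0 1]]) (simp, rule eq, auto)
  ultimately show ?thesis by (rule Lim_transform_eventually)
qed

text \<open>An increasing odd function with limit 1/2 at 1.\<close>

lemma Pi_fun_bounded:
  assumes "\<gamma> > - 1 / 2" "\<bar>u\<bar> < 1"
  shows "\<bar>Pi_fun \<gamma> u\<bar> \<le> 1 / 2"
proof -
  have mono: "Pi_fun \<gamma> x \<le> Pi_fun \<gamma> y" if "- 1 < x" "x \<le> y" "y < 1" for x y
  proof (rule DERIV_nonneg_imp_nondecreasing[OF \<open>x \<le> y\<close>], intro exI conjI)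
    fix z assume "x \<le> z" "z \<le> y"
    then show "(Pi_fun \<gamma> has_real_derivative Pi_const \<gamma> * (1 - z\<^sup>2) powr (\<gamma> - 1 / 2)) (at z)"
      using that by (intro DERIV_Pi_fun) auto
    show "Pi_const \<gamma> * (1 - z\<^sup>2) powr (\<gamma> - 1 / 2) \<ge> 0" using Pi_const_pos[OF assms(1)] by simp
  qed
  have le: "Pi_fun \<gamma> x \<le> 1 / 2" if "\<bar>x\<bar> < 1" for x
  proof (rule tendsto_lowerbound[OF Pi_fun_tendsto[OF assms(1)]])
    show "\<forall>\<^sub>F y in at_left 1. Pi_fun \<gamma> x \<le> Pi_fun \<gamma> y"
    proof (rule eventually_mono[OF eventually_at_left_real[of x 1]])
      show "x < 1" using that by auto
      fix y assume "y \<in> {x<..<1}"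
      then show "Pi_fun \<gamma> x \<le> Pi_fun \<gamma> y" using that by (intro mono) auto
    qed
  qed simp
  show ?thesis using le[of u] le[of "- u"] assms(2) Pi_fun_minus[OF assms(2), of \<gamma>] by auto
qed

lemma Pi_const_Suc:
  assumes "\<alpha> > - 1" "\<alpha> < - 1 / 2"
  shows "Pi_const (\<alpha> + 1) = Pi_const \<alpha> / (2 * \<alpha> + 1) * (2 * \<alpha> + 2)"
proof -
  have "Gamma (\<alpha> + 1 + 1) = (\<alpha> + 1) * Gamma (\<alpha> + 1)"
    using assms by (intro Gamma_plus1) (auto elim!: nonpos_Ints_cases)
  moreover have "Gamma (\<alpha> + 1 / 2 + 1) = (\<alpha> + 1 / 2) * Gamma (\<alpha> + 1 / 2)"
  proof (intro Gamma_plus1 notI)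
    \<comment> \<open>Here \<alpha> + 1/2 lies in (-1/2, 0), which contains no integer.\<close>
    assume "\<alpha> + 1 / 2 \<in> \<int>\<^sub>\<le>\<^sub>0"
    then obtain n where "\<alpha> + 1 / 2 = of_int n" "n \<le> 0" by (auto elim!: nonpos_Ints_cases)
    note n = this
    have "real_of_int n \<le> real_of_int (- 1)" if "n \<noteq> 0" using that n(2) by (subst of_int_le_iff) simp
    with n assms show False by (cases "n = 0") auto
  qed
  moreover have "\<alpha> + 1 + 1 / 2 = \<alpha> + 1 / 2 + 1" by simp
  ultimately have "Pi_const (\<alpha> + 1) = (\<alpha> + 1) * Gamma (\<alpha> + 1) / (sqrt pi * ((\<alpha> + 1 / 2) * Gamma (\<alpha> + 1 / 2)))"
    unfolding Pi_const_def by (simp only:)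
  also have "\<dots> = (\<alpha> + 1) / (\<alpha> + 1 / 2) * Pi_const \<alpha>" by (simp add: Pi_const_def)
  also have "(\<alpha> + 1) / (\<alpha> + 1 / 2) = (2 * \<alpha> + 2) / (2 * \<alpha> + 1)"
    using assms by (simp add: frac_eq_eq) (simp add: algebra_simps)
  finally show ?thesis by simp
qed

text \<open>Shifts the parameter into the range where \<open>Pi_fun\<close> is bounded, at the cost of an explicit integrable term.\<close>

lemma Pi_fun_Suc:
  assumes "\<alpha> > - 1" "\<alpha> < - 1 / 2" "\<bar>u\<bar> < 1"
  shows "Pi_fun \<alpha> u = Pi_fun (\<alpha> + 1) u - Pi_const \<alpha> / (2 * \<alpha> + 1) * (u * (1 - u\<^sup>2) powr (\<alpha> + 1 / 2))"
proof (rule eq_on_unit_interval[where f = "Pi_fun \<alpha>"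
    and g = "\<lambda>u. Pi_fun (\<alpha> + 1) u - Pi_const \<alpha> / (2 * \<alpha> + 1) * (u * (1 - u\<^sup>2) powr (\<alpha> + 1 / 2))"
    and d = "\<lambda>u. Pi_const \<alpha> * (1 - u\<^sup>2) powr (\<alpha> - 1 / 2)"])
  fix u :: real assume u: "\<bar>u\<bar> < 1"
  show "(Pi_fun \<alpha> has_real_derivative Pi_const \<alpha> * (1 - u\<^sup>2) powr (\<alpha> - 1 / 2)) (at u)"
    using u by (rule DERIV_Pi_fun)
  have p: "1 - u\<^sup>2 > 0" using u abs_square_less_1[of u] by simp
  let ?P = "(1 - u\<^sup>2) powr (\<alpha> - 1 / 2)"
  have P: "(1 - u\<^sup>2) powr (\<alpha> + 1 / 2) = ?P * (1 - u\<^sup>2)"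
  proof -
    have e: "\<alpha> + 1 / 2 = (\<alpha> - 1 / 2) + 1" by simp
    show ?thesis unfolding e powr_add using p by simp
  qed
  define Q where "Q = Pi_const \<alpha> / (2 * \<alpha> + 1)"
  have C0: "Pi_const \<alpha> = Q * (2 * \<alpha> + 1)" using assms by (simp add: Q_def)
  have C: "Pi_const (\<alpha> + 1) = Q * (2 * \<alpha> + 2)"
    using Pi_const_Suc[OF assms(1,2)] by (simp add: Q_def)
  \<comment> \<open>The explicit term comes from d/du u (1-u^2)^(\<alpha>+1/2) = (2\<alpha>+2)
    (1-u^2)^(\<alpha>+1/2) - (2\<alpha>+1) (1-u^2)^(\<alpha>-1/2).\<close>
  have "((\<lambda>u. Pi_fun (\<alpha> + 1) u - Pi_const \<alpha> / (2 * \<alpha> + 1) * (u * (1 - u\<^sup>2) powr (\<alpha> + 1 / 2))) has_real_derivative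
     Pi_const (\<alpha> + 1) * (1 - u\<^sup>2) powr (\<alpha> + 1 - 1 / 2) -
       Pi_const \<alpha> / (2 * \<alpha> + 1) * ((1 - u\<^sup>2) powr (\<alpha> + 1 / 2) + u * ((\<alpha> + 1 / 2) * ?P * (- 2 * u)))) (at u)"
  proof -
    have "((\<lambda>u. (1 - u\<^sup>2) powr (\<alpha> + 1 / 2)) has_real_derivative
        (\<alpha> + 1 / 2) * (1 - u\<^sup>2) powr (\<alpha> + 1 / 2 - of_nat 1) * (- 2 * u)) (at u)"
      using p by (intro DERIV_fun_powr) (auto intro!: derivative_eq_intros)
    moreover have "\<alpha> + 1 / 2 - of_nat 1 = \<alpha> - 1 / 2" by simp
    ultimately have d: "((\<lambda>u. (1 - u\<^sup>2) powr (\<alpha> + 1 / 2)) has_real_derivative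
        (\<alpha> + 1 / 2) * ?P * (- 2 * u)) (at u)" by (simp only:)
    show ?thesis
      using DERIV_diff[OF DERIV_Pi_fun[OF u] DERIV_cmult[OF DERIV_mult[OF DERIV_ident d]], of "\<alpha> + 1" "Pi_const \<alpha> / (2 * \<alpha> + 1)"]
      by (simp add: mult_ac add_ac)
  qed
  also have "Pi_const (\<alpha> + 1) * (1 - u\<^sup>2) powr (\<alpha> + 1 - 1 / 2) -
       Pi_const \<alpha> / (2 * \<alpha> + 1) * ((1 - u\<^sup>2) powr (\<alpha> + 1 / 2) + u * ((\<alpha> + 1 / 2) * ?P * (- 2 * u))) = Pi_const \<alpha> * ?P"
  proof -
    have e: "\<alpha> + 1 - 1 / 2 = \<alpha> + 1 / 2" by simp
    show ?thesis unfolding e P C Q_def[symmetric] unfolding C0 by (simp add: algebra_simps power2_eq_square)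
  qed
  finally show "((\<lambda>u. Pi_fun (\<alpha> + 1) u - Pi_const \<alpha> / (2 * \<alpha> + 1) * (u * (1 - u\<^sup>2) powr (\<alpha> + 1 / 2))) has_real_derivative
      Pi_const \<alpha> * ?P) (at u)" .
qed (use assms in \<open>simp_all add: Pi_fun_0\<close>)

lemma continuous_on_Pi_fun: "continuous_on {-1<..<1} (Pi_fun \<gamma>)"
  by (auto intro!: continuous_at_imp_continuous_on DERIV_isCont[OF DERIV_Pi_fun])

lemma Pi_fun_measurable [measurable]: "(\<lambda>u. indicator {-1<..<1} u * Pi_fun \<gamma> u) \<in> borel_measurable borel"
  using borel_measurable_continuous_on_indicator[OF _ continuous_on_Pi_fun[of \<gamma>]] by simp

section \<open>Integration by parts against \<open>Pi_fun\<close>\<close>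

lemma has_bochner_integral_lborel_I:
  fixes f :: "real \<Rightarrow> real"
  shows "has_bochner_integral lborel_I f x \<longleftrightarrow> has_bochner_integral lborel (\<lambda>u. indicator {-1<..<1} u * f u) x"
  unfolding lborel_I_def has_bochner_integral_iff
  by (simp add: integrable_restrict_space integral_restrict_space)

text \<open>Integration by parts of u^i \<open>Pi_fun\<close> over (-1, 1): the limits 1/2 at 1 and
  -(-1)^i/2 at -1 give the first term, and the derivative of \<open>Pi_fun\<close> gives the
  moment.\<close>

lemma has_bochner_integral_Pi_fun_deriv_power:
  assumes "\<gamma> > - 1 / 2"
  shows "has_bochner_integral lborel_I (\<lambda>u. real i * u ^ (i - 1) * Pi_fun \<gamma> u) ((1 + (- 1) ^ i) / 2 - Pi_moment \<gamma> i)"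
proof -
  let ?S = "{-1<..<1} :: real set"
  have 1: "integrable lborel (\<lambda>u. indicator ?S u * (real i * u ^ (i - 1) * Pi_fun \<gamma> u))"
  proof (rule Bochner_Integration.integrable_bound)
    show "integrable lborel (\<lambda>u. indicator ?S u * real i)" by simp
    have "(\<lambda>u. real i * u ^ (i - 1) * (indicator ?S u * Pi_fun \<gamma> u)) \<in> borel_measurable borel" by measurable
    then show "(\<lambda>u. indicator ?S u * (real i * u ^ (i - 1) * Pi_fun \<gamma> u)) \<in> borel_measurable lborel"
      by (simp add: mult_ac)
    show "AE u in lborel. norm (indicator ?S u * (real i * u ^ (i - 1) * Pi_fun \<gamma> u)) \<le> norm (indicator ?S u * real i)"
    proof (rule AE_I2)
      fix u :: real
      show "norm (indicator ?S u * (real i * u ^ (i - 1) * Pi_fun \<gamma> u)) \<le> norm (indicator ?S u * real i)"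
      proof (cases "\<bar>u\<bar> < 1")
        case True
        then have "\<bar>u\<bar> ^ (i - 1) * \<bar>Pi_fun \<gamma> u\<bar> \<le> 1 * 1"
          using Pi_fun_bounded[OF assms True] by (intro mult_mono power_le_one) auto
        then show ?thesis by (auto simp: indicator_def abs_mult power_abs mult.assoc intro!: mult_left_le)
      qed (auto simp: indicator_def)
    qed
  qed
  have 2: "has_bochner_integral lborel (\<lambda>u. indicator ?S u * (Pi_const \<gamma> * (1 - u\<^sup>2) powr (\<gamma> - 1 / 2) * u ^ i)) (Pi_moment \<gamma> i)"
    using has_bochner_integral_rho_moment[OF assms, of i] by (simp add: rho_def mult_ac)
  let ?F = "\<lambda>u. u ^ i * Pi_fun \<gamma> u"
  let ?f = "\<lambda>u. real i * u ^ (i - 1) * Pi_fun \<gamma> u + Pi_const \<gamma> * (1 - u\<^sup>2) powr (\<gamma> - 1 / 2) * u ^ i"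
  have right: "(?F \<longlongrightarrow> 1 / 2) (at_left 1)"
    by (auto intro!: tendsto_eq_intros Pi_fun_tendsto assms)
  \<comment> \<open>The limit at -1 is reflected to the one at 1 by oddness.\<close>
  have left: "(?F \<longlongrightarrow> (- 1) ^ i * (- 1 / 2)) (at_right (- 1))"
  proof -
    have "((\<lambda>u. (- u) ^ i * - Pi_fun \<gamma> u) \<longlongrightarrow> (- 1) ^ i * (- 1 / 2)) (at_left 1)"
      by (auto intro!: tendsto_eq_intros Pi_fun_tendsto assms)
    moreover have "\<forall>\<^sub>F u in at_left 1. (- u) ^ i * - Pi_fun \<gamma> u = ?F (- u)"
      using eventually_at_left_real[of 0 1] by (auto elim!: eventually_mono simp: Pi_fun_minus)
    ultimately have "((\<lambda>u. ?F (- u)) \<longlongrightarrow> (- 1) ^ i * (- 1 / 2)) (at_left 1)"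
      by (rule Lim_transform_eventually)
    then have "filterlim (\<lambda>u. ?F (- u)) (nhds ((- 1) ^ i * (- 1 / 2))) (at_left (- (- 1)))" by simp
    then show ?thesis by (subst at_right_minus[of "- 1"], subst filterlim_filtermap)
  qed
  have "(LBINT u=ereal (-1)..ereal 1. ?f u) = 1 / 2 - (- 1) ^ i * (- 1 / 2)"
  proof (rule interval_integral_FTC_integrable)
    show "(?F has_vector_derivative ?f u) (at u)" if "ereal (- 1) < ereal u" "ereal u < ereal 1" for u
      using that unfolding has_real_derivative_iff_has_vector_derivative[symmetric]
      using DERIV_mult[OF DERIV_pow[of i u] DERIV_Pi_fun[of u \<gamma>]] by (simp add: mult_ac abs_less_iff)
    show "isCont ?f u" if "ereal (- 1) < ereal u" "ereal u < ereal 1" for u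
    proof -
      have n: "1 - u\<^sup>2 \<noteq> 0" using that abs_square_less_1[of u] by auto
      have 1: "isCont (\<lambda>u. real i * u ^ (i - 1)) u" by (intro continuous_intros)
      have 2: "isCont (Pi_fun \<gamma>) u" using that by (intro DERIV_isCont[OF DERIV_Pi_fun]) auto
      have 3: "isCont (\<lambda>u. Pi_const \<gamma> * (1 - u\<^sup>2) powr (\<gamma> - 1 / 2)) u"
        using n by (intro continuous_intros) simp_all
      have 4: "isCont (\<lambda>u. u ^ i) u" by (intro continuous_intros)
      show ?thesis
        by (rule continuous_add[OF continuous_mult[OF 1 2] continuous_mult[OF 3 4]])
    qed
    have "integrable lborel (\<lambda>u. indicator ?S u * (real i * u ^ (i - 1) * Pi_fun \<gamma> u) +
        indicator ?S u * (Pi_const \<gamma> * (1 - u\<^sup>2) powr (\<gamma> - 1 / 2) * u ^ i))"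
      using 1 2 by (intro Bochner_Integration.integrable_add) (auto simp: has_bochner_integral_iff)
    moreover have "einterval (ereal (- 1)) (ereal 1) = ?S" by (auto simp: einterval_def)
    ultimately show "set_integrable lborel (einterval (ereal (- 1)) (ereal 1)) ?f"
      unfolding set_integrable_def real_scaleR_def distrib_left by (simp only:)
  qed (use left right in \<open>simp_all add: ereal_tendsto_simps\<close>)
  then have "(\<integral>u. indicator ?S u * ?f u \<partial>lborel) = (1 + (- 1) ^ i) / 2"
    by (simp add: interval_lebesgue_integral_def set_lebesgue_integral_def)
  moreover have "(\<integral>u. indicator ?S u * ?f u \<partial>lborel) =
      (\<integral>u. indicator ?S u * (real i * u ^ (i - 1) * Pi_fun \<gamma> u) \<partial>lborel) + Pi_moment \<gamma> i"
    using 1 2 unfolding distrib_left has_bochner_integral_iff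
    by (subst Bochner_Integration.integral_add) simp_all
  ultimately have "(\<integral>u. indicator ?S u * (real i * u ^ (i - 1) * Pi_fun \<gamma> u) \<partial>lborel) =
      (1 + (- 1) ^ i) / 2 - Pi_moment \<gamma> i" by linarith
  with 1 have "has_bochner_integral lborel (\<lambda>u. indicator ?S u * (real i * u ^ (i - 1) * Pi_fun \<gamma> u))
      ((1 + (- 1) ^ i) / 2 - Pi_moment \<gamma> i)"
    unfolding has_bochner_integral_iff by (intro conjI)
  then show ?thesis unfolding has_bochner_integral_lborel_I .
qed

lemma has_bochner_integral_Pi_fun_deriv_power':
  assumes "\<alpha> > - 1" "\<alpha> < - 1 / 2"
  shows "has_bochner_integral lborel_I (\<lambda>u. real i * u ^ (i - 1) * Pi_fun \<alpha> u) ((1 + (- 1) ^ i) / 2 - Pi_moment \<alpha> i)"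
proof -
  define Q where "Q = Pi_const \<alpha> / (2 * \<alpha> + 1)"
  have C: "Pi_const (\<alpha> + 1) = Q * (2 * \<alpha> + 2)" using Pi_const_Suc[OF assms] by (simp add: Q_def)
  have \<gamma>: "\<alpha> + 1 > - 1 / 2" using assms by simp
  \<comment> \<open>Dividing by 2\<alpha>+2 turns \<open>Pi_const (\<alpha> + 1)\<close> into
    \<open>Q\<close>, the constant of the explicit term.\<close>
  have "has_bochner_integral lborel (\<lambda>u. real i / (2 * \<alpha> + 2) * (Pi_const (\<alpha> + 1) * rho (\<alpha> + 1) u * u ^ i))
      (real i / (2 * \<alpha> + 2) * Pi_moment (\<alpha> + 1) i)"
    by (intro has_bochner_integral_mult_right has_bochner_integral_rho_moment \<gamma>)
  also have "(\<lambda>u. real i / (2 * \<alpha> + 2) * (Pi_const (\<alpha> + 1) * rho (\<alpha> + 1) u * u ^ i)) =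
      (\<lambda>u. indicator {-1<..<1} u * (real i * Q * (1 - u\<^sup>2) powr (\<alpha> + 1 / 2) * u ^ i))"
  proof
    fix u
    have "\<alpha> + 1 - 1 / 2 = \<alpha> + 1 / 2" "2 * \<alpha> + 2 \<noteq> 0" using assms by auto
    then show "real i / (2 * \<alpha> + 2) * (Pi_const (\<alpha> + 1) * rho (\<alpha> + 1) u * u ^ i) =
      indicator {-1<..<1} u * (real i * Q * (1 - u\<^sup>2) powr (\<alpha> + 1 / 2) * u ^ i)"
      unfolding C rho_def by (simp add: add.commute)
  qed
  finally have 1: "has_bochner_integral lborel_I (\<lambda>u. real i * Q * (1 - u\<^sup>2) powr (\<alpha> + 1 / 2) * u ^ i)
      (real i / (2 * \<alpha> + 2) * Pi_moment (\<alpha> + 1) i)"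
    unfolding has_bochner_integral_lborel_I .
  \<comment> \<open>The moments for \<alpha> and \<alpha>+1 differ by the factor
    (\<alpha>+1+m)/(\<alpha>+1) = 1 + i/(2\<alpha>+2), where i = 2m.\<close>
  have 2: "Pi_moment (\<alpha> + 1) i + real i / (2 * \<alpha> + 2) * Pi_moment (\<alpha> + 1) i = Pi_moment \<alpha> i"
  proof (cases "even i")
    case True
    then obtain m where i: "i = 2 * m" by blast
    have "(\<alpha> + 1) * pochhammer (\<alpha> + 2) m = pochhammer (\<alpha> + 1) m * (\<alpha> + 1 + real m)"
      using pochhammer_rec[of "\<alpha> + 1" m] pochhammer_rec'[of "\<alpha> + 1" m] by (simp add: add.assoc mult.commute)
    moreover have "pochhammer (\<alpha> + 2) m > 0" "pochhammer (\<alpha> + 1) m > 0" using assms by (simp_all add: pochhammer_pos)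
    ultimately have "(\<alpha> + 1 + real m) / (\<alpha> + 1) / pochhammer (\<alpha> + 2) m = 1 / pochhammer (\<alpha> + 1) m"
      using assms by (simp add: divide_simps)
    moreover have "(\<alpha> + 1 + real m) / (\<alpha> + 1) = 1 + real i / (2 * \<alpha> + 2)"
      using assms by (simp add: i divide_simps) (simp add: algebra_simps)
    moreover have "\<alpha> + 1 + 1 = \<alpha> + 2" by simp
    ultimately have "pochhammer (1 / 2) m * ((1 + real i / (2 * \<alpha> + 2)) / pochhammer (\<alpha> + 1 + 1) m) =
        pochhammer (1 / 2) m * (1 / pochhammer (\<alpha> + 1) m)" by (simp only:)
    then show ?thesis by (simp add: Pi_moment_def i algebra_simps add_divide_distrib)
  qed (simp add: Pi_moment_def)
  have "has_bochner_integral lborel_I (\<lambda>u. real i * u ^ (i - 1) * Pi_fun (\<alpha> + 1) u - real i * Q * (1 - u\<^sup>2) powr (\<alpha> + 1 / 2) * u ^ i)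
     ((1 + (- 1) ^ i) / 2 - Pi_moment (\<alpha> + 1) i - real i / (2 * \<alpha> + 2) * Pi_moment (\<alpha> + 1) i)"
    by (intro has_bochner_integral_diff has_bochner_integral_Pi_fun_deriv_power \<gamma> 1)
  also have "(1 + (- 1) ^ i) / 2 - Pi_moment (\<alpha> + 1) i - real i / (2 * \<alpha> + 2) * Pi_moment (\<alpha> + 1) i =
      (1 + (- 1) ^ i) / 2 - Pi_moment \<alpha> i"
    using 2 by linarith
  finally show ?thesis
  proof (subst (asm) has_bochner_integral_cong[OF refl _ refl])
    fix u assume "u \<in> space lborel_I"
    then have u: "\<bar>u\<bar> < 1" by (auto simp: lborel_I_def space_restrict_space)
    show "real i * u ^ (i - 1) * Pi_fun (\<alpha> + 1) u - real i * Q * (1 - u\<^sup>2) powr (\<alpha> + 1 / 2) * u ^ i =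
        real i * u ^ (i - 1) * Pi_fun \<alpha> u"
      unfolding Pi_fun_Suc[OF assms u] Q_def[symmetric]
      \<comment> \<open>For i = 0 both sides vanish; otherwise u * u^(i-1) = u^i.\<close>
      by (cases i) (simp_all add: algebra_simps)
  qed
qed

section \<open>The product formula for Jacobi polynomials\<close>

text \<open>The Jacobi differential operator in the variable \<open>y = sin^2 (\<theta>/2)\<close>.\<close>

definition jacobi_op :: "real \<Rightarrow> real \<Rightarrow> real poly \<Rightarrow> real poly" where
  "jacobi_op \<alpha> \<beta> p = [:0, 1, -1:] * pderiv (pderiv p) + [:\<alpha> + 1, - (\<alpha> + \<beta> + 2):] * pderiv p"

lemma coeff_jacobi_op:
  "coeff (jacobi_op \<alpha> \<beta> p) k =
     (real k + 1) * (real k + \<alpha> + 1) * coeff p (Suc k) - real k * (real k + \<alpha> + \<beta> + 1) * coeff p k"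
proof (cases k)
  case 0
  then show ?thesis by (simp add: jacobi_op_def coeff_pderiv)
next
  case (Suc j)
  then show ?thesis
    by (cases j) (simp_all add: jacobi_op_def coeff_pderiv algebra_simps)
qed

text \<open>Comparing coefficients gives a first-order recurrence whose leading factor
  (k+1)(k+\<alpha>+1) never vanishes, so the constant term fixes everything. The cross-multiplied
  form also covers a vanishing constant term.\<close>

lemma jacobi_op_eigen_unique:
  assumes "jacobi_op \<alpha> \<beta> p = smult c p" "jacobi_op \<alpha> \<beta> q = smult c q" "\<alpha> > -1"
  shows "smult (coeff q 0) p = smult (coeff p 0) q"
proof -
  have rec: "coeff f (Suc k) =
      (c + real k * (real k + \<alpha> + \<beta> + 1)) / ((real k + 1) * (real k + \<alpha> + 1)) * coeff f k"
    if "jacobi_op \<alpha> \<beta> f = smult c f" for f k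
  proof -
    have "(real k + 1) * (real k + \<alpha> + 1) * coeff f (Suc k)
        = (c + real k * (real k + \<alpha> + \<beta> + 1)) * coeff f k"
      using arg_cong[OF that, of "\<lambda>p. coeff p k"] by (simp add: coeff_jacobi_op algebra_simps)
    moreover have "(real k + 1) * (real k + \<alpha> + 1) > 0"
      using assms(3) by (intro mult_pos_pos) auto
    ultimately show ?thesis by (simp add: field_simps)
  qed
  have "coeff q 0 * coeff p k = coeff p 0 * coeff q k" for k
    by (induction k) (simp_all add: rec[OF assms(1)] rec[OF assms(2)] mult.left_commute)
  then show ?thesis by (intro poly_eqI) simp
qed

lemma jacobi_op_sum: "jacobi_op \<alpha> \<beta> (\<Sum>i\<in>A. f i) = (\<Sum>i\<in>A. jacobi_op \<alpha> \<beta> (f i))"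
  by (intro poly_eqI) (simp add: coeff_jacobi_op coeff_sum sum_distrib_left sum_subtractf)

lemma jacobi_op_smult: "jacobi_op \<alpha> \<beta> (smult c p) = smult c (jacobi_op \<alpha> \<beta> p)"
  by (intro poly_eqI) (simp add: coeff_jacobi_op algebra_simps)

text \<open>Both Rodrigues' expansion and the F4 sum are combinations of these unnormalized
  Bernstein polynomials, so one formula for the operator serves both.\<close>

definition bernstein :: "nat \<Rightarrow> nat \<Rightarrow> real poly" where
  "bernstein i j = [:0, 1:] ^ i * [:1, -1:] ^ j"

lemma poly_bernstein [simp]: "poly (bernstein i j) x = x ^ i * (1 - x) ^ j"
  by (simp add: bernstein_def poly_power)

text \<open>All three terms keep the total degree i + j, so the operator is tridiagonal in each
  degree. The truncated exponents are harmless, as their factors vanish for i = 0 or j = 0.\<close>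

lemma poly_jacobi_op_bernstein:
  "poly (jacobi_op \<alpha> \<beta> (bernstein i j)) x =
     real i * (real i + \<alpha>) * (x ^ (i - 1) * (1 - x) ^ Suc j)
   + real j * (real j + \<beta>) * (x ^ Suc i * (1 - x) ^ (j - 1))
   - (2 * real i * real j + real j * (\<alpha> + 1) + real i * (\<beta> + 1)) * (x ^ i * (1 - x) ^ j)"
proof -
  have X: "poly (pderiv ([:0, 1:] ^ n)) y = real n * y ^ (n - 1)" for n and y :: real
    by (simp add: pderiv_power poly_power pderiv_pCons)
  have Y: "poly (pderiv ([:1, -1:] ^ n)) y = - (real n * (1 - y) ^ (n - 1))" for n and y :: real
    by (simp add: pderiv_power poly_power pderiv_pCons)
  have XX: "poly (pderiv (pderiv ([:0, 1:] ^ n))) y = real n * real (n - 1) * y ^ (n - 2)"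
    for n and y :: real
    by (cases n; cases "n - 1")
       (simp_all add: pderiv_power poly_power pderiv_pCons pderiv_mult pderiv_smult del: power_Suc)
  have YY: "poly (pderiv (pderiv ([:1, -1:] ^ n))) y = real n * real (n - 1) * (1 - y) ^ (n - 2)"
    for n and y :: real
    by (cases n; cases "n - 1")
       (simp_all add: pderiv_power poly_power pderiv_pCons pderiv_mult pderiv_smult pderiv_minus del: power_Suc)
  have D1: "poly (pderiv (bernstein i j)) x =
      real i * x ^ (i - 1) * (1 - x) ^ j - real j * x ^ i * (1 - x) ^ (j - 1)"
    by (simp add: bernstein_def pderiv_mult X Y poly_power del: mult_pCons_right mult_pCons_left)
  have D2: "poly (pderiv (pderiv (bernstein i j))) x =
      real i * real (i - 1) * x ^ (i - 2) * (1 - x) ^ j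
      - 2 * real i * real j * x ^ (i - 1) * (1 - x) ^ (j - 1)
      + real j * real (j - 1) * x ^ i * (1 - x) ^ (j - 2)"
    by (simp add: bernstein_def pderiv_mult pderiv_add X Y XX YY poly_power
         del: mult_pCons_right mult_pCons_left)
  \<comment> \<open>The truncated exponents i - 2 and j - 2 make 0 and 1 separate cases.\<close>
  have I: "i = 0 \<or> i = 1 \<or> (\<exists>m. i = Suc (Suc m))" and J: "j = 0 \<or> j = 1 \<or> (\<exists>m. j = Suc (Suc m))"
    by presburger+
  have E: "poly (jacobi_op \<alpha> \<beta> (bernstein i j)) x =
      x * (1 - x) * poly (pderiv (pderiv (bernstein i j))) x
      + (\<alpha> + 1 - (\<alpha> + \<beta> + 2) * x) * poly (pderiv (bernstein i j)) x"
    by (simp add: jacobi_op_def algebra_simps)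
  show ?thesis
    unfolding E D1 D2
    using I J by (elim disjE exE; simp add: ring_distribs; (simp add: algebra_simps; fail)?)
qed

text \<open>The Jacobi polynomial as a polynomial in \<open>y = sin^2 (\<theta>/2)\<close>, so that \<open>cos \<theta> = 1 - 2 y\<close>.\<close>

definition jac :: "real \<Rightarrow> real \<Rightarrow> nat \<Rightarrow> real poly" where
  "jac \<alpha> \<beta> n = (\<Sum>k\<le>n. smult ((-1) ^ k * ((real n + \<alpha>) gchoose (n - k)) * ((real n + \<beta>) gchoose k))
     (bernstein k (n - k)))"

lemma jacobi_poly_cos: "jacobi_poly \<alpha> \<beta> n (cos \<theta>) = poly (jac \<alpha> \<beta> n) ((sin (\<theta> / 2))\<^sup>2)"
proof -
  have c: "cos \<theta> = 1 - 2 * (sin (\<theta> / 2))\<^sup>2"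
    using cos_double_sin[of "\<theta> / 2"] by simp
  have "(cos \<theta> - 1) / 2 = - (sin (\<theta> / 2))\<^sup>2" "(cos \<theta> + 1) / 2 = 1 - (sin (\<theta> / 2))\<^sup>2"
    using c by simp_all
  note this[THEN arg_cong, of "\<lambda>x. x ^ k" for k]
  then show ?thesis
    unfolding jacobi_poly_def jac_def poly_sum
    by (intro sum.cong refl) (simp only: poly_smult poly_bernstein power_minus[of "(sin (\<theta> / 2))\<^sup>2"] mult_ac)
qed

text \<open>Index shifts keep the range 0..n; this is used for the raised and lowered terms of the
  operator.\<close>

lemma sum_shift_vanishing:
  fixes g :: "nat \<Rightarrow> 'a::comm_monoid_add"
  assumes "g 0 = 0" "g (Suc n) = 0"
  shows "(\<Sum>i\<le>n. g (Suc i)) = (\<Sum>i\<le>n. g i)"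
proof -
  have "(\<Sum>i\<le>n. g (Suc i)) = (\<Sum>i\<le>Suc n. g i)"
    by (simp only: sum.atMost_Suc_shift assms(1) add_0)
  then show ?thesis using assms(2) by simp
qed

lemma gbinomial_Suc_mult: "(a gchoose Suc k) * (real k + 1) = (a gchoose k) * (a - real k)" for a :: real
  using gbinomial_absorption[of k a] gbinomial_absorb_comp[of a k]
  by (simp add: gbinomial_mult_1 algebra_simps)

text \<open>By the recurrence \<open>estep\<close>, the lowering term from k+1 and the raising term
  from k-1 both become multiples of term k, with factors -(n-k)(n-k+\<beta>) and -k(k+\<alpha>).
  Together with the diagonal factor they give -n(n+\<alpha>+\<beta>+1).\<close>

lemma jacobi_op_jac:
  "jacobi_op \<alpha> \<beta> (jac \<alpha> \<beta> n) = smult (- (real n * (real n + \<alpha> + \<beta> + 1))) (jac \<alpha> \<beta> n)"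
proof -
  define e where "e k = (-1) ^ k * ((real n + \<alpha>) gchoose (n - k)) * ((real n + \<beta>) gchoose k)" for k
  have estep: "e (Suc k) * ((real k + 1) * (real k + 1 + \<alpha>)) = - e k * ((real n - real k) * (real n - real k + \<beta>))"
    if "k < n" for k
  proof -
    have 1: "((real n + \<alpha>) gchoose (n - k)) * (real n - real k) =
             ((real n + \<alpha>) gchoose (n - Suc k)) * (real k + 1 + \<alpha>)"
      using gbinomial_Suc_mult[of "real n + \<alpha>" "n - Suc k"] that
      by (simp add: Suc_diff_Suc of_nat_diff algebra_simps)
    have 2: "((real n + \<beta>) gchoose Suc k) * (real k + 1) = ((real n + \<beta>) gchoose k) * (real n - real k + \<beta>)"
      using gbinomial_Suc_mult[of "real n + \<beta>" k] by (simp add: algebra_simps)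
    have "e (Suc k) * ((real k + 1) * (real k + 1 + \<alpha>)) =
       - ((-1) ^ k) * (((real n + \<alpha>) gchoose (n - Suc k)) * (real k + 1 + \<alpha>)) * (((real n + \<beta>) gchoose Suc k) * (real k + 1))"
      by (simp add: e_def algebra_simps)
    also have "\<dots> = - e k * ((real n - real k) * (real n - real k + \<beta>))"
      unfolding 1[symmetric] 2 by (simp add: e_def algebra_simps)
    finally show ?thesis .
  qed
  have "poly (jacobi_op \<alpha> \<beta> (jac \<alpha> \<beta> n)) x = - (real n * (real n + \<alpha> + \<beta> + 1)) * poly (jac \<alpha> \<beta> n) x" for x
  proof -
    let ?b = "\<lambda>k. x ^ k * (1 - x) ^ (n - k)"
    let ?m = "\<lambda>k. 2 * real k * (real n - real k) + (real n - real k) * (\<alpha> + 1) + real k * (\<beta> + 1)"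
    \<comment> \<open>\<open>g\<close> holds the lowering terms, indexed by their source;
      \<open>h\<close> holds the raising terms, indexed by the power of x produced. Both vanish at 0
      and at n + 1.\<close>
    define g where "g k = (if k \<le> n then e k * (real k * (real k + \<alpha>) * (x ^ (k - 1) * (1 - x) ^ Suc (n - k))) else 0)" for k
    define h where "h k = (if k = 0 then 0 else e (k - 1) * ((real n - real (k - 1)) * (real n - real (k - 1) + \<beta>) * ?b k))" for k
    have g: "g (Suc k) = - e k * ((real n - real k) * (real n - real k + \<beta>)) * ?b k" if "k \<le> n" for k
    proof (cases "k < n")
      case True
      then have "g (Suc k) = (e (Suc k) * ((real k + 1) * (real k + 1 + \<alpha>))) * ?b k"
        by (simp add: g_def Suc_diff_Suc del: power_Suc) (simp add: algebra_simps)
      then show ?thesis using estep[OF True] by simp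
    qed (use that in \<open>auto simp: g_def\<close>)
    have h: "h k = - e k * (real k * (real k + \<alpha>)) * ?b k" if "k \<le> n" for k
    proof (cases k)
      case (Suc l)
      then have "h k = (e l * ((real n - real l) * (real n - real l + \<beta>))) * ?b k" by (simp add: h_def)
      also have "e l * ((real n - real l) * (real n - real l + \<beta>)) =
          - (e (Suc l) * ((real l + 1) * (real l + 1 + \<alpha>)))"
        using estep[of l] Suc that by simp
      finally show ?thesis using Suc by (simp add: add.commute)
    qed (simp add: h_def)
    have "poly (jacobi_op \<alpha> \<beta> (jac \<alpha> \<beta> n)) x = (\<Sum>k\<le>n. e k * poly (jacobi_op \<alpha> \<beta> (bernstein k (n - k))) x)"
      by (simp add: jac_def jacobi_op_sum jacobi_op_smult poly_sum e_def)
    also have "\<dots> = (\<Sum>k\<le>n. g k + h (Suc k) - e k * ?m k * ?b k)"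
    proof (intro sum.cong refl)
      fix k assume "k \<in> {..n}"
      then have k: "k \<le> n" by simp
      have "n - Suc k = n - k - 1" by simp
      with k show "e k * poly (jacobi_op \<alpha> \<beta> (bernstein k (n - k))) x = g k + h (Suc k) - e k * ?m k * ?b k"
        unfolding poly_jacobi_op_bernstein by (simp add: g_def h_def of_nat_diff algebra_simps)
    qed
    also have "\<dots> = (\<Sum>k\<le>n. g k) + (\<Sum>k\<le>n. h (Suc k)) - (\<Sum>k\<le>n. e k * ?m k * ?b k)"
      by (simp add: sum.distrib sum_subtractf)
    also have "(\<Sum>k\<le>n. g k) = (\<Sum>k\<le>n. g (Suc k))"
      by (intro sum_shift_vanishing[symmetric]) (simp_all add: g_def)
    also have "(\<Sum>k\<le>n. h (Suc k)) = (\<Sum>k\<le>n. h k)"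
      by (intro sum_shift_vanishing) (simp_all add: h_def)
    also have "(\<Sum>k\<le>n. g (Suc k)) + (\<Sum>k\<le>n. h k) - (\<Sum>k\<le>n. e k * ?m k * ?b k) =
       (\<Sum>k\<le>n. - (real n * (real n + \<alpha> + \<beta> + 1)) * (e k * ?b k))"
      unfolding sum.distrib[symmetric] sum_subtractf[symmetric]
      by (intro sum.cong refl) (simp add: g h algebra_simps)
    also have "\<dots> = - (real n * (real n + \<alpha> + \<beta> + 1)) * poly (jac \<alpha> \<beta> n) x"
      by (simp add: jac_def poly_sum e_def sum_distrib_left)
    finally show ?thesis .
  qed
  then show ?thesis by (intro poly_eqI_degree[of UNIV] iffD1[OF poly_eq_poly_eq_iff]) auto
qed

section \<open>The Appell F4 sum and the product formula\<close>

definition F4_coeff :: "real \<Rightarrow> real \<Rightarrow> nat \<Rightarrow> nat \<Rightarrow> real" where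
  "F4_coeff \<alpha> \<beta> i j = 1 / (fact i * fact j * pochhammer (\<alpha> + 1) i * pochhammer (\<beta> + 1) j)"

text \<open>The Appell function \<open>F4 (-n, n+\<alpha>+\<beta>+1; \<alpha>+1, \<beta>+1; x y, (1-x) (1-y))\<close>, as a polynomial in \<open>x\<close>.
  The factor \<open>(-n)_(i+j)\<close> vanishes for \<open>i + j > n\<close>, which allows summation over a square.\<close>

definition F4_poly :: "real \<Rightarrow> real \<Rightarrow> nat \<Rightarrow> real \<Rightarrow> real poly" where
  "F4_poly \<alpha> \<beta> n y = (\<Sum>i\<le>n. \<Sum>j\<le>n. smult
     (pochhammer (- real n) (i + j) * pochhammer (real n + \<alpha> + \<beta> + 1) (i + j) * F4_coeff \<alpha> \<beta> i j
       * y ^ i * (1 - y) ^ j) (bernstein i j))"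

lemma F4_coeff_Suc_left:
  assumes "\<alpha> > -1"
  shows "(real i + 1) * (\<alpha> + 1 + real i) * F4_coeff \<alpha> \<beta> (Suc i) j = F4_coeff \<alpha> \<beta> i j"
proof -
  have "\<alpha> + 1 + real i > 0" using assms by simp
  moreover have "F4_coeff \<alpha> \<beta> (Suc i) j = F4_coeff \<alpha> \<beta> i j / ((real i + 1) * (\<alpha> + 1 + real i))"
    by (simp add: F4_coeff_def pochhammer_rec' add.commute[of 1 "real i"] mult_ac)
  ultimately show ?thesis by simp
qed

lemma F4_coeff_commute: "F4_coeff \<alpha> \<beta> i j = F4_coeff \<beta> \<alpha> j i"
  by (simp add: F4_coeff_def mult_ac)

lemma F4_coeff_Suc_right:
  assumes "\<beta> > -1"
  shows "(real j + 1) * (\<beta> + 1 + real j) * F4_coeff \<alpha> \<beta> i (Suc j) = F4_coeff \<alpha> \<beta> i j"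
  using F4_coeff_Suc_left[OF assms, of j \<alpha> i] by (simp add: F4_coeff_commute[of \<alpha>])

lemma jacobi_op_F4_poly:
  assumes "\<alpha> > -1" "\<beta> > -1"
  shows "jacobi_op \<alpha> \<beta> (F4_poly \<alpha> \<beta> n y) =
    smult (- (real n * (real n + \<alpha> + \<beta> + 1))) (F4_poly \<alpha> \<beta> n y)"
proof -
  define d where "d N = pochhammer (- real n) N * pochhammer (real n + \<alpha> + \<beta> + 1) N" for N
  have d0: "d N = 0" if "N > n" for N
    using that by (simp add: d_def pochhammer_of_nat_eq_0_iff)
  have dS: "d (Suc N) = (real N * (real N + \<alpha> + \<beta> + 1) - real n * (real n + \<alpha> + \<beta> + 1)) * d N" for N
    by (simp add: d_def pochhammer_rec' algebra_simps)
  have "poly (jacobi_op \<alpha> \<beta> (F4_poly \<alpha> \<beta> n y)) x =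
      - (real n * (real n + \<alpha> + \<beta> + 1)) * poly (F4_poly \<alpha> \<beta> n y) x" for x
  proof -
    let ?c = "F4_coeff \<alpha> \<beta>"
    define T where "T i j = ?c i j * (x * y) ^ i * ((1 - x) * (1 - y)) ^ j" for i j
    define g where "g i j = d (i + j) * (real i * (real i + \<alpha>) * ?c i j) *
      (x ^ (i - 1) * (1 - x) ^ Suc j * y ^ i * (1 - y) ^ j)" for i j
    define h where "h i j = d (i + j) * (real j * (real j + \<beta>) * ?c i j) *
      (x ^ Suc i * (1 - x) ^ (j - 1) * y ^ i * (1 - y) ^ j)" for i j
    define u where "u i j = d (i + j) * (real i * (real i + \<alpha>)) * T i j" for i j
    define v where "v i j = d (i + j) * (real j * (real j + \<beta>)) * T i j" for i j
    define m where "m i j = 2 * real i * real j + real j * (\<alpha> + 1) + real i * (\<beta> + 1)" for i j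
    have L: "real (Suc i) * (real (Suc i) + \<alpha>) * ?c (Suc i) j = ?c i j" for i j
      using F4_coeff_Suc_left[OF assms(1), of i \<beta> j] by (simp add: algebra_simps)
    have R: "real (Suc j) * (real (Suc j) + \<beta>) * ?c i (Suc j) = ?c i j" for i j
      using F4_coeff_Suc_right[OF assms(2), of j \<alpha> i] by (simp add: algebra_simps)
    have gS: "g (Suc i) j = d (Suc (i + j)) * (y * (1 - x)) * T i j" for i j
      unfolding g_def L by (simp add: T_def power_mult_distrib)
    have hS: "h i (Suc j) = d (Suc (i + j)) * (x * (1 - y)) * T i j" for i j
      unfolding h_def R by (simp add: T_def power_mult_distrib)
    have uS: "u (Suc i) j = d (Suc (i + j)) * (x * y) * T i j" for i j
    proof -
      have "u (Suc i) j = d (Suc (i + j)) * (real (Suc i) * (real (Suc i) + \<alpha>) * ?c (Suc i) j) *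
          ((x * y) * (x * y) ^ i) * ((1 - x) * (1 - y)) ^ j"
        by (simp add: u_def T_def del: of_nat_Suc)
      then show ?thesis unfolding L by (simp add: T_def)
    qed
    have vS: "v i (Suc j) = d (Suc (i + j)) * ((1 - x) * (1 - y)) * T i j" for i j
    proof -
      have "v i (Suc j) = d (Suc (i + j)) * (real (Suc j) * (real (Suc j) + \<beta>) * ?c i (Suc j)) *
          (x * y) ^ i * (((1 - x) * (1 - y)) * ((1 - x) * (1 - y)) ^ j)"
        by (simp add: v_def T_def del: of_nat_Suc)
      then show ?thesis unfolding R by (simp add: T_def)
    qed
    have left: "(\<Sum>i\<le>n. \<Sum>j\<le>n. f (Suc i) j) = (\<Sum>i\<le>n. \<Sum>j\<le>n. f i j)"
      if "\<And>j. f 0 j = 0" "\<And>j. f (Suc n) j = 0" for f :: "nat \<Rightarrow> nat \<Rightarrow> real"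
      by (rule sum_shift_vanishing) (simp_all add: that)
    have right: "(\<Sum>i\<le>n. \<Sum>j\<le>n. f i (Suc j)) = (\<Sum>i\<le>n. \<Sum>j\<le>n. f i j)"
      if "\<And>i. f i 0 = 0" "\<And>i. f i (Suc n) = 0" for f :: "nat \<Rightarrow> nat \<Rightarrow> real"
      by (intro sum.cong refl sum_shift_vanishing) (simp_all add: that)
    have E: "poly (F4_poly \<alpha> \<beta> n y) x = (\<Sum>i\<le>n. \<Sum>j\<le>n. d (i + j) * T i j)"
      by (simp add: F4_poly_def poly_sum d_def T_def power_mult_distrib mult_ac)
    have "poly (jacobi_op \<alpha> \<beta> (F4_poly \<alpha> \<beta> n y)) x =
        (\<Sum>i\<le>n. \<Sum>j\<le>n. g i j + h i j - d (i + j) * m i j * T i j)"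
      unfolding F4_poly_def jacobi_op_sum jacobi_op_smult poly_sum poly_smult poly_jacobi_op_bernstein
        d_def[symmetric]
      by (intro sum.cong refl) (simp only: g_def h_def m_def T_def power_mult_distrib, simp add: algebra_simps)
    also have "\<dots> = (\<Sum>i\<le>n. \<Sum>j\<le>n. g i j) + (\<Sum>i\<le>n. \<Sum>j\<le>n. h i j) - (\<Sum>i\<le>n. \<Sum>j\<le>n. d (i + j) * m i j * T i j)"
      by (simp add: sum.distrib sum_subtractf)
    also have "(\<Sum>i\<le>n. \<Sum>j\<le>n. g i j) = (\<Sum>i\<le>n. \<Sum>j\<le>n. g (Suc i) j)"
      by (intro left[symmetric]) (simp_all add: g_def d0)
    also have "(\<Sum>i\<le>n. \<Sum>j\<le>n. h i j) = (\<Sum>i\<le>n. \<Sum>j\<le>n. h i (Suc j))"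
      by (intro right[symmetric]) (simp_all add: h_def d0)
    \<comment> \<open>The identity y(1-x) + x(1-y) = 1 - xy - (1-x)(1-y): the last two products are
      again index shifts of the F4 terms, namely of \<open>u\<close> and \<open>v\<close>.\<close>
    also have "(\<Sum>i\<le>n. \<Sum>j\<le>n. g (Suc i) j) + (\<Sum>i\<le>n. \<Sum>j\<le>n. h i (Suc j)) =
        (\<Sum>i\<le>n. \<Sum>j\<le>n. d (Suc (i + j)) * T i j) - (\<Sum>i\<le>n. \<Sum>j\<le>n. u (Suc i) j) - (\<Sum>i\<le>n. \<Sum>j\<le>n. v i (Suc j))"
      unfolding gS hS uS vS sum.distrib[symmetric] sum_subtractf[symmetric]
      by (intro sum.cong refl) (simp add: algebra_simps)
    also have "(\<Sum>i\<le>n. \<Sum>j\<le>n. u (Suc i) j) = (\<Sum>i\<le>n. \<Sum>j\<le>n. u i j)"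
      by (intro left) (simp_all add: u_def d0)
    also have "(\<Sum>i\<le>n. \<Sum>j\<le>n. v i (Suc j)) = (\<Sum>i\<le>n. \<Sum>j\<le>n. v i j)"
      by (intro right) (simp_all add: v_def d0)
    \<comment> \<open>With N = i + j one has N(N+\<alpha>+\<beta>+1) = i(i+\<alpha>) + j(j+\<beta>)
      + \<open>m i j\<close>, so \<open>dS\<close> leaves just the eigenvalue.\<close>
    also have "(\<Sum>i\<le>n. \<Sum>j\<le>n. d (Suc (i + j)) * T i j) - (\<Sum>i\<le>n. \<Sum>j\<le>n. u i j) - (\<Sum>i\<le>n. \<Sum>j\<le>n. v i j)
        - (\<Sum>i\<le>n. \<Sum>j\<le>n. d (i + j) * m i j * T i j)
        = (\<Sum>i\<le>n. \<Sum>j\<le>n. - (real n * (real n + \<alpha> + \<beta> + 1)) * (d (i + j) * T i j))"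
      unfolding dS u_def v_def m_def sum.distrib[symmetric] sum_subtractf[symmetric]
      by (intro sum.cong refl) (simp add: algebra_simps)
    also have "\<dots> = - (real n * (real n + \<alpha> + \<beta> + 1)) * poly (F4_poly \<alpha> \<beta> n y) x"
      by (simp only: E sum_distrib_left)
    finally show ?thesis .
  qed
  then show ?thesis by (intro iffD1[OF poly_eq_poly_eq_iff] ext) simp
qed

lemma poly_jac_0: "poly (jac \<alpha> \<beta> n) 0 = (real n + \<alpha>) gchoose n"
proof -
  have "poly (jac \<alpha> \<beta> n) 0 = (\<Sum>k\<le>n. if k = 0 then (real n + \<alpha>) gchoose n else 0)"
    unfolding jac_def poly_sum by (intro sum.cong) (auto simp: power_0_left)
  then show ?thesis by simp
qed

lemma poly_jac_1: "poly (jac \<alpha> \<beta> n) 1 = (-1) ^ n * ((real n + \<beta>) gchoose n)"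
proof -
  have "poly (jac \<alpha> \<beta> n) 1 = (\<Sum>k\<le>n. if k = n then (-1) ^ n * ((real n + \<beta>) gchoose n) else 0)"
    unfolding jac_def poly_sum by (intro sum.cong) (auto simp: power_0_left)
  then show ?thesis by simp
qed

lemma gbinomial_shifted: "(real n + a) gchoose n = pochhammer (a + 1) n / fact n"
  by (simp add: gbinomial_pochhammer')

text \<open>The sum is symmetric in x and y, which transfers the eigenvalue equation to y. At (1, 0)
  both arguments xy and (1-x)(1-y) vanish, so only the constant term 1 survives.\<close>

lemma jac_product_formula:
  assumes "\<alpha> > -1" "\<beta> > -1"
  shows "poly (jac \<alpha> \<beta> n) x * poly (jac \<alpha> \<beta> n) y =
    (-1) ^ n * pochhammer (\<alpha> + 1) n * pochhammer (\<beta> + 1) n / (fact n)\<^sup>2 * poly (F4_poly \<alpha> \<beta> n y) x"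
proof -
  define A where "A = (real n + \<alpha>) gchoose n"
  define B where "B = (real n + \<beta>) gchoose n"
  let ?p = "poly (jac \<alpha> \<beta> n)" and ?F = "\<lambda>y. poly (F4_poly \<alpha> \<beta> n y)"
  have pos: "A > 0" "B > 0"
    using assms by (simp_all add: A_def B_def gbinomial_shifted pochhammer_pos)
  have p0: "?p 0 = A" and p1: "?p 1 = (-1) ^ n * B" by (simp_all add: poly_jac_0 poly_jac_1 A_def B_def)
  have e: "A * ?F y x = ?F y 0 * ?p x" for x y
    using arg_cong[OF jacobi_op_eigen_unique[OF jacobi_op_F4_poly[OF assms, of n y] jacobi_op_jac assms(1)],
      of "\<lambda>q. poly q x"]
    by (simp add: poly_0_coeff_0[symmetric] p0)
  have sym: "?F y x = ?F x y" for x y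
    by (simp add: F4_poly_def poly_sum mult_ac)
  have F10: "?F 0 1 = 1"
  proof -
    have "?F 0 1 = (\<Sum>i\<le>n. \<Sum>j\<le>n. if j = 0 then if i = 0 then 1 else 0 else 0)"
      unfolding F4_poly_def poly_sum by (intro sum.cong refl) (auto simp: F4_coeff_def power_0_left)
    then show ?thesis by simp
  qed
  have 2: "A = ?F 0 0 * ?p 1" using e[of 0 1] F10 by simp
  \<comment> \<open>Uniqueness is applied once in each variable; the unknown \<open>?F 0 0\<close>
    is then eliminated by \<open>2\<close>.\<close>
  have "A * A * ?F y x = ?F 0 0 * ?p y * ?p x"
    using e[of y x] e[of 0 y] sym[of y 0] by (simp add: mult_ac)
  then have "?p 1 * (A * A * ?F y x) = A * ?p y * ?p x" using 2 by simp
  then have "?p 1 * A * ?F y x = ?p y * ?p x" using pos by simp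
  then show ?thesis
    unfolding p1 A_def B_def gbinomial_shifted by (simp add: power2_eq_square mult_ac)
qed

section \<open>Norms of the Jacobi polynomials\<close>

text \<open>The substitution t = sin^2(\<theta>/2), with dt = sin(\<theta>/2) cos(\<theta>/2)
  d\<theta>, turns the Jacobi weight into a Beta density.\<close>

lemma has_bochner_integral_jacobi_measure:
  assumes "\<alpha> > -1" "\<beta> > -1"
  shows "has_bochner_integral (jacobi_measure \<alpha> \<beta>) (\<lambda>\<theta>. poly (bernstein i j) ((sin (\<theta> / 2))\<^sup>2))
    (Beta (\<alpha> + 1 + real i) (\<beta> + 1 + real j))"
proof -
  let ?f = "\<lambda>t::real. t powr (\<alpha> + real i) * (1 - t) powr (\<beta> + real j)"
  let ?g = "\<lambda>\<theta>::real. (sin (\<theta> / 2))\<^sup>2" and ?g' = "\<lambda>\<theta>::real. sin (\<theta> / 2) * cos (\<theta> / 2)"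
  let ?w = "\<lambda>\<theta>. sin (\<theta> / 2) powr (2 * \<alpha> + 1) * cos (\<theta> / 2) powr (2 * \<beta> + 1)"
  let ?B = "Beta (\<alpha> + 1 + real i) (\<beta> + 1 + real j)"
  have f: "has_bochner_integral lborel (\<lambda>t. indicator {0..1} t * ?f t) ?B"
    using has_bochner_integral_Beta[of "\<alpha> + 1 + real i" "\<beta> + 1 + real j"] assms by (simp add: algebra_simps)
  then have sf: "set_integrable lborel {?g 0..?g pi} ?f"
    by (simp add: has_bochner_integral_iff set_integrable_def)
  have 1: "set_integrable lborel {0..pi} (\<lambda>u. ?f (?g u) * ?g' u)"
     "(LBINT t. ?f t * indicator {?g 0..?g pi} t) = (LBINT u. ?f (?g u) * ?g' u * indicator {0..pi} u)"
    by (rule integral_substitution[where g = ?g and g' = ?g' and a = 0 and b = pi, OF sf];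
        auto intro!: derivative_eq_intros continuous_intros mult_nonneg_nonneg sin_ge_zero cos_ge_zero)+
  \<comment> \<open>At x = 0 both sides are 0, since \<open>0 powr r\<close> is 0 for every r,
    including r \<le> 0.\<close>
  have P: "(x\<^sup>2) powr (a + real k) * x = x powr (2 * a + 1) * (x\<^sup>2) ^ k" if "x \<ge> 0" for x a :: real and k
  proof (cases "x = 0")
    case False
    with that have x: "x > 0" by simp
    have "(x\<^sup>2) powr (a + real k) = (x\<^sup>2) powr a * (x\<^sup>2) ^ k"
      using x by (simp add: powr_add powr_realpow)
    moreover have "(x\<^sup>2) powr a = x powr (2 * a)"
      using x powr_powr[of x 2 a] by simp
    ultimately show ?thesis using x by (simp add: powr_add)
  qed simp
  have eq: "?f (?g u) * ?g' u * indicator {0..pi} u = indicator {0..pi} u * ?w u * poly (bernstein i j) (?g u)" for u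
  proof (cases "u \<in> {0..pi}")
    case True
    then have nn: "sin (u / 2) \<ge> 0" "cos (u / 2) \<ge> 0"
      by (auto intro!: sin_ge_zero cos_ge_zero)
    have c: "1 - (sin (u / 2))\<^sup>2 = (cos (u / 2))\<^sup>2" by (simp add: cos_squared_eq)
    have "?f (?g u) * ?g' u = (((sin (u / 2))\<^sup>2) powr (\<alpha> + real i) * sin (u / 2)) * (((cos (u / 2))\<^sup>2) powr (\<beta> + real j) * cos (u / 2))"
      unfolding c by simp
    also have "\<dots> = ?w u * poly (bernstein i j) (?g u)"
      unfolding P[OF nn(1)] P[OF nn(2)] poly_bernstein c by simp
    finally show ?thesis using True by simp
  qed simp
  have "has_bochner_integral lborel (\<lambda>u. ?f (?g u) * ?g' u * indicator {0..pi} u) ?B"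
    using f 1 by (simp add: has_bochner_integral_iff set_integrable_def mult_ac)
  then have "has_bochner_integral lborel (\<lambda>u. indicator {0..pi} u * ?w u * poly (bernstein i j) (?g u)) ?B"
    unfolding eq .
  then show ?thesis
    unfolding jacobi_measure_def by (intro has_bochner_integral_density) auto
qed

text \<open>An n-th finite difference: one step is (y)_k - (y+1)_k = -k (y+1)_(k-1). For k < n the
  factor \<open>k choose n\<close> makes it vanish.\<close>

lemma sum_alternating_pochhammer:
  "(\<Sum>s\<le>n. (-1) ^ s * real (n choose s) * pochhammer (x + real s) k) =
     (-1) ^ n * (fact n * real (k choose n)) * pochhammer (x + real n) (k - n)" for x :: real
proof (induction n arbitrary: x k)
  case 0
  show ?case by simp
next
  case (Suc n)
  let ?D = "\<lambda>n k x. \<Sum>s\<le>n. (-1) ^ s * real (n choose s) * pochhammer (x + real s) k :: real"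
  have "?D (Suc n) k x = pochhammer x k + (\<Sum>s\<le>n. (-1) ^ Suc s * real (Suc n choose Suc s) * pochhammer (x + real (Suc s)) k)"
    by (subst sum.atMost_Suc_shift) simp
  also have "(\<Sum>s\<le>n. (-1) ^ Suc s * real (Suc n choose Suc s) * pochhammer (x + real (Suc s)) k) =
     (\<Sum>s\<le>n. (-1) ^ Suc s * real (n choose Suc s) * pochhammer (x + real (Suc s)) k) - ?D n k (x + 1)"
    unfolding sum_subtractf[symmetric] by (intro sum.cong refl) (simp add: algebra_simps)
  also have "pochhammer x k + ((\<Sum>s\<le>n. (-1) ^ Suc s * real (n choose Suc s) * pochhammer (x + real (Suc s)) k) - ?D n k (x + 1)) =
     (\<Sum>s\<le>Suc n. (-1) ^ s * real (n choose s) * pochhammer (x + real s) k) - ?D n k (x + 1)"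
    by (subst sum.atMost_Suc_shift) simp
  also have "(\<Sum>s\<le>Suc n. (-1) ^ s * real (n choose s) * pochhammer (x + real s) k) = ?D n k x"
    by simp
  also have "?D n k x - ?D n k (x + 1) = - real k * ?D n (k - 1) (x + 1)"
  proof -
    have p: "pochhammer y k - pochhammer (y + 1) k = - real k * pochhammer (y + 1) (k - 1)" for y :: real
      by (cases k) (simp_all only: pochhammer_rec[of y] pochhammer_rec'[of "y + 1"] pochhammer_0 diff_Suc_1 of_nat_Suc of_nat_0, simp_all add: algebra_simps)
    have "pochhammer (x + real s) k - pochhammer (x + 1 + real s) k = - real k * pochhammer (x + 1 + real s) (k - 1)" for s
      using p[of "x + real s"] by (simp add: add_ac)
    then show ?thesis
      by (simp only: sum_subtractf[symmetric] right_diff_distrib[symmetric] sum_distrib_left) (simp add: mult_ac)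
  qed
  also have "\<dots> = (-1) ^ Suc n * (fact n * (real k * real ((k - 1) choose n))) * pochhammer (x + 1 + real n) (k - 1 - n)"
    unfolding Suc.IH by simp
  also have "real k * real ((k - 1) choose n) = real (Suc n) * real (k choose Suc n)"
  proof (cases k)
    case (Suc m)
    have "real (Suc m * (m choose n)) = real ((Suc m choose Suc n) * Suc n)"
      by (simp only: Suc_times_binomial_eq)
    then show ?thesis by (simp only: Suc diff_Suc_1 of_nat_mult mult.commute)
  qed simp
  finally show ?case by (simp add: mult_ac add_ac)
qed

text \<open>Orthogonality to lower powers, with the value at k = n. The Gamma factors of the Beta
  integrals cancel against the binomials, leaving an n-th difference of a polynomial of degree
  k.\<close>

lemma integral_jac_power:
  assumes "\<alpha> > -1" "\<beta> > -1" "k \<le> n"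
  shows "has_bochner_integral (jacobi_measure \<alpha> \<beta>)
    (\<lambda>\<theta>. ((sin (\<theta> / 2))\<^sup>2) ^ k * poly (jac \<alpha> \<beta> n) ((sin (\<theta> / 2))\<^sup>2))
    (if k = n then (-1) ^ n * Gamma (real n + \<alpha> + 1) * Gamma (real n + \<beta> + 1) / Gamma (2 * real n + \<alpha> + \<beta> + 2) else 0)"
proof -
  define e where "e s = (-1) ^ s * ((real n + \<alpha>) gchoose (n - s)) * ((real n + \<beta>) gchoose s)" for s
  let ?Y = "\<lambda>\<theta>::real. (sin (\<theta> / 2))\<^sup>2"
  let ?C = "Gamma (real n + \<alpha> + 1) * Gamma (real n + \<beta> + 1) / (fact n * Gamma (\<alpha> + \<beta> + 2 + real k + real n))"
  have "y ^ k * poly (jac \<alpha> \<beta> n) y = (\<Sum>s\<le>n. e s * poly (bernstein (s + k) (n - s)) y)" for y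
    by (simp add: jac_def poly_sum sum_distrib_left e_def power_add mult_ac)
  moreover have "has_bochner_integral (jacobi_measure \<alpha> \<beta>) (\<lambda>\<theta>. \<Sum>s\<le>n. e s * poly (bernstein (s + k) (n - s)) (?Y \<theta>))
     (\<Sum>s\<le>n. e s * Beta (\<alpha> + 1 + real (s + k)) (\<beta> + 1 + real (n - s)))"
    by (intro has_bochner_integral_sum has_bochner_integral_mult_right has_bochner_integral_jacobi_measure assms)
  moreover have "e s * Beta (\<alpha> + 1 + real (s + k)) (\<beta> + 1 + real (n - s)) =
      ?C * ((-1) ^ s * real (n choose s) * pochhammer (\<alpha> + 1 + real s) k)" if "s \<le> n" for s
  proof -
    have pG: "pochhammer x m = Gamma (x + real m) / Gamma x" if "x > 0" for x m
      using that by (subst pochhammer_Gamma) (auto elim!: nonpos_Ints_cases)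
    have pos: "\<alpha> + 1 + real s > 0" "\<beta> + 1 + real (n - s) > 0" using assms by auto
    have 1: "((real n + \<alpha>) gchoose (n - s)) = Gamma (real n + \<alpha> + 1) / Gamma (\<alpha> + 1 + real s) / fact (n - s)"
    proof -
      have "((real n + \<alpha>) gchoose (n - s)) = pochhammer (\<alpha> + 1 + real s) (n - s) / fact (n - s)"
        using that by (simp add: gbinomial_pochhammer' of_nat_diff algebra_simps)
      also have "pochhammer (\<alpha> + 1 + real s) (n - s) = Gamma (real n + \<alpha> + 1) / Gamma (\<alpha> + 1 + real s)"
        using that pG[OF pos(1), of "n - s"] by (simp add: of_nat_diff algebra_simps)
      finally show ?thesis .
    qed
    have 2: "((real n + \<beta>) gchoose s) = Gamma (real n + \<beta> + 1) / Gamma (\<beta> + 1 + real (n - s)) / fact s"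
    proof -
      have "((real n + \<beta>) gchoose s) = pochhammer (\<beta> + 1 + real (n - s)) s / fact s"
        using that by (simp add: gbinomial_pochhammer' of_nat_diff algebra_simps)
      also have "pochhammer (\<beta> + 1 + real (n - s)) s = Gamma (real n + \<beta> + 1) / Gamma (\<beta> + 1 + real (n - s))"
        using that pG[OF pos(2), of s] by (simp add: of_nat_diff algebra_simps)
      finally show ?thesis .
    qed
    have 3: "real (n choose s) = fact n / (fact s * fact (n - s))"
      using that by (rule binomial_fact)
    have 4: "\<alpha> + 1 + real (s + k) = \<alpha> + 1 + real s + real k"
      "\<alpha> + 1 + real s + real k + (\<beta> + 1 + real (n - s)) = \<alpha> + \<beta> + 2 + real k + real n"
      using that by (simp_all add: of_nat_diff)
    have "Gamma (\<alpha> + 1 + real s) > 0" "Gamma (\<beta> + 1 + real (n - s)) > 0"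
      using pos by (auto intro!: Gamma_real_pos)
    then show ?thesis
      unfolding e_def Beta_def 1 2 3 4 pG[OF pos(1)] by (simp add: mult_ac)
  qed
  moreover have "(\<Sum>s\<le>n. ?C * ((-1) ^ s * real (n choose s) * pochhammer (\<alpha> + 1 + real s) k)) =
     (if k = n then (-1) ^ n * Gamma (real n + \<alpha> + 1) * Gamma (real n + \<beta> + 1) / Gamma (2 * real n + \<alpha> + \<beta> + 2) else 0)"
    unfolding sum_distrib_left[symmetric] sum_alternating_pochhammer
    using assms(3) by (auto simp: binomial_eq_0 add_ac)
  ultimately show ?thesis by simp
qed

lemma degree_bernstein_le: "degree (bernstein i j) \<le> i + j"
  unfolding bernstein_def
  by (intro order.trans[OF degree_mult_le] add_mono order.trans[OF degree_power_le]) simp_all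

lemma coeff_bernstein: "coeff (bernstein i j) (i + j) = (-1) ^ j"
proof -
  have "lead_coeff (bernstein i j) = (-1) ^ j" by (simp add: bernstein_def lead_coeff_mult lead_coeff_power)
  moreover have "degree (bernstein i j) = i + j" by (simp add: bernstein_def degree_mult_eq degree_power_eq)
  ultimately show ?thesis by simp
qed

text \<open>The signs (-1)^k and (-1)^(n-k) combine to (-1)^n, and the binomials add up by
  Vandermonde.\<close>

lemma coeff_jac: "coeff (jac \<alpha> \<beta> n) n = (-1) ^ n * ((2 * real n + \<alpha> + \<beta>) gchoose n)"
proof -
  have "coeff (jac \<alpha> \<beta> n) n = (\<Sum>k\<le>n. (-1) ^ n * (((real n + \<beta>) gchoose k) * ((real n + \<alpha>) gchoose (n - k))))"
    unfolding jac_def coeff_sum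
  proof (intro sum.cong refl)
    fix k assume "k \<in> {..n}"
    then have k: "k \<le> n" by simp
    have "coeff (bernstein k (n - k)) n = (-1) ^ (n - k)" using coeff_bernstein[of k "n - k"] k by simp
    moreover have "(-1::real) ^ n = (-1) ^ k * (-1) ^ (n - k)" using k by (simp add: power_add[symmetric])
    ultimately show "coeff (smult ((-1) ^ k * (real n + \<alpha> gchoose (n - k)) * (real n + \<beta> gchoose k)) (bernstein k (n - k))) n =
        (-1) ^ n * (((real n + \<beta>) gchoose k) * ((real n + \<alpha>) gchoose (n - k)))"
      by simp
  qed
  also have "\<dots> = (-1) ^ n * ((real n + \<beta> + (real n + \<alpha>)) gchoose n)"
    unfolding gbinomial_Vandermonde[symmetric] by (simp add: sum_distrib_left atMost_atLeast0)
  finally show ?thesis by (simp add: algebra_simps)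
qed

text \<open>One factor of the square is expanded in powers of sin^2(\<theta>/2); by orthogonality
  only its leading coefficient counts. The binomial form stays valid for n = 0 and \<alpha>+\<beta>
  = -1.\<close>

lemma jacobi_poly_norm:
  assumes "\<alpha> > -1" "\<beta> > -1"
  shows "(\<integral>\<phi>. (jacobi_poly \<alpha> \<beta> n (cos \<phi>))\<^sup>2 \<partial>jacobi_measure \<alpha> \<beta>) =
    ((2 * real n + \<alpha> + \<beta>) gchoose n) * (Gamma (real n + \<alpha> + 1) * Gamma (real n + \<beta> + 1)) / Gamma (2 * real n + \<alpha> + \<beta> + 2)"
proof -
  let ?Y = "\<lambda>\<theta>::real. (sin (\<theta> / 2))\<^sup>2" and ?p = "jac \<alpha> \<beta> n"
  let ?G = "Gamma (real n + \<alpha> + 1) * Gamma (real n + \<beta> + 1) / Gamma (2 * real n + \<alpha> + \<beta> + 2)"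
  have deg: "degree ?p \<le> n"
    unfolding jac_def
  proof (intro degree_sum_le)
    fix k assume "k \<in> {..n}"
    then show "degree (smult ((-1) ^ k * (real n + \<alpha> gchoose (n - k)) * (real n + \<beta> gchoose k)) (bernstein k (n - k))) \<le> n"
      using degree_bernstein_le[of k "n - k"] by (intro order.trans[OF degree_smult_le]) simp
  qed simp
  have "poly ?p y = (\<Sum>k\<le>n. coeff ?p k * y ^ k)" for y
    unfolding poly_altdef using deg by (intro sum.mono_neutral_left) (auto simp: coeff_eq_0)
  then have sq: "(poly ?p y)\<^sup>2 = (\<Sum>k\<le>n. coeff ?p k * (y ^ k * poly ?p y))" for y
    unfolding power2_eq_square by (metis (no_types, lifting) sum.cong mult.assoc sum_distrib_right)
  have "has_bochner_integral (jacobi_measure \<alpha> \<beta>) (\<lambda>\<theta>. \<Sum>k\<le>n. coeff ?p k * (?Y \<theta> ^ k * poly ?p (?Y \<theta>)))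
     (\<Sum>k\<le>n. coeff ?p k * (if k = n then (-1) ^ n * Gamma (real n + \<alpha> + 1) * Gamma (real n + \<beta> + 1) / Gamma (2 * real n + \<alpha> + \<beta> + 2) else 0))"
    by (intro has_bochner_integral_sum has_bochner_integral_mult_right integral_jac_power assms) simp
  also have "(\<Sum>k\<le>n. coeff ?p k * (if k = n then (-1) ^ n * Gamma (real n + \<alpha> + 1) * Gamma (real n + \<beta> + 1) / Gamma (2 * real n + \<alpha> + \<beta> + 2) else 0)) =
     coeff ?p n * ((-1) ^ n * ?G)"
    by (simp add: if_distrib[of "(*) _"] cong: if_cong)
  also have "\<dots> = ((2 * real n + \<alpha> + \<beta>) gchoose n) * ?G"
    unfolding coeff_jac by (simp add: power_add[symmetric] flip: mult.assoc)
  finally show ?thesis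
    unfolding jacobi_poly_cos sq by (simp add: has_bochner_integral_iff)
qed

section \<open>Gegenbauer polynomials\<close>

definition antidiag2 :: "nat \<Rightarrow> (nat \<times> nat) set" where
  "antidiag2 k = {(m, j). 2 * m + j = k}"

lemma finite_antidiag2 [simp]: "finite (antidiag2 k)"
  by (rule finite_subset[of _ "{..k} \<times> {..k}"]) (auto simp: antidiag2_def)

lemma sum_antidiag2_Suc:
  fixes f :: "nat \<Rightarrow> nat \<Rightarrow> real"
  assumes "\<And>m. f m 0 = 0"
  shows "(\<Sum>(m, j)\<in>antidiag2 (Suc k). f m j) = (\<Sum>(m, j)\<in>antidiag2 k. f m (Suc j))"
proof -
  have "(\<Sum>(m, j)\<in>antidiag2 (Suc k). f m j) = (\<Sum>(m, j)\<in>(\<lambda>(m, j). (m, Suc j)) ` antidiag2 k. f m j)"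
  proof (rule sum.mono_neutral_right)
    show "\<forall>x\<in>antidiag2 (Suc k) - (\<lambda>(m, j). (m, Suc j)) ` antidiag2 k. (case x of (m, j) \<Rightarrow> f m j) = 0"
    proof clarify
      fix m j assume "(m, j) \<in> antidiag2 (Suc k)" "(m, j) \<notin> (\<lambda>(m, j). (m, Suc j)) ` antidiag2 k"
      then have "j = 0" by (cases j) (auto simp: antidiag2_def image_iff)
      then show "f m j = 0" using assms by simp
    qed
  qed (simp, auto simp: antidiag2_def)
  also have "\<dots> = (\<Sum>(m, j)\<in>antidiag2 k. f m (Suc j))"
    by (subst sum.reindex) (auto simp: inj_on_def case_prod_unfold)
  finally show ?thesis .
qed

lemma sum_antidiag2_Suc_Suc:
  fixes f :: "nat \<Rightarrow> nat \<Rightarrow> real"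
  assumes "\<And>j. f 0 j = 0"
  shows "(\<Sum>(m, j)\<in>antidiag2 (Suc (Suc k)). f m j) = (\<Sum>(m, j)\<in>antidiag2 k. f (Suc m) j)"
proof -
  have "(\<Sum>(m, j)\<in>antidiag2 (Suc (Suc k)). f m j) = (\<Sum>(m, j)\<in>(\<lambda>(m, j). (Suc m, j)) ` antidiag2 k. f m j)"
  proof (rule sum.mono_neutral_right)
    show "\<forall>x\<in>antidiag2 (Suc (Suc k)) - (\<lambda>(m, j). (Suc m, j)) ` antidiag2 k. (case x of (m, j) \<Rightarrow> f m j) = 0"
    proof clarify
      fix m j assume "(m, j) \<in> antidiag2 (Suc (Suc k))" "(m, j) \<notin> (\<lambda>(m, j). (Suc m, j)) ` antidiag2 k"
      then have "m = 0" by (cases m) (auto simp: antidiag2_def image_iff)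
      then show "f m j = 0" using assms by simp
    qed
  qed (simp, auto simp: antidiag2_def)
  also have "\<dots> = (\<Sum>(m, j)\<in>antidiag2 k. f (Suc m) j)"
    by (subst sum.reindex) (auto simp: inj_on_def case_prod_unfold)
  finally show ?thesis .
qed

text \<open>With k = 2m + j this is the classical coefficient of C_k^s, since m + j = k - m.\<close>

definition gegen_coeff :: "real \<Rightarrow> nat \<Rightarrow> nat \<Rightarrow> real" where
  "gegen_coeff s m j = (-1) ^ m * pochhammer s (m + j) * 2 ^ j / (fact m * fact j)"

definition gegen :: "real \<Rightarrow> nat \<Rightarrow> real \<Rightarrow> real" where
  "gegen s k w = (\<Sum>(m, j)\<in>antidiag2 k. gegen_coeff s m j * w ^ j)"

lemma gegen_0: "gegen s 0 w = 1"
proof -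
  have "antidiag2 0 = {(0, 0)}" by (auto simp: antidiag2_def)
  then show ?thesis by (simp add: gegen_def gegen_coeff_def)
qed

lemma gegen_1: "gegen s (Suc 0) w = 2 * s * w"
proof -
  have "2 * m + j = Suc 0 \<longleftrightarrow> m = 0 \<and> j = 1" for m j :: nat by presburger
  then have "antidiag2 (Suc 0) = {(0, 1)}" by (auto simp: antidiag2_def)
  then show ?thesis by (simp add: gegen_def gegen_coeff_def)
qed

lemma gegen_coeff_Suc_right:
  "real (Suc j) * gegen_coeff s m (Suc j) = 2 * (s + real m + real j) * gegen_coeff s m j"
  by (simp add: gegen_coeff_def pochhammer_rec' divide_simps del: of_nat_Suc)

lemma gegen_coeff_Suc_left:
  "real (Suc m) * gegen_coeff s (Suc m) j = - (s + real m + real j) * gegen_coeff s m j"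
  by (simp add: gegen_coeff_def pochhammer_rec' divide_simps del: of_nat_Suc) (simp add: algebra_simps)

text \<open>The three-term recurrence, checked coefficient by coefficient. It links the explicit
  polynomial to the product of two binomial series.\<close>

lemma gegen_rec:
  "(real k + 2) * gegen s (Suc (Suc k)) w =
     2 * w * (real k + 1 + s) * gegen s (Suc k) w - (real k + 2 * s) * gegen s k w"
proof -
  let ?G = "gegen_coeff s"
  have key: "(real k + 2) * ?G m j =
      (if j = 0 then 0 else 2 * (real k + 1 + s) * ?G m (j - 1)) -
      (if m = 0 then 0 else (real k + 2 * s) * ?G (m - 1) j)" (is "_ = ?r m j - ?l m j")
    if "(m, j) \<in> antidiag2 (Suc (Suc k))" for m j
  proof -
    have k: "real k + 2 = 2 * real m + real j" using that by (auto simp: antidiag2_def)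
    have j: "real j * ?G m j = 2 * (s + real m + real j - 1) * ?G m (j - 1)" if "j \<noteq> 0"
      using gegen_coeff_Suc_right[of "j - 1" s m] that by (simp add: of_nat_diff)
    have m: "real m * ?G m j = - (s + real m + real j - 1) * ?G (m - 1) j" if "m \<noteq> 0"
      using gegen_coeff_Suc_left[of "m - 1" s j] that by (simp add: of_nat_diff)
    show ?thesis
    proof (cases "m = 0 \<or> j = 0")
      case True
      have k': "real k = 2 * real m + real j - 2" using k by simp
      have "m \<noteq> 0 \<or> j \<noteq> 0" using k by auto
      with True consider "m = 0" "j \<noteq> 0" | "m \<noteq> 0" "j = 0" by auto
      then show ?thesis
      proof cases
        case 1
        then show ?thesis using j by (simp add: k')
      next
        case 2
        have "(real k + 2) * ?G m j = 2 * (real m * ?G m j)" using 2 by (simp add: k)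
        then show ?thesis using 2 m by (simp add: k' algebra_simps)
      qed
    next
      case False
      \<comment> \<open>The coefficients of the two neighbours are proportional; this removes the
        remainder left when k is expressed through m and j.\<close>
      have jm: "2 * real m * ?G m (j - 1) = - real j * ?G (m - 1) j"
      proof -
        obtain j' m' where jm': "j = Suc j'" "m = Suc m'" using False by (metis not0_implies_Suc)
        show ?thesis by (simp add: jm' gegen_coeff_def divide_simps del: of_nat_Suc)
      qed
      have "(real k + 2) * ?G m j = 2 * (real m * ?G m j) + real j * ?G m j"
        by (simp add: k algebra_simps)
      also have "\<dots> = 2 * (s + real m + real j - 1) * ?G m (j - 1) - 2 * (s + real m + real j - 1) * ?G (m - 1) j"
        using False by (simp add: j m) (simp add: algebra_simps)
      also have "\<dots> = 2 * (real k + 1 + s) * ?G m (j - 1) - (real k + 2 * s) * ?G (m - 1) j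
          - (2 * real m * ?G m (j - 1) + real j * ?G (m - 1) j)"
      proof -
        have k': "real k = 2 * real m + real j - 2" using k by simp
        show ?thesis unfolding k' by (simp add: algebra_simps)
      qed
      finally show ?thesis using False jm by simp
    qed
  qed
  have "(real k + 2) * gegen s (Suc (Suc k)) w =
      (\<Sum>(m, j)\<in>antidiag2 (Suc (Suc k)). ?r m j * w ^ j - ?l m j * w ^ j)"
    unfolding gegen_def sum_distrib_left
  proof (intro sum.cong refl, clarify)
    fix m j assume "(m, j) \<in> antidiag2 (Suc (Suc k))"
    note k = key[OF this]
    have "(real k + 2) * (?G m j * w ^ j) = ((real k + 2) * ?G m j) * w ^ j" by simp
    then show "(real k + 2) * (?G m j * w ^ j) = ?r m j * w ^ j - ?l m j * w ^ j"
      unfolding k by (simp only: left_diff_distrib)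
  qed
  also have "\<dots> = (\<Sum>(m, j)\<in>antidiag2 (Suc (Suc k)). ?r m j * w ^ j) - (\<Sum>(m, j)\<in>antidiag2 (Suc (Suc k)). ?l m j * w ^ j)"
    by (simp add: case_prod_unfold sum_subtractf)
  also have "(\<Sum>(m, j)\<in>antidiag2 (Suc (Suc k)). ?r m j * w ^ j) = 2 * w * (real k + 1 + s) * gegen s (Suc k) w"
    unfolding gegen_def sum_distrib_left by (subst sum_antidiag2_Suc) (auto intro!: sum.cong)
  also have "(\<Sum>(m, j)\<in>antidiag2 (Suc (Suc k)). ?l m j * w ^ j) = (real k + 2 * s) * gegen s k w"
    unfolding gegen_def sum_distrib_left by (subst sum_antidiag2_Suc_Suc) (auto intro!: sum.cong)
  finally show ?thesis .
qed

text \<open>The derivative is again a Gegenbauer polynomial, with s raised by 1, so bounds and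
  series for derivatives are inherited from the undifferentiated case.\<close>

lemma DERIV_gegen:
  "(gegen s k has_real_derivative (if k = 0 then 0 else 2 * s * gegen (s + 1) (k - 1) w)) (at w)"
proof (cases k)
  case 0
  then show ?thesis by (simp add: gegen_0[abs_def])
next
  case (Suc l)
  have "(gegen s k has_real_derivative (\<Sum>(m, j)\<in>antidiag2 k. gegen_coeff s m j * (real j * w ^ (j - 1)))) (at w)"
    unfolding gegen_def[abs_def] case_prod_unfold
    by (auto intro!: derivative_eq_intros sum.cong)
  also have "(\<Sum>(m, j)\<in>antidiag2 k. gegen_coeff s m j * (real j * w ^ (j - 1))) =
      (\<Sum>(m, j)\<in>antidiag2 l. 2 * s * (gegen_coeff (s + 1) m j * w ^ j))"
    unfolding Suc
    by (subst sum_antidiag2_Suc)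
       (auto simp: gegen_coeff_def pochhammer_rec divide_simps simp del: of_nat_Suc intro!: sum.cong)
  also have "\<dots> = 2 * s * gegen (s + 1) l w"
    by (simp add: gegen_def sum_distrib_left case_prod_unfold)
  finally show ?thesis using Suc by simp
qed

section \<open>Generating function and uniform bounds\<close>

text \<open>The Taylor coefficients of (1 - x)^(-s).\<close>

definition binom_coeff :: "real \<Rightarrow> nat \<Rightarrow> real" where
  "binom_coeff s i = pochhammer s i / fact i"

lemma binom_coeff_nonneg: "s > 0 \<Longrightarrow> binom_coeff s i \<ge> 0"
  by (simp add: binom_coeff_def pochhammer_nonneg)

lemma binom_coeff_0 [simp]: "binom_coeff s 0 = 1" by (simp add: binom_coeff_def)

lemma binom_coeff_Suc: "real (Suc i) * binom_coeff s (Suc i) = (s + real i) * binom_coeff s i"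
  by (simp add: binom_coeff_def pochhammer_rec' divide_simps del: of_nat_Suc)

text \<open>Since 1 - 2 Re(\<omega>) X + X^2 = (1 - \<omega> X)(1 - cnj \<omega> X), the generating
  function is a product of two binomial series. The product is identified through a differential
  equation that yields \<open>gegen_rec\<close>.\<close>

lemma of_real_gegen:
  assumes \<omega>: "norm \<omega> = 1"
  shows "complex_of_real (gegen s k (Re \<omega>)) =
    (\<Sum>i\<le>k. (complex_of_real (binom_coeff s i) * \<omega> ^ i) * (complex_of_real (binom_coeff s (k - i)) * cnj \<omega> ^ (k - i)))"
proof -
  define F where "F x = Abs_fps (\<lambda>i. complex_of_real (binom_coeff s i) * x ^ i)" for x :: complex
  \<comment> \<open>The first-order equation satisfied by (1 - x X)^(-s).\<close>
  have F: "fps_deriv (F x) * (1 - fps_const x * fps_X) = fps_const (of_real s * x) * F x" for x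
  proof (rule fps_ext)
    fix i
    have b: "of_nat (Suc i) * (complex_of_real (binom_coeff s (Suc i)) * y) = (of_real s + of_nat i) * of_real (binom_coeff s i) * y" for i y
      using arg_cong[OF binom_coeff_Suc[of i s], of complex_of_real] by (simp add: mult.assoc[symmetric] del: of_nat_Suc)
    have m: "fps_nth (A * (1 - fps_const x * fps_X)) i = fps_nth A i - (if i = 0 then 0 else x * fps_nth A (i - 1))" for A i
    proof -
      have "A * (1 - fps_const x * fps_X) = A - fps_const x * (A * fps_X)"
        by (simp add: right_diff_distrib mult_ac)
      then show ?thesis by simp
    qed
    have d: "fps_nth (fps_deriv (F x)) i = (of_real s + of_nat i) * of_real (binom_coeff s i) * x ^ Suc i"
      using b[of i "x ^ Suc i"] by (simp add: F_def)
    have d': "(if i = 0 then 0 else x * fps_nth (fps_deriv (F x)) (i - 1)) =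
        of_nat i * of_real (binom_coeff s i) * x ^ Suc i"
      by (cases i) (simp_all add: F_def mult_ac)
    show "fps_nth (fps_deriv (F x) * (1 - fps_const x * fps_X)) i = fps_nth (fps_const (of_real s * x) * F x) i"
      unfolding m d d' by (simp add: F_def ring_distribs)
  qed
  define T where "T = F \<omega> * F (cnj \<omega>)"
  have one: "\<omega> * cnj \<omega> = 1" using \<omega> by (simp add: complex_norm_square[symmetric])
  have two: "\<omega> + cnj \<omega> = 2 * of_real (Re \<omega>)" by (simp add: complex_add_cnj)
  \<comment> \<open>The logarithmic derivatives of the factors add up: with w = Re \<omega>, T' (1 -
    2wX + X^2) = 2s (w - X) T.\<close>
  have "fps_deriv T * (1 - fps_const (2 * of_real (Re \<omega>)) * fps_X + fps_X ^ 2) =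
      fps_const (2 * of_real s) * (fps_const (of_real (Re \<omega>)) - fps_X) * T"
  proof -
    have ab: "fps_const \<omega> * fps_const (cnj \<omega>) = 1"
      "fps_const \<omega> + fps_const (cnj \<omega>) = fps_const (2 * of_real (Re \<omega>))"
      by (simp_all add: one two)
    have "1 - fps_const (2 * of_real (Re \<omega>)) * fps_X + fps_X ^ 2 =
        (1 - fps_const \<omega> * fps_X) * (1 - fps_const (cnj \<omega>) * fps_X)"
    proof -
      have "(1 - fps_const \<omega> * fps_X) * (1 - fps_const (cnj \<omega>) * fps_X) =
          1 - (fps_const \<omega> + fps_const (cnj \<omega>)) * fps_X + (fps_const \<omega> * fps_const (cnj \<omega>)) * fps_X ^ 2"
        by (simp only: power2_eq_square ring_distribs) (simp add: mult_ac)
      then show ?thesis unfolding ab by simp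
    qed
    note P = this
    have D: "fps_deriv T = fps_deriv (F \<omega>) * F (cnj \<omega>) + F \<omega> * fps_deriv (F (cnj \<omega>))"
      by (simp add: T_def)
    have "fps_deriv T * (1 - fps_const (2 * of_real (Re \<omega>)) * fps_X + fps_X ^ 2) =
        (fps_deriv (F \<omega>) * (1 - fps_const \<omega> * fps_X)) * F (cnj \<omega>) * (1 - fps_const (cnj \<omega>) * fps_X)
        + (fps_deriv (F (cnj \<omega>)) * (1 - fps_const (cnj \<omega>) * fps_X)) * F \<omega> * (1 - fps_const \<omega> * fps_X)"
      unfolding P D by (simp only: distrib_left distrib_right mult_ac)
    also have "\<dots> = fps_const (of_real s) * T * ((fps_const \<omega> + fps_const (cnj \<omega>)) - 2 * (fps_const \<omega> * fps_const (cnj \<omega>)) * fps_X)"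
    proof -
      have "k * a * A * B * (1 - b * X) + k * b * B * A * (1 - a * X) =
          k * (A * B) * ((a + b) - 2 * (a * b) * X)" for k a b A B X :: "complex fps"
        by algebra
      then show ?thesis unfolding F T_def fps_const_mult[symmetric] .
    qed
    also have "\<dots> = fps_const (2 * of_real s) * (fps_const (of_real (Re \<omega>)) - fps_X) * T"
      unfolding ab fps_const_mult[symmetric] of_real_mult by (simp add: ring_distribs mult_ac numeral_fps_const)
    finally show ?thesis .
  qed
  then have "fps_nth (fps_deriv T * (1 - fps_const (2 * of_real (Re \<omega>)) * fps_X + fps_X ^ 2)) k =
      fps_nth (fps_const (2 * of_real s) * (fps_const (of_real (Re \<omega>)) - fps_X) * T) k" for k by simp
  note nth = this
  have T0: "fps_nth T 0 = 1" by (simp add: T_def F_def)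
  have T1: "fps_nth T (Suc 0) = 2 * s * Re \<omega>"
    using nth[of 0] by (simp add: T0 algebra_simps)
  have Trec: "(of_nat k + 2) * fps_nth T (Suc (Suc k)) =
      2 * Re \<omega> * (real k + 1 + s) * fps_nth T (Suc k) - (real k + 2 * s) * fps_nth T k" for k
    using nth[of "Suc k"] by (cases k) (simp_all add: ring_distribs power2_eq_square mult.assoc[symmetric], simp_all add: algebra_simps)
  have "fps_nth T k = of_real (gegen s k (Re \<omega>)) \<and> fps_nth T (Suc k) = of_real (gegen s (Suc k) (Re \<omega>))" for k
  proof (induction k)
    case 0
    show ?case by (simp add: T0 T1 gegen_0 gegen_1)
  next
    case (Suc k)
    have "(of_nat k + 2) * fps_nth T (Suc (Suc k)) = of_real ((real k + 2) * gegen s (Suc (Suc k)) (Re \<omega>))"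
      unfolding Trec gegen_rec using Suc by simp
    moreover have "complex_of_real (real k + 2) \<noteq> 0" by (subst of_real_eq_0_iff) linarith
    ultimately show ?case using Suc by simp
  qed
  then show ?thesis
    unfolding T_def F_def fps_mult_nth by (simp add: atLeast0AtMost)
qed

text \<open>Equal to C_k^s(1), the case \<omega> = 1 of \<open>of_real_gegen\<close>; as the
  binomial coefficients are nonnegative, it dominates C_k^s on [-1, 1].\<close>

definition gegen_bound :: "real \<Rightarrow> nat \<Rightarrow> real" where
  "gegen_bound s k = (\<Sum>i\<le>k. binom_coeff s i * binom_coeff s (k - i))"

lemma abs_gegen_le:
  assumes "s > 0" "\<bar>w\<bar> \<le> 1"
  shows "\<bar>gegen s k w\<bar> \<le> gegen_bound s k"
proof -
  define \<omega> where "\<omega> = Complex w (sqrt (1 - w\<^sup>2))"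
  have \<omega>: "norm \<omega> = 1" "Re \<omega> = w"
    using assms(2) by (simp_all add: \<omega>_def cmod_def abs_square_le_1)
  have "\<bar>gegen s k w\<bar> = norm (complex_of_real (gegen s k (Re \<omega>)))" by (simp add: \<omega>)
  also have "\<dots> \<le> (\<Sum>i\<le>k. norm ((complex_of_real (binom_coeff s i) * \<omega> ^ i) * (complex_of_real (binom_coeff s (k - i)) * cnj \<omega> ^ (k - i))))"
    unfolding of_real_gegen[OF \<omega>(1)] by (rule norm_sum)
  also have "\<dots> = gegen_bound s k"
    using binom_coeff_nonneg[OF assms(1)] by (simp add: gegen_bound_def norm_mult norm_power \<omega>)
  finally show ?thesis .
qed

lemma summable_binom_coeff:
  assumes "0 \<le> z" "z < 1"
  shows "summable (\<lambda>i. binom_coeff s i * z ^ i)"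
proof -
  have "(\<lambda>n. (- s gchoose n) * (- z) ^ n) sums (1 + (- z)) powr (- s)"
    using assms by (intro gen_binomial_real) auto
  moreover have "(- s gchoose n) * (- z) ^ n = binom_coeff s n * z ^ n" for n
    unfolding gbinomial_pochhammer binom_coeff_def power_minus[of z] by simp
  ultimately show ?thesis by (simp add: sums_iff)
qed

lemma summable_gegen_bound:
  assumes "s > 0" "0 \<le> z" "z < 1"
  shows "summable (\<lambda>k. z ^ k * gegen_bound s k)"
proof -
  have "summable (\<lambda>i. norm (binom_coeff s i * z ^ i))"
    using summable_binom_coeff[OF assms(2,3), of s] assms binom_coeff_nonneg[OF assms(1)] by (simp add: abs_mult)
  from Cauchy_product_sums[OF this this]
  have "summable (\<lambda>k. \<Sum>i\<le>k. binom_coeff s i * z ^ i * (binom_coeff s (k - i) * z ^ (k - i)))"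
    by (rule sums_summable)
  also have "(\<lambda>k. \<Sum>i\<le>k. binom_coeff s i * z ^ i * (binom_coeff s (k - i) * z ^ (k - i))) =
      (\<lambda>k. z ^ k * gegen_bound s k)"
    unfolding gegen_bound_def sum_distrib_left
  proof (intro ext sum.cong refl)
    fix k i :: nat assume "i \<in> {..k}"
    then have "z ^ k = z ^ i * z ^ (k - i)" by (simp add: power_add[symmetric])
    then show "binom_coeff s i * z ^ i * (binom_coeff s (k - i) * z ^ (k - i)) =
        z ^ k * (binom_coeff s i * binom_coeff s (k - i))" by simp
  qed
  finally show ?thesis .
qed

text \<open>With w = Re \<omega>, the two binomial series sum to complex conjugates, so their
  product is |1 - \<omega> z|^(-2s).\<close>

lemma gegen_sums:
  assumes "s > 0" "\<bar>w\<bar> \<le> 1" "0 \<le> z" "z < 1"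
  shows "(\<lambda>k. z ^ k * gegen s k w) sums (1 - 2 * z * w + z\<^sup>2) powr (- s)"
proof -
  define \<omega> where "\<omega> = Complex w (sqrt (1 - w\<^sup>2))"
  have \<omega>: "norm \<omega> = 1" "Re \<omega> = w"
    using assms(2) by (simp_all add: \<omega>_def cmod_def abs_square_le_1)
  define f where "f x i = complex_of_real (binom_coeff s i) * (x * of_real z) ^ i" for x i
  have norm_f: "summable (\<lambda>i. norm (f x i))" if "norm x = 1" for x
    using summable_binom_coeff[OF assms(3,4), of s] assms binom_coeff_nonneg[OF assms(1)] that
    by (simp add: f_def norm_mult norm_power)
  have f: "f x sums (1 - x * of_real z) powr (- of_real s)" if "norm x = 1" for x
  proof -
    have "(\<lambda>n. (- of_real s gchoose n) * (- (x * of_real z)) ^ n) sums (1 + (- (x * of_real z))) powr (- of_real s)"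
      using assms that by (intro gen_binomial_complex) (auto simp: norm_mult)
    moreover have "(- of_real s gchoose n) * (- (x * of_real z)) ^ n = f x n" for n
      unfolding gbinomial_pochhammer binom_coeff_def power_minus[of "x * of_real z"] f_def
      by (simp add: pochhammer_of_real)
    ultimately show ?thesis by simp
  qed
  have nc: "norm (cnj \<omega>) = 1" using \<omega> by simp
  define Z where "Z = 1 - \<omega> * of_real z"
  \<comment> \<open>This keeps \<open>Z\<close> off the branch cut, where conjugation and the
    complex power commute.\<close>
  have Re: "Re Z > 0"
  proof -
    have "w * z < 1" using assms
      by (metis abs_ge_self abs_mult abs_of_nonneg dual_order.strict_trans2 mult_left_le_one_le order.trans abs_ge_zero)
    then show ?thesis by (simp add: Z_def \<omega>)
  qed
  have "(\<Sum>k. f \<omega> k) * (\<Sum>k. f (cnj \<omega>) k) = Z powr (- of_real s) * cnj Z powr (- of_real s)"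
    using f[OF \<omega>(1)] f[OF nc] by (simp add: sums_iff Z_def)
  also have "cnj Z powr (- of_real s) = cnj (Z powr (- of_real s))"
    using Re by (subst cnj_powr) (auto simp: complex_nonpos_Reals_iff)
  also have "Z powr (- of_real s) * cnj (Z powr (- of_real s)) = of_real ((norm (Z powr (- of_real s)))\<^sup>2)"
    by (simp add: complex_norm_square del: of_real_power)
  also have "norm (Z powr (- of_real s)) = norm Z powr (- s)"
    by (subst norm_powr_real_powr') auto
  also have "(norm Z powr (- s))\<^sup>2 = ((norm Z)\<^sup>2) powr (- s)"
    by (simp add: power2_eq_square powr_mult)
  also have "(norm Z)\<^sup>2 = 1 - 2 * z * w + z\<^sup>2"
  proof -
    have "(norm Z)\<^sup>2 = (1 - w * z)\<^sup>2 + (sqrt (1 - w\<^sup>2) * z)\<^sup>2"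
      by (simp add: Z_def \<omega>_def cmod_power2)
    also have "\<dots> = 1 - 2 * z * w + z\<^sup>2"
      using assms(2) by (simp add: power_mult_distrib abs_square_le_1) (simp add: power2_eq_square algebra_simps)
    finally show ?thesis .
  qed
  finally have "(\<lambda>k. \<Sum>i\<le>k. f \<omega> i * f (cnj \<omega>) (k - i)) sums of_real ((1 - 2 * z * w + z\<^sup>2) powr (- s))"
    using Cauchy_product_sums[OF norm_f[OF \<omega>(1)] norm_f[OF nc]] by simp
  moreover have "(\<Sum>i\<le>k. f \<omega> i * f (cnj \<omega>) (k - i)) = of_real (z ^ k * gegen s k w)" for k
  proof -
    have "f \<omega> i * f (cnj \<omega>) (k - i) = of_real (z ^ k) *
        ((complex_of_real (binom_coeff s i) * \<omega> ^ i) * (complex_of_real (binom_coeff s (k - i)) * cnj \<omega> ^ (k - i)))" if "i \<le> k" for i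
    proof -
      have "complex_of_real z ^ k = of_real z ^ i * of_real z ^ (k - i)"
        using that by (simp add: power_add[symmetric])
      then show ?thesis by (simp add: f_def power_mult_distrib mult_ac)
    qed
    then show ?thesis
      using of_real_gegen[OF \<omega>(1), of s k] unfolding \<omega>(2) by (simp add: sum_distrib_left)
  qed
  ultimately have "(\<lambda>k. complex_of_real (z ^ k * gegen s k w)) sums of_real ((1 - 2 * z * w + z\<^sup>2) powr (- s))"
    by (simp only:)
  then show ?thesis by (simp only: sums_of_real_iff)
qed

section \<open>Termwise integration\<close>

context pair_sigma_finite
begin

lemma integrable_prod_mult:
  fixes f :: "'a \<Rightarrow> real" and g :: "'b \<Rightarrow> real"
  assumes [measurable]: "integrable M1 f" "integrable M2 g"
  shows "integrable (M1 \<Otimes>\<^sub>M M2) (\<lambda>(x, y). f x * g y)"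
proof (rule Fubini_integrable)
  show "AE x in M1. integrable M2 (\<lambda>y. case (x, y) of (x, y) \<Rightarrow> f x * g y)" using assms by simp
  have "(\<lambda>x. \<integral>y. norm (case (x, y) of (x, y) \<Rightarrow> f x * g y) \<partial>M2) = (\<lambda>x. \<bar>f x\<bar> * (\<integral>y. \<bar>g y\<bar> \<partial>M2))"
    by (simp add: abs_mult)
  then show "integrable M1 (\<lambda>x. \<integral>y. norm (case (x, y) of (x, y) \<Rightarrow> f x * g y) \<partial>M2)" using assms by simp
qed measurable

lemma integral_prod_mult:
  fixes f :: "'a \<Rightarrow> real" and g :: "'b \<Rightarrow> real"
  assumes "integrable M1 f" "integrable M2 g"
  shows "(\<integral>(x, y). f x * g y \<partial>(M1 \<Otimes>\<^sub>M M2)) = (\<integral>x. f x \<partial>M1) * (\<integral>y. g y \<partial>M2)"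
  using integral_fst[OF integrable_prod_mult[OF assms]] by simp

end

text \<open>Dominated termwise integration, kept general in both measures so that it applies to
  \<open>dPi\<close> and \<open>lborel_I\<close> alike. \<open>h1\<close> and \<open>h2\<close>
  carry the weights, \<open>B\<close> the numerical majorant; each term is a finite sum of products
  and so factors by Fubini.\<close>

lemma pair_integral_sums:
  fixes M1 M2 :: "real measure" and f g :: "'i \<Rightarrow> real \<Rightarrow> real"
  assumes "sigma_finite_measure M1" "sigma_finite_measure M2"
    and id1 [measurable]: "(\<lambda>u. u) \<in> borel_measurable M1" and id2 [measurable]: "(\<lambda>v. v) \<in> borel_measurable M2"
    and f: "\<And>x. integrable M1 (f x)" and g: "\<And>x. integrable M2 (g x)"
    and h: "integrable M1 h1" "integrable M2 h2"
    and AE1: "AE u in M1. \<bar>u\<bar> \<le> 1" and AE2: "AE v in M2. \<bar>v\<bar> \<le> 1"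
    and \<Phi> [measurable]: "(\<lambda>(u, v). \<Phi> u v) \<in> borel_measurable (M1 \<Otimes>\<^sub>M M2)"
    and bound: "\<And>u v k. \<bar>u\<bar> \<le> 1 \<Longrightarrow> \<bar>v\<bar> \<le> 1 \<Longrightarrow> \<bar>\<Sum>x\<in>S k. e k x * (f x u * g x v)\<bar> \<le> B k * \<bar>h1 u * h2 v\<bar>"
    and sums: "\<And>u v. \<bar>u\<bar> \<le> 1 \<Longrightarrow> \<bar>v\<bar> \<le> 1 \<Longrightarrow> (\<lambda>k. \<Sum>x\<in>S k. e k x * (f x u * g x v)) sums \<Phi> u v"
    and B: "summable B"
  shows "(\<lambda>k. \<Sum>x\<in>S k. e k x * ((\<integral>u. f x u \<partial>M1) * (\<integral>v. g x v \<partial>M2))) sums (\<integral>(u, v). \<Phi> u v \<partial>(M1 \<Otimes>\<^sub>M M2))"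
proof -
  interpret M1: sigma_finite_measure M1 by fact
  interpret M2: sigma_finite_measure M2 by fact
  interpret pair_sigma_finite M1 M2 ..
  let ?M = "M1 \<Otimes>\<^sub>M M2"
  define F where "F k = (\<lambda>(u, v). \<Sum>x\<in>S k. e k x * (f x u * g x v))" for k
  have F_alt: "F k = (\<lambda>p. \<Sum>x\<in>S k. e k x * (case p of (u, v) \<Rightarrow> f x u * g x v))" for k
    by (auto simp: F_def fun_eq_iff)
  have intF: "integrable ?M (F k)" for k
    unfolding F_alt by (intro Bochner_Integration.integrable_sum integrable_mult_right integrable_prod_mult f g)
  have [measurable]: "F k \<in> borel_measurable ?M" for k
    using intF by (rule borel_measurable_integrable)
  have F: "integral\<^sup>L ?M (F k) = (\<Sum>x\<in>S k. e k x * ((\<integral>u. f x u \<partial>M1) * (\<integral>v. g x v \<partial>M2)))" for k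
    unfolding F_alt
    by (subst Bochner_Integration.integral_sum)
       (auto intro!: integrable_mult_right integrable_prod_mult f g simp: integral_prod_mult[OF f g])
  have AE: "AE p in ?M. \<bar>fst p\<bar> \<le> 1 \<and> \<bar>snd p\<bar> \<le> 1"
    by (rule AE_pair_measure) (use AE1 AE2 in \<open>auto\<close>)
  have h12: "integrable ?M (\<lambda>(u, v). h1 u * h2 v)" using h by (rule integrable_prod_mult)
  have Fle: "norm (F k p) \<le> B k * \<bar>case p of (u, v) \<Rightarrow> h1 u * h2 v\<bar>" if "\<bar>fst p\<bar> \<le> 1 \<and> \<bar>snd p\<bar> \<le> 1" for k p
    using bound[of "fst p" "snd p" k] that by (simp add: F_def case_prod_unfold)
  have "(\<lambda>k. integral\<^sup>L ?M (F k)) sums (\<integral>p. (\<Sum>k. F k p) \<partial>?M)"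
  proof (rule sums_integral)
    show "AE p in ?M. summable (\<lambda>k. norm (F k p))"
      using AE
    proof eventually_elim
      case (elim p)
      show ?case
        by (rule summable_comparison_test'[of _ 0, OF summable_mult2[OF B]]) (use Fle[OF elim] in simp)
    qed
    show "summable (\<lambda>k. \<integral>p. norm (F k p) \<partial>?M)"
    proof (rule summable_comparison_test'[of _ 0, OF summable_mult2[OF B]])
      fix k
      have "(\<integral>p. norm (F k p) \<partial>?M) \<le> (\<integral>p. B k * \<bar>case p of (u, v) \<Rightarrow> h1 u * h2 v\<bar> \<partial>?M)"
      proof (rule integral_mono_AE)
        show "AE p in ?M. norm (F k p) \<le> B k * \<bar>case p of (u, v) \<Rightarrow> h1 u * h2 v\<bar>"
          using AE by eventually_elim (rule Fle)
      qed (use intF h12 in \<open>auto intro!: integrable_norm integrable_abs\<close>)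
      then show "norm (\<integral>p. norm (F k p) \<partial>?M) \<le> B k * (\<integral>p. \<bar>case p of (u, v) \<Rightarrow> h1 u * h2 v\<bar> \<partial>?M)"
        by simp
    qed
  qed (rule intF)
  also have "(\<integral>p. (\<Sum>k. F k p) \<partial>?M) = (\<integral>(u, v). \<Phi> u v \<partial>?M)"
  proof (rule integral_cong_AE)
    show "AE p in ?M. (\<Sum>k. F k p) = (case p of (u, v) \<Rightarrow> \<Phi> u v)"
      using AE
    proof eventually_elim
      case (elim p)
      then show ?case
        using sums_unique[OF sums[of "fst p" "snd p"]] by (simp add: F_def case_prod_unfold)
    qed
  qed measurable
  finally show ?thesis unfolding F .
qed

section \<open>Derivatives of Gegenbauer polynomials and expansion in powers of u and v\<close>

text \<open>The \<open>p\<close>-th derivative of the Gegenbauer polynomial \<open>C_k^s\<close>.\<close>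

definition gegenD :: "nat \<Rightarrow> real \<Rightarrow> nat \<Rightarrow> real \<Rightarrow> real" where
  "gegenD p s k w = (if k < p then 0 else 2 ^ p * pochhammer s p * gegen (s + real p) (k - p) w)"

lemma DERIV_gegenD: "(gegenD p s k has_real_derivative gegenD (Suc p) s k w) (at w)"
proof (cases "k < p")
  case True
  then show ?thesis by (simp add: gegenD_def[abs_def])
next
  case False
  then have "((\<lambda>w. 2 ^ p * pochhammer s p * gegen (s + real p) (k - p) w) has_real_derivative
      2 ^ p * pochhammer s p * (if k - p = 0 then 0 else 2 * (s + real p) * gegen (s + real p + 1) (k - p - 1) w)) (at w)"
    by (intro DERIV_cmult DERIV_gegen)
  also have "2 ^ p * pochhammer s p * (if k - p = 0 then 0 else 2 * (s + real p) * gegen (s + real p + 1) (k - p - 1) w) =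
      gegenD (Suc p) s k w"
    using False by (auto simp: gegenD_def pochhammer_rec' add_ac)
  finally show ?thesis using False by (simp add: gegenD_def[abs_def])
qed

definition gegenD_bound :: "nat \<Rightarrow> real \<Rightarrow> nat \<Rightarrow> real" where
  "gegenD_bound p s k = (if k < p then 0 else 2 ^ p * pochhammer s p * gegen_bound (s + real p) (k - p))"

lemma abs_gegenD_le:
  assumes "s > 0" "\<bar>w\<bar> \<le> 1"
  shows "\<bar>gegenD p s k w\<bar> \<le> gegenD_bound p s k"
  using abs_gegen_le[of "s + real p" w "k - p"] assms pochhammer_pos[OF assms(1), of p]
  by (auto simp: gegenD_def gegenD_bound_def abs_mult intro!: mult_left_mono)

lemma summable_gegenD_bound:
  assumes "s > 0" "0 \<le> z" "z < 1"
  shows "summable (\<lambda>k. z ^ k * gegenD_bound p s k)"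
proof -
  have "summable (\<lambda>k. (z ^ p * 2 ^ p * pochhammer s p) * (z ^ k * gegen_bound (s + real p) k))"
    using assms by (intro summable_mult summable_gegen_bound) auto
  then have "summable (\<lambda>k. z ^ (k + p) * gegenD_bound p s (k + p))"
    by (simp add: gegenD_bound_def power_add mult_ac)
  then show ?thesis by (subst (asm) summable_iff_shift)
qed

text \<open>The p-th w-derivative of the generating function, obtained from the undifferentiated
  series with parameter s + p.\<close>

lemma gegenD_sums:
  assumes "s > 0" "\<bar>w\<bar> \<le> 1" "0 \<le> z" "z < 1"
  shows "(\<lambda>k. z ^ k * gegenD p s k w) sums
    ((2 * z) ^ p * pochhammer s p * (1 - 2 * z * w + z\<^sup>2) powr (- (s + real p)))"
proof -
  have "(\<lambda>k. (2 * z) ^ p * pochhammer s p * (z ^ k * gegen (s + real p) k w)) sums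
    ((2 * z) ^ p * pochhammer s p * (1 - 2 * z * w + z\<^sup>2) powr (- (s + real p)))"
    using assms by (intro sums_mult gegen_sums) auto
  also have "(\<lambda>k. (2 * z) ^ p * pochhammer s p * (z ^ k * gegen (s + real p) k w)) =
      (\<lambda>k. z ^ (k + p) * gegenD p s (k + p) w)"
    by (simp add: gegenD_def power_add power_mult_distrib mult_ac)
  finally have "(\<lambda>k. z ^ (k + p) * gegenD p s (k + p) w) sums
    ((2 * z) ^ p * pochhammer s p * (1 - 2 * z * w + z\<^sup>2) powr (- (s + real p)))" .
  \<comment> \<open>The p terms skipped by the shift are zero.\<close>
  then show ?thesis by (subst (asm) sums_iff_shift) (simp add: gegenD_def)
qed

text \<open>The triple \<open>(m, i, j)\<close> indexes the monomial \<open>u^i v^j\<close> of \<open>C_k^s (a u + b v)\<close>, where \<open>2 m + i + j = k\<close>.\<close>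

definition triples :: "nat \<Rightarrow> (nat \<times> nat \<times> nat) set" where
  "triples k = {(m, i, j). 2 * m + i + j = k}"

lemma finite_triples [simp]: "finite (triples k)"
  by (rule finite_subset[of _ "{..k} \<times> {..k} \<times> {..k}"]) (auto simp: triples_def)

definition triple_coeff :: "real \<Rightarrow> real \<Rightarrow> real \<Rightarrow> nat \<times> nat \<times> nat \<Rightarrow> real" where
  "triple_coeff s a b = (\<lambda>(m, i, j). (-1) ^ m * pochhammer s (m + i + j) * (2 * a) ^ i * (2 * b) ^ j / (fact m * fact i * fact j))"

lemma gegen_bilinear:
  "gegen s k (a * u + b * v) = (\<Sum>x\<in>triples k. triple_coeff s a b x * (u ^ fst (snd x) * v ^ snd (snd x)))"
proof -
  have "gegen s k (a * u + b * v) =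
      (\<Sum>(m, l)\<in>antidiag2 k. \<Sum>i\<le>l. gegen_coeff s m l * (real (l choose i) * (a * u) ^ i * (b * v) ^ (l - i)))"
    unfolding gegen_def binomial_ring by (simp add: sum_distrib_left)
  also have "\<dots> = (\<Sum>((m, l), i)\<in>Sigma (antidiag2 k) (\<lambda>(m, l). {..l}).
      gegen_coeff s m l * (real (l choose i) * (a * u) ^ i * (b * v) ^ (l - i)))"
    by (subst sum.Sigma[symmetric]) (auto simp: case_prod_unfold)
  also have "\<dots> = (\<Sum>x\<in>triples k. triple_coeff s a b x * (u ^ fst (snd x) * v ^ snd (snd x)))"
  proof (rule sum.reindex_bij_witness[where j = "\<lambda>((m, l), i). (m, i, l - i)" and i = "\<lambda>(m, i, j). ((m, i + j), i)"], goal_cases)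
    case (5 x)
    then obtain m i j where x: "x = ((m, i + j), i)"
      by (auto simp: antidiag2_def) (metis le_add_diff_inverse)
    have "real ((i + j) choose i) = fact (i + j) / (fact i * fact j)"
      using binomial_fact[of i "i + j", where ?'a = real] by simp
    then show ?case
      by (simp add: x triple_coeff_def gegen_coeff_def power_mult_distrib power_add add_ac mult_ac)
  qed (auto simp: triples_def antidiag2_def)
  finally show ?thesis .
qed

text \<open>The p-th derivative of u^i for p = 0 or 1; the value p = 1 stands for every nonzero
  p.\<close>

definition deriv_power :: "nat \<Rightarrow> nat \<Rightarrow> real \<Rightarrow> real" where
  "deriv_power p i u = (if p = 0 then u ^ i else real i * u ^ (i - 1))"

text \<open>Each identity is the derivative of an earlier one in u or v; uniqueness of derivatives
  replaces a new computation of coefficients.\<close>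

lemma gegenD_bilinear:
  assumes "p \<le> 1" "q \<le> 1"
  shows "a ^ p * b ^ q * gegenD (p + q) s k (a * u + b * v) =
    (\<Sum>x\<in>triples k. triple_coeff s a b x * (deriv_power p (fst (snd x)) u * deriv_power q (snd (snd x)) v))"
proof -
  let ?c = "triple_coeff s a b" and ?i = "\<lambda>x. fst (snd x)" and ?j = "\<lambda>x. snd (snd x)"
  have d: "((\<lambda>u. gegenD p s k (a * u + c)) has_real_derivative a * gegenD (Suc p) s k (a * u + c)) (at u)" for p a c u
  proof -
    have "((\<lambda>u. a * u + c) has_real_derivative a) (at u)" by (auto intro!: derivative_eq_intros)
    from DERIV_chain2[OF DERIV_gegenD this] show ?thesis by (rule DERIV_cong) simp
  qed
  have 00: "gegenD 0 s k (a * u + b * v) = (\<Sum>x\<in>triples k. ?c x * (u ^ ?i x * v ^ ?j x))" for u v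
    by (simp add: gegenD_def gegen_bilinear)
  have 10: "a * gegenD 1 s k (a * u + b * v) = (\<Sum>x\<in>triples k. ?c x * ((real (?i x) * u ^ (?i x - 1)) * v ^ ?j x))" for u v
  proof (rule DERIV_unique)
    show "((\<lambda>u. gegenD 0 s k (a * u + b * v)) has_real_derivative a * gegenD 1 s k (a * u + b * v)) (at u)"
      using d[of 0 a "b * v" u] by simp
    show "((\<lambda>u. gegenD 0 s k (a * u + b * v)) has_real_derivative
        (\<Sum>x\<in>triples k. ?c x * ((real (?i x) * u ^ (?i x - 1)) * v ^ ?j x))) (at u)"
      unfolding 00 by (auto intro!: derivative_eq_intros sum.cong)
  qed
  have 01: "b * gegenD 1 s k (a * u + b * v) = (\<Sum>x\<in>triples k. ?c x * (u ^ ?i x * (real (?j x) * v ^ (?j x - 1))))" for u v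
  proof (rule DERIV_unique)
    show "((\<lambda>v. gegenD 0 s k (a * u + b * v)) has_real_derivative b * gegenD 1 s k (a * u + b * v)) (at v)"
      using d[of 0 b "a * u" v] by (simp add: add.commute)
    show "((\<lambda>v. gegenD 0 s k (a * u + b * v)) has_real_derivative
        (\<Sum>x\<in>triples k. ?c x * (u ^ ?i x * (real (?j x) * v ^ (?j x - 1))))) (at v)"
      unfolding 00 by (auto intro!: derivative_eq_intros sum.cong)
  qed
  have 11: "a * b * gegenD 2 s k (a * u + b * v) =
     (\<Sum>x\<in>triples k. ?c x * ((real (?i x) * u ^ (?i x - 1)) * (real (?j x) * v ^ (?j x - 1))))"
  proof (rule DERIV_unique)
    show "((\<lambda>v. a * gegenD 1 s k (a * u + b * v)) has_real_derivative a * b * gegenD 2 s k (a * u + b * v)) (at v)"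
      using DERIV_cmult[OF d[of 1 b "a * u" v], of a] by (simp add: add.commute mult.assoc numeral_2_eq_2)
    show "((\<lambda>v. a * gegenD 1 s k (a * u + b * v)) has_real_derivative
        (\<Sum>x\<in>triples k. ?c x * ((real (?i x) * u ^ (?i x - 1)) * (real (?j x) * v ^ (?j x - 1))))) (at v)"
      unfolding 10 by (auto intro!: derivative_eq_intros sum.cong)
  qed
  have "p = 0 \<or> p = 1" "q = 0 \<or> q = 1" using assms by auto
  then show ?thesis
    using 00[of u v] 10[of u v] 01[of u v] 11 by (auto simp: deriv_power_def numeral_2_eq_2)
qed

section \<open>The Poisson kernel\<close>

text \<open>The closed form of the series in \<open>gegenD_sums\<close>.\<close>

definition gegenD_gf :: "real \<Rightarrow> real \<Rightarrow> nat \<Rightarrow> real \<Rightarrow> real" where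
  "gegenD_gf z s p w = (2 * z) ^ p * pochhammer s p * (1 - 2 * z * w + z\<^sup>2) powr (- (s + real p))"

lemma DERIV_gegenD_gf:
  assumes "1 - 2 * z * w + z\<^sup>2 > 0"
  shows "(gegenD_gf z s p has_real_derivative gegenD_gf z s (Suc p) w) (at w)"
proof -
  have "((\<lambda>w. (1 - 2 * z * w + z\<^sup>2) powr (- (s + real p))) has_real_derivative
      - (s + real p) * (1 - 2 * z * w + z\<^sup>2) powr (- (s + real p) - of_nat 1) * (- 2 * z)) (at w)"
    using assms by (intro DERIV_fun_powr) (auto intro!: derivative_eq_intros)
  then have "(gegenD_gf z s p has_real_derivative (2 * z) ^ p * pochhammer s p *
      (- (s + real p) * (1 - 2 * z * w + z\<^sup>2) powr (- (s + real p) - of_nat 1) * (- 2 * z))) (at w)"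
    unfolding gegenD_gf_def[abs_def] by (rule DERIV_cmult)
  moreover have "- (s + real p) - of_nat 1 = - (s + real (Suc p))" by simp
  moreover have "(2 * z) ^ p * pochhammer s p * (- (s + real p) * P * (- 2 * z)) =
      (2 * z) ^ Suc p * pochhammer s (Suc p) * P" for P
    by (simp add: pochhammer_rec' algebra_simps)
  ultimately show ?thesis by (simp only: gegenD_gf_def)
qed

text \<open>The closed form of f is assumed only where the base is positive. This set is open, so it
  determines \<open>deriv f\<close> at each of its points.\<close>

lemma deriv_gegenD_gf_affine:
  assumes z: "z > 0" and f: "\<And>x. 2 * z * (a * x + c) < 1 + z\<^sup>2 \<Longrightarrow> f x = \<kappa> * gegenD_gf z s p (a * x + c)"
    and u: "2 * z * (a * u + c) < 1 + z\<^sup>2"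
  shows "deriv f u = \<kappa> * (a * gegenD_gf z s (Suc p) (a * u + c))"
proof (rule DERIV_imp_deriv)
  let ?S = "{x. 2 * z * (a * x + c) < 1 + z\<^sup>2}"
  show "(f has_real_derivative \<kappa> * (a * gegenD_gf z s (Suc p) (a * u + c))) (at u)"
  proof (rule has_field_derivative_transform_within_open[where S = ?S])
    have "((\<lambda>u. a * u + c) has_real_derivative a) (at u)" by (auto intro!: derivative_eq_intros)
    moreover have "(gegenD_gf z s p has_real_derivative gegenD_gf z s (Suc p) (a * u + c)) (at (a * u + c))"
      using u by (intro DERIV_gegenD_gf) simp
    ultimately have "((\<lambda>u. gegenD_gf z s p (a * u + c)) has_real_derivative gegenD_gf z s (Suc p) (a * u + c) * a) (at u)"
      by (intro DERIV_chain2)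
    then show "((\<lambda>u. \<kappa> * gegenD_gf z s p (a * u + c)) has_real_derivative \<kappa> * (a * gegenD_gf z s (Suc p) (a * u + c))) (at u)"
      by (intro DERIV_cmult) (simp add: mult.commute)
    show "open ?S" by (intro open_Collect_less continuous_intros)
  qed (use u f in auto)
qed

text \<open>What remains of \<open>Psi\<close> after 2z(cosh(t/2) - w) = 1 - 2zw + z^2 and 2z
  sinh(t/2) = 1 - z^2.\<close>

definition poisson_const :: "real \<Rightarrow> real \<Rightarrow> real \<Rightarrow> real" where
  "poisson_const \<alpha> \<beta> t = c_const \<alpha> \<beta> * (2 * exp (- t / 2)) powr (\<alpha> + \<beta> + 1) * (1 - (exp (- t / 2))\<^sup>2)"

lemma Psi_eq:
  fixes \<alpha> \<beta> t \<theta> \<phi> u v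
  defines "z \<equiv> exp (- t / 2)" and "a \<equiv> sin (\<theta> / 2) * sin (\<phi> / 2)" and "b \<equiv> cos (\<theta> / 2) * cos (\<phi> / 2)"
  assumes "2 * z * (a * u + b * v) < 1 + z\<^sup>2"
  shows "Psi \<alpha> \<beta> t \<theta> \<phi> u v = poisson_const \<alpha> \<beta> t * gegenD_gf z (\<alpha> + \<beta> + 2) 0 (a * u + b * v)"
proof -
  define y where "y = cosh (t / 2) - (a * u + b * v)"
  let ?s = "\<alpha> + \<beta> + 2"
  have z: "z > 0" by (simp add: z_def)
  have ez: "exp (t / 2) = 1 / z" by (simp add: z_def exp_minus field_simps)
  have zz: "exp (- (t / 2)) = z" by (simp add: z_def)
  have c: "2 * z * cosh (t / 2) = 1 + z\<^sup>2"
    using z unfolding cosh_def zz ez by (simp add: field_simps power2_eq_square)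
  have sh: "2 * z * sinh (t / 2) = 1 - z\<^sup>2"
    using z unfolding sinh_def zz ez by (simp add: field_simps power2_eq_square)
  have X: "1 - 2 * z * (a * u + b * v) + z\<^sup>2 = 2 * z * y"
    unfolding y_def right_diff_distrib c by simp
  have "2 * z * y > 0" using assms(4) X by linarith
  then have y: "y > 0" using z by (simp add: zero_less_mult_iff)
  have "Psi \<alpha> \<beta> t \<theta> \<phi> u v = c_const \<alpha> \<beta> * sinh (t / 2) / y powr ?s"
    by (simp add: Psi_def q_fun_def y_def a_def b_def algebra_simps)
  also have "\<dots> = c_const \<alpha> \<beta> * sinh (t / 2) * y powr (- ?s) * 1"
    by (simp only: powr_minus_divide) simp
  \<comment> \<open>This splitting of 1 supplies the power of 2z that merges with y, plus the factor
    2z that sinh(t/2) requires.\<close>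
  also have "1 = (2 * z) powr (\<alpha> + \<beta> + 1) * (2 * z) powr (- ?s) * (2 * z)"
  proof -
    have "(2 * z) powr (\<alpha> + \<beta> + 1) * (2 * z) powr (- ?s) * (2 * z) powr 1 = (2 * z) powr 0"
      unfolding powr_add[symmetric] by simp
    then show ?thesis using z by simp
  qed
  also have "c_const \<alpha> \<beta> * sinh (t / 2) * y powr (- ?s) * ((2 * z) powr (\<alpha> + \<beta> + 1) * (2 * z) powr (- ?s) * (2 * z)) =
      poisson_const \<alpha> \<beta> t * ((2 * z) powr (- ?s) * y powr (- ?s))"
    unfolding poisson_const_def z_def[symmetric] sh[symmetric] by simp
  also have "(2 * z) powr (- ?s) * y powr (- ?s) = gegenD_gf z ?s 0 (a * u + b * v)"
    unfolding gegenD_gf_def X using z y by (simp add: powr_mult)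
  finally show ?thesis .
qed

text \<open>The strict inequality holds on the whole closed square, so the two-sided
  \<open>deriv\<close> is correct at u, v = -1, 1 as well, where the point masses sit.\<close>

lemma Psi_deriv_eq:
  fixes \<alpha> \<beta> t \<theta> \<phi> u v
  defines "z \<equiv> exp (- t / 2)" and "a \<equiv> sin (\<theta> / 2) * sin (\<phi> / 2)" and "b \<equiv> cos (\<theta> / 2) * cos (\<phi> / 2)"
  assumes uv: "2 * z * (a * u + b * v) < 1 + z\<^sup>2"
  shows Psi_u_eq: "Psi_u \<alpha> \<beta> t \<theta> \<phi> u v = poisson_const \<alpha> \<beta> t * (a * gegenD_gf z (\<alpha> + \<beta> + 2) 1 (a * u + b * v))"
    and Psi_v_eq: "Psi_v \<alpha> \<beta> t \<theta> \<phi> u v = poisson_const \<alpha> \<beta> t * (b * gegenD_gf z (\<alpha> + \<beta> + 2) 1 (a * u + b * v))"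
    and Psi_uv_eq: "Psi_uv \<alpha> \<beta> t \<theta> \<phi> u v = poisson_const \<alpha> \<beta> t * (a * b * gegenD_gf z (\<alpha> + \<beta> + 2) 2 (a * u + b * v))"
proof -
  let ?s = "\<alpha> + \<beta> + 2" and ?K = "poisson_const \<alpha> \<beta> t"
  have z: "z > 0" by (simp add: z_def)
  show "Psi_u \<alpha> \<beta> t \<theta> \<phi> u v = ?K * (a * gegenD_gf z ?s 1 (a * u + b * v))"
    unfolding Psi_u_def using deriv_gegenD_gf_affine[OF z Psi_eq[of t \<theta> \<phi> _ v \<alpha> \<beta>, folded z_def a_def b_def] uv] by simp
  have v: "Psi_v \<alpha> \<beta> t \<theta> \<phi> u v = ?K * (b * gegenD_gf z ?s 1 (a * u + b * v))" if "2 * z * (a * u + b * v) < 1 + z\<^sup>2" for u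
    using deriv_gegenD_gf_affine[OF z, of b "a * u" "\<lambda>y. Psi \<alpha> \<beta> t \<theta> \<phi> u y" ?K ?s 0 v]
      Psi_eq[of t \<theta> \<phi> u _ \<alpha> \<beta>, folded z_def a_def b_def] that
    by (simp add: add.commute[of "a * u"] Psi_v_def)
  then show "Psi_v \<alpha> \<beta> t \<theta> \<phi> u v = ?K * (b * gegenD_gf z ?s 1 (a * u + b * v))" using uv .
  \<comment> \<open>The factor b joins the constant so that the affine lemma can be applied a second
    time, now in u.\<close>
  have v': "Psi_v \<alpha> \<beta> t \<theta> \<phi> x v = (?K * b) * gegenD_gf z ?s 1 (a * x + b * v)" if "2 * z * (a * x + b * v) < 1 + z\<^sup>2" for x
    using v[OF that] by simp
  show "Psi_uv \<alpha> \<beta> t \<theta> \<phi> u v = ?K * (a * b * gegenD_gf z ?s 2 (a * u + b * v))"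
    unfolding Psi_uv_def using deriv_gegenD_gf_affine[OF z v' uv] by (simp add: numeral_2_eq_2 mult_ac)
qed

text \<open>The last bound is cos((\<theta>-\<phi>)/2) \<le> 1; it keeps the Gegenbauer argument in
  [-1, 1].\<close>

lemma sin_cos_half_le:
  fixes \<theta> \<phi> :: real
  assumes "\<theta> \<in> {0..pi}" "\<phi> \<in> {0..pi}"
  shows "0 \<le> sin (\<theta> / 2) * sin (\<phi> / 2)" "0 \<le> cos (\<theta> / 2) * cos (\<phi> / 2)"
    "sin (\<theta> / 2) * sin (\<phi> / 2) + cos (\<theta> / 2) * cos (\<phi> / 2) \<le> 1"
proof -
  show "0 \<le> sin (\<theta> / 2) * sin (\<phi> / 2)" "0 \<le> cos (\<theta> / 2) * cos (\<phi> / 2)"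
    using assms by (auto intro!: mult_nonneg_nonneg sin_ge_zero cos_ge_zero)
  show "sin (\<theta> / 2) * sin (\<phi> / 2) + cos (\<theta> / 2) * cos (\<phi> / 2) \<le> 1"
    using cos_le_one[of "\<theta> / 2 - \<phi> / 2"] by (simp add: cos_diff)
qed

lemma abs_bilinear_le:
  fixes a b u v :: real
  assumes "0 \<le> a" "0 \<le> b" "a + b \<le> 1" "\<bar>u\<bar> \<le> 1" "\<bar>v\<bar> \<le> 1"
  shows "\<bar>a * u + b * v\<bar> \<le> 1"
proof -
  have "\<bar>a * u + b * v\<bar> \<le> a * \<bar>u\<bar> + b * \<bar>v\<bar>"
    using assms abs_triangle_ineq[of "a * u" "b * v"] by (simp add: abs_mult)
  also have "\<dots> \<le> a * 1 + b * 1" using assms by (intro add_mono mult_left_mono) auto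
  finally show ?thesis using assms by simp
qed

lemma two_z_mult_less:
  fixes z w :: real
  assumes "0 < z" "z < 1" "\<bar>w\<bar> \<le> 1"
  shows "2 * z * w < 1 + z\<^sup>2"
proof -
  have "2 * z * w \<le> 2 * z * 1" using assms by (intro mult_left_mono) auto
  moreover have "0 < (1 - z)\<^sup>2" using assms by simp
  ultimately show ?thesis by (simp add: power2_eq_square algebra_simps)
qed

text \<open>Here p and q record whether u and v are differentiated. The weights are constants
  against \<open>dPi\<close> and multiples of \<open>Pi_fun\<close> against
  \<open>lborel_I\<close>.\<close>

lemma weighted_integral_sums:
  fixes M1 M2 :: "real measure"
  assumes s: "s > 0" and z: "0 < z" "z < 1" and ab: "0 \<le> a" "0 \<le> b" "a + b \<le> 1" and pq: "p \<le> 1" "q \<le> 1"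
    and sf: "sigma_finite_measure M1" "sigma_finite_measure M2"
    and id: "(\<lambda>u. u) \<in> borel_measurable M1" "(\<lambda>v. v) \<in> borel_measurable M2"
    and f: "\<And>i. integrable M1 (\<lambda>u. deriv_power p i u * h1 u)" and g: "\<And>j. integrable M2 (\<lambda>v. deriv_power q j v * h2 v)"
    and AE: "AE u in M1. \<bar>u\<bar> \<le> 1" "AE v in M2. \<bar>v\<bar> \<le> 1"
    and \<Phi>: "(\<lambda>(u, v). \<Phi> u v) \<in> borel_measurable (M1 \<Otimes>\<^sub>M M2)"
      "\<And>u v. \<bar>u\<bar> \<le> 1 \<Longrightarrow> \<bar>v\<bar> \<le> 1 \<Longrightarrow> \<Phi> u v = a ^ p * b ^ q * gegenD_gf z s (p + q) (a * u + b * v) * (h1 u * h2 v)"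
  shows "(\<lambda>k. \<Sum>x\<in>triples k. z ^ k * triple_coeff s a b x *
      ((\<integral>u. deriv_power p (fst (snd x)) u * h1 u \<partial>M1) * (\<integral>v. deriv_power q (snd (snd x)) v * h2 v \<partial>M2)))
    sums (\<integral>(u, v). \<Phi> u v \<partial>(M1 \<Otimes>\<^sub>M M2))"
proof (rule pair_integral_sums[where ?h1.0 = h1 and ?h2.0 = h2 and B = "\<lambda>k. a ^ p * b ^ q * (z ^ k * gegenD_bound (p + q) s k)"])
  \<comment> \<open>Taking i = p in the integrability hypothesis thus gives integrability of the
    bare weight.\<close>
  have one: "deriv_power r r u = 1" if "r \<le> 1" for r u using that by (cases r) (auto simp: deriv_power_def)
  show "integrable M1 h1" using f[of p] pq by (simp add: one)
  show "integrable M2 h2" using g[of q] pq by (simp add: one)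
  have *: "(\<Sum>x\<in>triples k. z ^ k * triple_coeff s a b x * (deriv_power p (fst (snd x)) u * h1 u * (deriv_power q (snd (snd x)) v * h2 v))) =
     a ^ p * b ^ q * (z ^ k * gegenD (p + q) s k (a * u + b * v)) * (h1 u * h2 v)" for k u v
  proof -
    have "a ^ p * b ^ q * (z ^ k * gegenD (p + q) s k (a * u + b * v)) * (h1 u * h2 v) =
       z ^ k * (a ^ p * b ^ q * gegenD (p + q) s k (a * u + b * v)) * (h1 u * h2 v)" by simp
    also have "\<dots> = (\<Sum>x\<in>triples k. z ^ k * (triple_coeff s a b x * (deriv_power p (fst (snd x)) u * deriv_power q (snd (snd x)) v)) * (h1 u * h2 v))"
      unfolding gegenD_bilinear[OF pq] by (simp add: sum_distrib_left sum_distrib_right)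
    finally show ?thesis by (simp add: mult_ac)
  qed
  fix u v :: real assume uv: "\<bar>u\<bar> \<le> 1" "\<bar>v\<bar> \<le> 1"
  then have w: "\<bar>a * u + b * v\<bar> \<le> 1" using ab by (intro abs_bilinear_le)
  show "\<bar>\<Sum>x\<in>triples k. z ^ k * triple_coeff s a b x * (deriv_power p (fst (snd x)) u * h1 u * (deriv_power q (snd (snd x)) v * h2 v))\<bar>
      \<le> a ^ p * b ^ q * (z ^ k * gegenD_bound (p + q) s k) * \<bar>h1 u * h2 v\<bar>" for k
  proof -
    have "a ^ p * b ^ q * (z ^ k * \<bar>gegenD (p + q) s k (a * u + b * v)\<bar>) * \<bar>h1 u * h2 v\<bar> \<le>
       a ^ p * b ^ q * (z ^ k * gegenD_bound (p + q) s k) * \<bar>h1 u * h2 v\<bar>"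
      using ab z by (intro mult_right_mono mult_left_mono abs_gegenD_le s w) auto
    then show ?thesis unfolding * using ab z by (simp add: abs_mult)
  qed
  show "(\<lambda>k. \<Sum>x\<in>triples k. z ^ k * triple_coeff s a b x * (deriv_power p (fst (snd x)) u * h1 u * (deriv_power q (snd (snd x)) v * h2 v))) sums \<Phi> u v"
    unfolding * \<Phi>(2)[OF uv] gegenD_gf_def
    using s z w by (intro sums_mult sums_mult2 gegenD_sums) auto
next
  show "summable (\<lambda>k. a ^ p * b ^ q * (z ^ k * gegenD_bound (p + q) s k))"
    using s z by (intro summable_mult summable_gegenD_bound) auto
qed (fact sf id f g AE \<Phi>(1))+

section \<open>Moment sums and their identification with the Poisson series\<close>

definition moment_sum :: "real \<Rightarrow> real \<Rightarrow> real \<Rightarrow> real \<Rightarrow> nat \<Rightarrow> real" where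
  "moment_sum \<alpha> \<beta> a b k =
    (\<Sum>x\<in>triples k. triple_coeff (\<alpha> + \<beta> + 2) a b x * (Pi_moment \<alpha> (fst (snd x)) * Pi_moment \<beta> (snd (snd x))))"

lemma moment_sum_odd: "odd k \<Longrightarrow> moment_sum \<alpha> \<beta> a b k = 0"
  unfolding moment_sum_def by (intro sum.neutral) (auto simp: triples_def Pi_moment_def)

text \<open>By (2i)! = 4^i i! (1/2)_i the numerator of the moment cancels, leaving an F4
  denominator.\<close>

lemma power_Pi_moment:
  "(2 * a) ^ (2 * i) / fact (2 * i) * Pi_moment \<alpha> (2 * i) = (a\<^sup>2) ^ i / (fact i * pochhammer (\<alpha> + 1) i)"
proof -
  have p: "pochhammer (1 / 2 :: real) i > 0" by (simp add: pochhammer_pos)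
  have "(2 * a) ^ (2 * i) = 2 ^ (2 * i) * (a\<^sup>2) ^ i" by (simp add: power_mult_distrib power_mult)
  then show ?thesis using p by (simp add: Pi_moment_def fact_double)
qed

text \<open>Only triples with two even exponents 2i and 2j survive; then m = n - (i + j), and the
  Pochhammer index m + 2i + 2j is n + (i + j).\<close>

lemma moment_sum_even:
  "moment_sum \<alpha> \<beta> a b (2 * n) = (\<Sum>i\<le>n. \<Sum>j\<le>n. if i + j \<le> n then
     (-1) ^ (n - (i + j)) * pochhammer (\<alpha> + \<beta> + 2) (n + (i + j)) / fact (n - (i + j))
       * ((a\<^sup>2) ^ i * (b\<^sup>2) ^ j * F4_coeff \<alpha> \<beta> i j) else 0)"
proof -
  let ?g = "\<lambda>x. triple_coeff (\<alpha> + \<beta> + 2) a b x * (Pi_moment \<alpha> (fst (snd x)) * Pi_moment \<beta> (snd (snd x)))"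
  let ?h = "\<lambda>(i, j). if i + j \<le> n then
     (-1) ^ (n - (i + j)) * pochhammer (\<alpha> + \<beta> + 2) (n + (i + j)) / fact (n - (i + j))
       * ((a\<^sup>2) ^ i * (b\<^sup>2) ^ j * F4_coeff \<alpha> \<beta> i j) else 0"
  let ?T = "{(i, j). i + j \<le> n}" and ?\<tau> = "\<lambda>(i, j). (n - (i + j), 2 * i, 2 * j)"
  have T: "?T \<subseteq> {..n} \<times> {..n}" by auto
  have "moment_sum \<alpha> \<beta> a b (2 * n) = sum ?g (?\<tau> ` ?T)"
    unfolding moment_sum_def
  proof (rule sum.mono_neutral_right)
    show "\<forall>x\<in>triples (2 * n) - ?\<tau> ` ?T. ?g x = 0"
    proof (clarify, rule ccontr)
      fix m i j assume x: "(m, i, j) \<in> triples (2 * n)" "(m, i, j) \<notin> ?\<tau> ` ?T" and "?g (m, i, j) \<noteq> 0"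
      then have "even i" "even j" by (auto simp: Pi_moment_def split: if_splits)
      then obtain i' j' where ij: "i = 2 * i'" "j = 2 * j'" by blast
      with x(1) have "m = n - (i' + j')" "i' + j' \<le> n" by (auto simp: triples_def)
      then have "(m, i, j) = ?\<tau> (i', j')" "(i', j') \<in> ?T" using ij by auto
      with x(2) show False by blast
    qed
  qed (simp, auto simp: triples_def)
  also have "\<dots> = sum (?g \<circ> ?\<tau>) ?T"
    by (rule sum.reindex) (auto simp: inj_on_def)
  also have "\<dots> = sum ?h ?T"
  proof (rule sum.cong[OF refl])
    fix x assume "x \<in> ?T"
    then obtain i j where x: "x = (i, j)" and ij: "i + j \<le> n" by auto
    have e: "n - (i + j) + 2 * i + 2 * j = n + (i + j)" using ij by simp
    have "(?g \<circ> ?\<tau>) x = (-1) ^ (n - (i + j)) * pochhammer (\<alpha> + \<beta> + 2) (n + (i + j)) / fact (n - (i + j)) *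
        (((2 * a) ^ (2 * i) / fact (2 * i) * Pi_moment \<alpha> (2 * i)) * ((2 * b) ^ (2 * j) / fact (2 * j) * Pi_moment \<beta> (2 * j)))"
      unfolding x comp_def triple_coeff_def prod.case fst_conv snd_conv e by (simp add: mult_ac)
    also have "\<dots> = ?h x"
      unfolding power_Pi_moment using ij by (simp add: x F4_coeff_def)
    finally show "(?g \<circ> ?\<tau>) x = ?h x" .
  qed
  also have "\<dots> = sum ?h ({..n} \<times> {..n})"
    by (rule sum.mono_neutral_left) (use T in auto)
  also have "\<dots> = (\<Sum>i\<le>n. \<Sum>j\<le>n. ?h (i, j))" by (simp add: sum.cartesian_product)
  finally show ?thesis by simp
qed

lemma pochhammer_minus_of_nat:
  assumes "N \<le> n"
  shows "pochhammer (- real n) N = (-1) ^ N * fact n / fact (n - N)"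
proof -
  have "real (n choose N) = (-1) ^ N * pochhammer (- real n) N / fact N"
    by (simp add: binomial_gbinomial gbinomial_pochhammer)
  moreover have "real (n choose N) = fact n / (fact N * fact (n - N))" using assms by (rule binomial_fact)
  ultimately have "(-1) ^ N * pochhammer (- real n) N = fact n / fact (n - N)" by (simp add: field_simps)
  then have "(-1) ^ N * ((-1) ^ N * pochhammer (- real n) N) = (-1) ^ N * (fact n / fact (n - N))" by simp
  then show ?thesis by (simp add: mult.assoc[symmetric] power_add[symmetric])
qed

text \<open>This is the coefficient of z^(2n) after multiplication by 1 - z^2. The difference
  depends on i and j only through N = i + j, apart from the common F4 factor, so it is compared for
  each N.\<close>

lemma moment_sum_diff:
  assumes "n > 0" "a\<^sup>2 = x * y" "b\<^sup>2 = (1 - x) * (1 - y)"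
  shows "moment_sum \<alpha> \<beta> a b (2 * n) - moment_sum \<alpha> \<beta> a b (2 * (n - 1)) =
    (2 * real n + \<alpha> + \<beta> + 1) * (-1) ^ n * pochhammer (\<alpha> + \<beta> + 2) (n - 1) / fact n * poly (F4_poly \<alpha> \<beta> n y) x"
proof -
  let ?s = "\<alpha> + \<beta> + 2"
  define T where "T i j = (a\<^sup>2) ^ i * (b\<^sup>2) ^ j * F4_coeff \<alpha> \<beta> i j" for i j
  define A where "A n N = (if N \<le> n then (-1) ^ (n - N) * pochhammer ?s (n + N) / fact (n - N) else 0)" for n N :: nat
  have M: "moment_sum \<alpha> \<beta> a b (2 * n) = (\<Sum>i\<le>n. \<Sum>j\<le>n. A n (i + j) * T i j)" for n
    unfolding moment_sum_even A_def T_def by (intro sum.cong refl) auto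
  obtain l where n: "n = Suc l" using assms(1) by (cases n) auto
  have "moment_sum \<alpha> \<beta> a b (2 * l) = (\<Sum>i\<le>n. \<Sum>j\<le>n. A l (i + j) * T i j)"
    unfolding M by (simp add: n A_def)
  then have "moment_sum \<alpha> \<beta> a b (2 * n) - moment_sum \<alpha> \<beta> a b (2 * l) =
      (\<Sum>i\<le>n. \<Sum>j\<le>n. (A n (i + j) - A l (i + j)) * T i j)"
    unfolding M[of n] by (simp add: sum_subtractf left_diff_distrib)
  also have "\<dots> = (\<Sum>i\<le>n. \<Sum>j\<le>n. ((2 * real n + \<alpha> + \<beta> + 1) * (-1) ^ n * pochhammer ?s l / fact n *
      (pochhammer (- real n) (i + j) * pochhammer (real n + \<alpha> + \<beta> + 1) (i + j))) * T i j)"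
  proof -
    have "A n N - A l N = (2 * real n + \<alpha> + \<beta> + 1) * (-1) ^ n * pochhammer ?s l / fact n *
      (pochhammer (- real n) N * pochhammer (real n + \<alpha> + \<beta> + 1) N)" for N
    proof (cases "N \<le> n")
      case False
      then show ?thesis by (simp add: A_def n pochhammer_of_nat_eq_0_iff del: of_nat_Suc)
    next
      case True
      have p: "pochhammer ?s l * pochhammer (real n + \<alpha> + \<beta> + 1) N = pochhammer ?s (l + N)"
        using pochhammer_product'[of ?s l N] by (simp add: n add_ac)
      have sg: "(-1::real) ^ n * (-1) ^ N = (-1) ^ (n - N)"
      proof -
        have "(-1::real) ^ n = (-1) ^ (n - N) * (-1) ^ N" using True by (simp add: power_add[symmetric])
        moreover have "(-1::real) ^ N * (-1) ^ N = 1" by (subst power_add[symmetric]) simp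
        ultimately show ?thesis by (simp add: mult.assoc)
      qed
      have R: "(2 * real n + \<alpha> + \<beta> + 1) * (-1) ^ n * pochhammer ?s l / fact n *
          (pochhammer (- real n) N * pochhammer (real n + \<alpha> + \<beta> + 1) N) =
          (2 * real n + \<alpha> + \<beta> + 1) * ((-1) ^ n * (-1) ^ N) * (pochhammer ?s l * pochhammer (real n + \<alpha> + \<beta> + 1) N) / fact (n - N)"
        unfolding pochhammer_minus_of_nat[OF True] by simp
      have P: "pochhammer ?s (n + N) = pochhammer ?s (l + N) * (?s + real l + real N)"
        by (simp add: n pochhammer_rec' add_ac)
      show ?thesis
      \<comment> \<open>For N = n the lower sum contributes nothing; for N < n both terms share the
        denominator (n - N)!.\<close>
      proof (cases "N = n")
        case True
        have "A n N = pochhammer ?s (n + N)" "A l N = 0" using True by (simp_all add: A_def n)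
        moreover have "?s + real l + real N = 2 * real n + \<alpha> + \<beta> + 1" using True by (simp add: n)
        ultimately show ?thesis unfolding R p sg using P True by simp
      next
        case False
        with \<open>N \<le> n\<close> obtain m where m: "l = N + m" "n - N = Suc m" "l - N = m"
          by (metis Suc_diff_le diff_add_inverse le_Suc_eq le_iff_add n)
        have f: "real (Suc m) / fact (Suc m) = 1 / fact m" by (simp add: divide_simps del: of_nat_Suc)
        have "A n N - A l N = (-1) ^ Suc m * pochhammer ?s (l + N) * ((?s + real l + real N) / fact (Suc m) + 1 / fact m)"
        proof -
          have "A n N = (-1) ^ Suc m * (pochhammer ?s (l + N) * (?s + real l + real N)) / fact (Suc m)"
            unfolding A_def P m(2) using \<open>N \<le> n\<close> by (simp only: if_True)
          moreover have "A l N = (-1) ^ m * pochhammer ?s (l + N) / fact m"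
            unfolding A_def m(3) using m(1) by simp
          ultimately show ?thesis by (simp only: power_Suc) (simp add: distrib_left)
        qed
        \<comment> \<open>The numerator is s + l + N + (m + 1) with N + m = l = n - 1, which is 2n +
          \<alpha> + \<beta> + 1.\<close>
        also have "(?s + real l + real N) / fact (Suc m) + 1 / fact m = (2 * real n + \<alpha> + \<beta> + 1) / fact (Suc m)"
          unfolding f[symmetric] add_divide_distrib[symmetric] using m by (simp add: n)
        finally show ?thesis unfolding R p sg m(2) by simp
      qed
    qed
    then show ?thesis by simp
  qed
  also have "\<dots> = (2 * real n + \<alpha> + \<beta> + 1) * (-1) ^ n * pochhammer ?s l / fact n * poly (F4_poly \<alpha> \<beta> n y) x"
    unfolding F4_poly_def poly_sum sum_distrib_left
    by (intro sum.cong refl) (simp add: T_def assms(2,3) power_mult_distrib mult_ac)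
  finally show ?thesis by (simp add: n)
qed

text \<open>The denominator on the right is the squared norm from
  \<open>jacobi_poly_norm\<close>.\<close>

lemma moment_sum_diff_jac:
  assumes "\<alpha> > -1" "\<beta> > -1" "a\<^sup>2 = x * y" "b\<^sup>2 = (1 - x) * (1 - y)"
  shows "Gamma (\<alpha> + \<beta> + 2) / (Gamma (\<alpha> + 1) * Gamma (\<beta> + 1)) *
      (moment_sum \<alpha> \<beta> a b (2 * n) - (if n = 0 then 0 else moment_sum \<alpha> \<beta> a b (2 * (n - 1)))) =
    poly (jac \<alpha> \<beta> n) x * poly (jac \<alpha> \<beta> n) y /
      (((2 * real n + \<alpha> + \<beta>) gchoose n) * (Gamma (real n + \<alpha> + 1) * Gamma (real n + \<beta> + 1)) / Gamma (2 * real n + \<alpha> + \<beta> + 2))"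
proof (cases "n = 0")
  case True
  have "triples 0 = {(0, 0, 0)}" by (auto simp: triples_def)
  then show ?thesis using True
    by (simp add: moment_sum_def triple_coeff_def Pi_moment_def jac_def bernstein_def add_ac)
next
  case False
  let ?s = "\<alpha> + \<beta> + 2" and ?p = "poly (jac \<alpha> \<beta> n)"
  define G where "G = Gamma (real n + \<alpha> + \<beta> + 1)"
  define G2 where "G2 = Gamma (2 * real n + \<alpha> + \<beta> + 1)"
  \<comment> \<open>For n \<ge> 1 the argument n+\<alpha>+\<beta>+1 is positive. At n = 0 it may be
    0 or negative, which is why that case is separate.\<close>
  have n: "real n \<ge> 1" using False by simp
  have pG: "pochhammer x m = Gamma (x + real m) / Gamma x" if "x > 0" for x :: real and m
    using that by (subst pochhammer_Gamma) (auto elim!: nonpos_Ints_cases)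
  have pos: "Gamma (\<alpha> + 1) > 0" "Gamma (\<beta> + 1) > 0" "Gamma ?s > 0" "G > 0" "G2 > 0"
     "Gamma (real n + \<alpha> + 1) > 0" "Gamma (real n + \<beta> + 1) > 0"
    unfolding G_def G2_def using assms n by (auto intro!: Gamma_real_pos)
  have 1: "Gamma ?s * pochhammer ?s (n - 1) = G"
  proof -
    have e: "?s + real (n - 1) = real n + \<alpha> + \<beta> + 1" using False by (simp add: of_nat_diff)
    have "?s > 0" using assms by simp
    from pG[OF this, of "n - 1"] show ?thesis unfolding e G_def[symmetric] using pos by simp
  qed
  have 2: "pochhammer (\<alpha> + 1) n = Gamma (real n + \<alpha> + 1) / Gamma (\<alpha> + 1)"
    "pochhammer (\<beta> + 1) n = Gamma (real n + \<beta> + 1) / Gamma (\<beta> + 1)"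
    using pG[of "\<alpha> + 1" n] pG[of "\<beta> + 1" n] assms by (simp_all add: add_ac)
  have 3: "(2 * real n + \<alpha> + \<beta>) gchoose n = G2 / G / fact n"
  proof -
    have "(2 * real n + \<alpha> + \<beta>) gchoose n = pochhammer (real n + \<alpha> + \<beta> + 1) n / fact n"
      by (simp add: gbinomial_pochhammer' algebra_simps)
    also have "pochhammer (real n + \<alpha> + \<beta> + 1) n = G2 / G"
      using pG[of "real n + \<alpha> + \<beta> + 1" n] assms n by (simp add: G_def G2_def algebra_simps)
    finally show ?thesis .
  qed
  have 4: "Gamma (2 * real n + \<alpha> + \<beta> + 2) = (2 * real n + \<alpha> + \<beta> + 1) * G2"
  proof -
    have "2 * real n + \<alpha> + \<beta> + 1 \<notin> \<int>\<^sub>\<le>\<^sub>0" using assms n by (auto elim!: nonpos_Ints_cases)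
    from Gamma_plus1[OF this] show ?thesis by (simp add: G2_def add.assoc)
  qed
  have F: "poly (F4_poly \<alpha> \<beta> n y) x = (-1) ^ n * (fact n)\<^sup>2 / (pochhammer (\<alpha> + 1) n * pochhammer (\<beta> + 1) n) * (?p x * ?p y)"
  proof -
    have "pochhammer (\<alpha> + 1) n > 0" "pochhammer (\<beta> + 1) n > 0" using assms by (auto intro!: pochhammer_pos)
    then show ?thesis unfolding jac_product_formula[OF assms(1,2)]
      by (simp add: field_simps power_add[symmetric])
  qed
  have "Gamma ?s / (Gamma (\<alpha> + 1) * Gamma (\<beta> + 1)) *
      (moment_sum \<alpha> \<beta> a b (2 * n) - moment_sum \<alpha> \<beta> a b (2 * (n - 1))) =
      (2 * real n + \<alpha> + \<beta> + 1) * (Gamma ?s * pochhammer ?s (n - 1)) * ((-1) ^ n * (-1) ^ n) * fact n / (Gamma (real n + \<alpha> + 1) * Gamma (real n + \<beta> + 1)) * (?p x * ?p y)"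
    using False pos
    by (subst moment_sum_diff[OF _ assms(3,4)]) (simp_all add: F 2 power2_eq_square)
  also have "\<dots> = (2 * real n + \<alpha> + \<beta> + 1) * G * fact n / (Gamma (real n + \<alpha> + 1) * Gamma (real n + \<beta> + 1)) * (?p x * ?p y)"
    unfolding 1 by (simp add: power_add[symmetric])
  also have "\<dots> = ?p x * ?p y / (((2 * real n + \<alpha> + \<beta>) gchoose n) * (Gamma (real n + \<alpha> + 1) * Gamma (real n + \<beta> + 1)) / Gamma (2 * real n + \<alpha> + \<beta> + 2))"
    unfolding 3 4 using pos by simp
  finally show ?thesis using False by simp
qed

text \<open>Multiplication by 1 - z^2 takes differences of the even coefficients, and
  z^(\<alpha>+\<beta>+1+2n) is the exponential of the n-th Poisson term.\<close>

lemma jacobi_poisson_eq: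
  fixes \<alpha> \<beta> t \<theta> \<phi> :: real
  defines "z \<equiv> exp (- t / 2)" and "a \<equiv> sin (\<theta> / 2) * sin (\<phi> / 2)" and "b \<equiv> cos (\<theta> / 2) * cos (\<phi> / 2)"
  assumes \<alpha>\<beta>: "\<alpha> > -1" "\<beta> > -1"
    and S: "(\<lambda>k. \<Sum>x\<in>triples k. z ^ k * triple_coeff (\<alpha> + \<beta> + 2) a b x *
      (Pi_moment \<alpha> (fst (snd x)) * Pi_moment \<beta> (snd (snd x)))) sums T"
  shows "jacobi_poisson \<alpha> \<beta> t \<theta> \<phi> = poisson_const \<alpha> \<beta> t * T"
proof -
  let ?M = "moment_sum \<alpha> \<beta> a b"
  define X where "X = (sin (\<theta> / 2))\<^sup>2"
  define Y where "Y = (sin (\<phi> / 2))\<^sup>2"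
  have a: "a\<^sup>2 = X * Y" by (simp add: a_def X_def Y_def power_mult_distrib)
  have b: "b\<^sup>2 = (1 - X) * (1 - Y)" by (simp add: b_def X_def Y_def power_mult_distrib cos_squared_eq)
  define c where "c = Gamma (\<alpha> + \<beta> + 2) / (Gamma (\<alpha> + 1) * Gamma (\<beta> + 1)) * z powr (\<alpha> + \<beta> + 1)"
  have z: "z > 0" by (simp add: z_def)
  have K: "poisson_const \<alpha> \<beta> t = c * (1 - z\<^sup>2)"
    unfolding poisson_const_def c_def c_const_def z_def[symmetric] using z by (simp add: powr_mult)
  have "(\<lambda>k. z ^ k * ?M k) sums T"
    using S by (simp add: moment_sum_def sum_distrib_left mult.assoc)
  moreover have z0: "?M k = 0" if "k \<notin> range (\<lambda>n. 2 * n)" for k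
    using that by (intro moment_sum_odd) auto
  ultimately have "(\<lambda>n. z ^ (2 * n) * ?M (2 * n)) sums T"
    by (subst sums_mono_reindex[of "\<lambda>n. 2 * n", where f = "\<lambda>k. z ^ k * ?M k"])
       (auto simp: strict_mono_def intro: z0)
  note ev = this
  have "(\<lambda>n. z\<^sup>2 * (z ^ (2 * n) * ?M (2 * n))) sums (z\<^sup>2 * T)" by (intro sums_mult ev)
  \<comment> \<open>The product with z^2 is reindexed by a leading zero, so that both series align
    at z^(2n).\<close>
  then have "(\<lambda>n. if n = 0 then 0 else z\<^sup>2 * (z ^ (2 * (n - 1)) * ?M (2 * (n - 1)))) sums (z\<^sup>2 * T)"
    using sums_Suc[of "\<lambda>n. if n = 0 then 0 else z\<^sup>2 * (z ^ (2 * (n - 1)) * ?M (2 * (n - 1)))" "z\<^sup>2 * T"] by simp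
  from sums_mult[OF sums_diff[OF ev this], of c]
  have "(\<lambda>n. c * (z ^ (2 * n) * ?M (2 * n) - (if n = 0 then 0 else z\<^sup>2 * (z ^ (2 * (n - 1)) * ?M (2 * (n - 1)))))) sums (c * (T - z\<^sup>2 * T))" .
  moreover have "c * (z ^ (2 * n) * ?M (2 * n) - (if n = 0 then 0 else z\<^sup>2 * (z ^ (2 * (n - 1)) * ?M (2 * (n - 1))))) =
      exp (- t * (real n + (\<alpha> + \<beta> + 1) / 2)) * jacobi_trig \<alpha> \<beta> n \<theta> * jacobi_trig \<alpha> \<beta> n \<phi>" for n
  proof -
    let ?h = "\<integral>\<phi>. (jacobi_poly \<alpha> \<beta> n (cos \<phi>))\<^sup>2 \<partial>jacobi_measure \<alpha> \<beta>"
    \<comment> \<open>Nonnegativity lets the two square roots in the normalized polynomials multiply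
      to the norm integral.\<close>
    have h: "?h \<ge> 0" by (intro integral_nonneg_AE) simp
    have "z ^ (2 * n) * ?M (2 * n) - (if n = 0 then 0 else z\<^sup>2 * (z ^ (2 * (n - 1)) * ?M (2 * (n - 1)))) =
       z ^ (2 * n) * (?M (2 * n) - (if n = 0 then 0 else ?M (2 * (n - 1))))"
      by (cases n) (simp_all add: algebra_simps power2_eq_square)
    then have "c * (z ^ (2 * n) * ?M (2 * n) - (if n = 0 then 0 else z\<^sup>2 * (z ^ (2 * (n - 1)) * ?M (2 * (n - 1))))) =
       z powr (\<alpha> + \<beta> + 1) * z ^ (2 * n) * (Gamma (\<alpha> + \<beta> + 2) / (Gamma (\<alpha> + 1) * Gamma (\<beta> + 1)) * (?M (2 * n) - (if n = 0 then 0 else ?M (2 * (n - 1)))))"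
      by (simp add: c_def)
    also have "Gamma (\<alpha> + \<beta> + 2) / (Gamma (\<alpha> + 1) * Gamma (\<beta> + 1)) * (?M (2 * n) - (if n = 0 then 0 else ?M (2 * (n - 1)))) =
       jacobi_poly \<alpha> \<beta> n (cos \<theta>) * jacobi_poly \<alpha> \<beta> n (cos \<phi>) / ?h"
      unfolding moment_sum_diff_jac[OF \<alpha>\<beta> a b] jacobi_poly_norm[OF \<alpha>\<beta>] by (simp only: jacobi_poly_cos X_def Y_def)
    also have "\<dots> = jacobi_trig \<alpha> \<beta> n \<theta> * jacobi_trig \<alpha> \<beta> n \<phi>"
      using h by (simp add: jacobi_trig_def)
    also have "z powr (\<alpha> + \<beta> + 1) * z ^ (2 * n) = exp (- t * (real n + (\<alpha> + \<beta> + 1) / 2))"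
      by (simp add: z_def powr_def exp_of_nat_mult[symmetric] exp_add[symmetric] algebra_simps)
    finally show ?thesis by (simp add: mult.assoc)
  qed
  ultimately have "jacobi_poisson \<alpha> \<beta> t \<theta> \<phi> = c * (T - z\<^sup>2 * T)"
    unfolding jacobi_poisson_def by (simp only: sums_iff)
  then show ?thesis unfolding K by (simp add: algebra_simps)
qed

section \<open>Measurability of the kernel and the final assembly\<close>

text \<open>The real logarithm is extended to negative arguments as an even function.\<close>

lemma powr_minus_base: "(- x) powr r = x powr r" for x r :: real
  by (simp add: powr_def ln_minus)

text \<open>Outside the region where the base is positive the real power is an even function of its base,
  so the derivatives of \<^const>\<open>Psi\<close> still are Borel functions there.\<close>

lemma deriv_inverse_powr_measurable:
  fixes a C r :: real
  shows "(\<lambda>y. deriv (\<lambda>x. C / (y - a * x) powr r) 0) \<in> borel_measurable borel" (is "?D \<in> _")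
proof -
  have pos: "((\<lambda>x. C / (y - a * x) powr r) has_real_derivative C * (- r * y powr (- r - 1) * (- a))) (at 0)"
    if "y > 0" for y a :: real
  proof -
    have "((\<lambda>x. C * (y - a * x) powr (- r)) has_real_derivative
        C * (- r * (y - a * 0) powr (- r - of_nat 1) * (- a))) (at 0)"
      using that by (intro DERIV_cmult DERIV_fun_powr) (auto intro!: derivative_eq_intros)
    then show ?thesis by (simp add: powr_minus_divide)
  qed
  have neg: "((\<lambda>x. C / (y - a * x) powr r) has_real_derivative C * (- r * (- y) powr (- r - 1) * a)) (at 0)"
    if "y < 0" for y :: real
    using pos[of "- y" "- a"] that powr_minus_base[of "y - a * x" r for x]
    by (simp add: algebra_simps)
  \<comment> \<open>At y = 0 the derivative may not exist; \<open>deriv\<close> still is some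
    constant there, which is enough for a Borel function.\<close>
  have "?D = (\<lambda>y. if y > 0 then C * (- r * y powr (- r - 1) * (- a))
      else if y < 0 then C * (- r * (- y) powr (- r - 1) * a) else ?D 0)"
    using DERIV_imp_deriv[OF pos] DERIV_imp_deriv[OF neg] by (auto simp: fun_eq_iff not_less)
  also have "\<dots> \<in> borel_measurable borel" by measurable
  finally show ?thesis .
qed

text \<open>\<open>dPi\<close> lives on the whole line, so measurability must hold outside the
  square too. Moving the differentiation point to 0 makes each derivative a one-variable function of
  the base of the power.\<close>

lemma Psi_measurable:
  assumes [measurable]: "(\<lambda>u. u) \<in> borel_measurable M1" "(\<lambda>v. v) \<in> borel_measurable M2"
  shows "(\<lambda>(u, v). Psi \<alpha> \<beta> t \<theta> \<phi> u v) \<in> borel_measurable (M1 \<Otimes>\<^sub>M M2)"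
    and "(\<lambda>(u, v). Psi_u \<alpha> \<beta> t \<theta> \<phi> u v) \<in> borel_measurable (M1 \<Otimes>\<^sub>M M2)"
    and "(\<lambda>(u, v). Psi_v \<alpha> \<beta> t \<theta> \<phi> u v) \<in> borel_measurable (M1 \<Otimes>\<^sub>M M2)"
proof -
  have p1 [measurable]: "fst \<in> borel_measurable (M1 \<Otimes>\<^sub>M M2)"
    using measurable_compose[OF measurable_fst assms(1), of M2] by simp
  have p2 [measurable]: "snd \<in> borel_measurable (M1 \<Otimes>\<^sub>M M2)"
    using measurable_compose[OF measurable_snd assms(2), of M1] by simp
  show "(\<lambda>(u, v). Psi \<alpha> \<beta> t \<theta> \<phi> u v) \<in> borel_measurable (M1 \<Otimes>\<^sub>M M2)"
    unfolding Psi_def q_fun_def case_prod_unfold by measurable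
  let ?C = "c_const \<alpha> \<beta> * sinh (t / 2)" and ?s = "\<alpha> + \<beta> + 2"
  let ?a = "sin (\<theta> / 2) * sin (\<phi> / 2)" and ?b = "cos (\<theta> / 2) * cos (\<phi> / 2)"
  let ?y = "\<lambda>u v. cosh (t / 2) - ?a * u - ?b * v"
  have u: "Psi_u \<alpha> \<beta> t \<theta> \<phi> u v = deriv (\<lambda>x. ?C / (?y u v - ?a * x) powr ?s) 0" for u v
  proof -
    have "Psi_u \<alpha> \<beta> t \<theta> \<phi> u v = deriv (\<lambda>x. Psi \<alpha> \<beta> t \<theta> \<phi> (u + x) v) 0"
      unfolding Psi_u_def by (subst deriv_shift_0) (simp add: comp_def)
    then show ?thesis by (simp add: Psi_def q_fun_def algebra_simps)
  qed
  have v: "Psi_v \<alpha> \<beta> t \<theta> \<phi> u v = deriv (\<lambda>x. ?C / (?y u v - ?b * x) powr ?s) 0" for u v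
  proof -
    have "Psi_v \<alpha> \<beta> t \<theta> \<phi> u v = deriv (\<lambda>x. Psi \<alpha> \<beta> t \<theta> \<phi> u (v + x)) 0"
      unfolding Psi_v_def by (subst deriv_shift_0) (simp add: comp_def)
    then show ?thesis by (simp add: Psi_def q_fun_def algebra_simps)
  qed
  have y: "(\<lambda>p. ?y (fst p) (snd p)) \<in> borel_measurable (M1 \<Otimes>\<^sub>M M2)" by measurable
  show "(\<lambda>(u, v). Psi_u \<alpha> \<beta> t \<theta> \<phi> u v) \<in> borel_measurable (M1 \<Otimes>\<^sub>M M2)"
    unfolding u case_prod_unfold by (rule measurable_compose[OF y deriv_inverse_powr_measurable])
  show "(\<lambda>(u, v). Psi_v \<alpha> \<beta> t \<theta> \<phi> u v) \<in> borel_measurable (M1 \<Otimes>\<^sub>M M2)"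
    unfolding v case_prod_unfold by (rule measurable_compose[OF y deriv_inverse_powr_measurable])
qed

lemma sets_lborel_I: "sets lborel_I = sets (restrict_space borel {-1<..<1})"
  by (simp add: lborel_I_def sets_restrict_space)

lemma Pi_fun_measurable_lborel_I: "Pi_fun \<alpha> \<in> borel_measurable lborel_I"
  unfolding measurable_cong_sets[OF sets_lborel_I refl]
  by (rule borel_measurable_continuous_on_restrict[OF continuous_on_Pi_fun])

lemma id_measurable_lborel_I: "(\<lambda>u. u) \<in> borel_measurable lborel_I"
  unfolding measurable_cong_sets[OF sets_lborel_I refl]
  by (rule borel_measurable_continuous_on_restrict) (rule continuous_on_id)

lemma id_measurable_dPi: "(\<lambda>u. u) \<in> borel_measurable (dPi \<gamma>)"
  unfolding measurable_cong_sets[OF sets_dPi refl] by simp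

lemma AE_lborel_I: "AE u in lborel_I. \<bar>u\<bar> \<le> 1"
  by (rule AE_I2) (auto simp: lborel_I_def space_restrict_space)

lemma sigma_finite_lborel_I: "sigma_finite_measure lborel_I"
  unfolding lborel_I_def by (rule sigma_finite_measure_restrict_space) (auto intro: sigma_finite_lborel)

lemma sigma_finite_dPi: "\<gamma> \<ge> - 1 / 2 \<Longrightarrow> sigma_finite_measure (dPi \<gamma>)"
  by (intro finite_measure.axioms(1) finite_measure_dPi)

lemma deriv_power_dPi:
  assumes "\<gamma> \<ge> - 1 / 2"
  shows "integrable (dPi \<gamma>) (\<lambda>u. deriv_power 0 i u * c)" "(\<integral>u. deriv_power 0 i u * c \<partial>dPi \<gamma>) = c * Pi_moment \<gamma> i"
  using assms by (simp_all add: deriv_power_def integrable_dPi_power integral_dPi_power)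

text \<open>Writing the boundary term (1 + (-1)^i)/2 as a moment of \<open>dPi (- 1 / 2)\<close>
  prepares the cancellation between the integrals of cases (ii)-(iv).\<close>

lemma deriv_power_Pi_fun:
  assumes "\<alpha> > - 1" "\<alpha> < - 1 / 2"
  shows "integrable lborel_I (\<lambda>u. deriv_power 1 i u * (c * Pi_fun \<alpha> u))"
    "(\<integral>u. deriv_power 1 i u * (c * Pi_fun \<alpha> u) \<partial>lborel_I) = c * (Pi_moment (- 1 / 2) i - Pi_moment \<alpha> i)"
proof -
  have "has_bochner_integral lborel_I (\<lambda>u. c * (real i * u ^ (i - 1) * Pi_fun \<alpha> u)) (c * ((1 + (- 1) ^ i) / 2 - Pi_moment \<alpha> i))"
    by (intro has_bochner_integral_mult_right has_bochner_integral_Pi_fun_deriv_power' assms)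
  moreover have "Pi_moment (- 1 / 2) i = (1 + (- 1) ^ i) / 2"
    by (auto simp: Pi_moment_def pochhammer_eq_0_iff)
  moreover have "(\<lambda>u. deriv_power 1 i u * (c * Pi_fun \<alpha> u)) = (\<lambda>u. c * (real i * u ^ (i - 1) * Pi_fun \<alpha> u))"
    by (simp add: deriv_power_def fun_eq_iff)
  ultimately show "integrable lborel_I (\<lambda>u. deriv_power 1 i u * (c * Pi_fun \<alpha> u))"
    "(\<integral>u. deriv_power 1 i u * (c * Pi_fun \<alpha> u) \<partial>lborel_I) = c * (Pi_moment (- 1 / 2) i - Pi_moment \<alpha> i)"
    by (simp_all only: has_bochner_integral_iff)
qed

lemma poisson_const_pos:
  assumes "\<alpha> > -1" "\<beta> > -1" "t > 0"
  shows "poisson_const \<alpha> \<beta> t > 0"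
  unfolding poisson_const_def c_const_def
  using assms by (intro mult_pos_pos divide_pos_pos Gamma_real_pos) (auto simp: abs_square_less_1)

theorem proposition2p3:
  fixes \<alpha> \<beta> t \<theta> \<phi> :: real
  assumes "\<alpha> > - 1" and "\<beta> > - 1" and "t > 0" and "\<theta> \<in> {0..pi}" and "\<phi> \<in> {0..pi}"
  shows
   "(\<alpha> \<ge> - 1 / 2 \<and> \<beta> \<ge> - 1 / 2 \<longrightarrow>
      jacobi_poisson \<alpha> \<beta> t \<theta> \<phi> =
        (\<integral>(u, v). Psi \<alpha> \<beta> t \<theta> \<phi> u v \<partial>(dPi \<alpha> \<Otimes>\<^sub>M dPi \<beta>))) \<and>
    (\<alpha> < - 1 / 2 \<and> - 1 / 2 \<le> \<beta> \<longrightarrow>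
      jacobi_poisson \<alpha> \<beta> t \<theta> \<phi> =
        (\<integral>(u, v). - Psi_u \<alpha> \<beta> t \<theta> \<phi> u v * Pi_fun \<alpha> u \<partial>(lborel_I \<Otimes>\<^sub>M dPi \<beta>)) +
        (\<integral>(u, v). Psi \<alpha> \<beta> t \<theta> \<phi> u v \<partial>(dPi (- 1 / 2) \<Otimes>\<^sub>M dPi \<beta>))) \<and>
    (\<beta> < - 1 / 2 \<and> - 1 / 2 \<le> \<alpha> \<longrightarrow>
      jacobi_poisson \<alpha> \<beta> t \<theta> \<phi> =
        (\<integral>(u, v). - Psi_v \<alpha> \<beta> t \<theta> \<phi> u v * Pi_fun \<beta> v \<partial>(dPi \<alpha> \<Otimes>\<^sub>M lborel_I)) +
        (\<integral>(u, v). Psi \<alpha> \<beta> t \<theta> \<phi> u v \<partial>(dPi \<alpha> \<Otimes>\<^sub>M dPi (- 1 / 2)))) \<and>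
    (\<alpha> < - 1 / 2 \<and> \<beta> < - 1 / 2 \<longrightarrow>
      jacobi_poisson \<alpha> \<beta> t \<theta> \<phi> =
        (\<integral>(u, v). Psi_uv \<alpha> \<beta> t \<theta> \<phi> u v * Pi_fun \<alpha> u * Pi_fun \<beta> v \<partial>(lborel_I \<Otimes>\<^sub>M lborel_I)) -
        (\<integral>(u, v). Psi_u \<alpha> \<beta> t \<theta> \<phi> u v * Pi_fun \<alpha> u \<partial>(lborel_I \<Otimes>\<^sub>M dPi (- 1 / 2))) -
        (\<integral>(u, v). Psi_v \<alpha> \<beta> t \<theta> \<phi> u v * Pi_fun \<beta> v \<partial>(dPi (- 1 / 2) \<Otimes>\<^sub>M lborel_I)) +
        (\<integral>(u, v). Psi \<alpha> \<beta> t \<theta> \<phi> u v \<partial>(dPi (- 1 / 2) \<Otimes>\<^sub>M dPi (- 1 / 2))))"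
proof -
  define z where "z = exp (- t / 2)"
  define a where "a = sin (\<theta> / 2) * sin (\<phi> / 2)"
  define b where "b = cos (\<theta> / 2) * cos (\<phi> / 2)"
  define s where "s = \<alpha> + \<beta> + 2"
  define K where "K = poisson_const \<alpha> \<beta> t"
  have s: "s > 0" using assms by (simp add: s_def)
  have z: "0 < z" "z < 1" using assms by (simp_all add: z_def)
  have ab: "0 \<le> a" "0 \<le> b" "a + b \<le> 1" using sin_cos_half_le[OF assms(4,5)] by (simp_all add: a_def b_def)
  have K: "K > 0" using poisson_const_pos assms by (simp add: K_def)
  have less: "2 * z * (a * u + b * v) < 1 + z\<^sup>2" if "\<bar>u\<bar> \<le> 1" "\<bar>v\<bar> \<le> 1" for u v
    using z that ab by (intro two_z_mult_less abs_bilinear_le)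
  note defs = z_def[symmetric] a_def[symmetric] b_def[symmetric] s_def[symmetric] K_def[symmetric]
  let ?P = "Psi \<alpha> \<beta> t \<theta> \<phi>" and ?Pu = "Psi_u \<alpha> \<beta> t \<theta> \<phi>" and ?Pv = "Psi_v \<alpha> \<beta> t \<theta> \<phi>" and ?Puv = "Psi_uv \<alpha> \<beta> t \<theta> \<phi>"
  have P: "?P u v = K * gegenD_gf z s 0 (a * u + b * v)"
     "?Pu u v = K * (a * gegenD_gf z s 1 (a * u + b * v))"
     "?Pv u v = K * (b * gegenD_gf z s 1 (a * u + b * v))"
     "?Puv u v = K * (a * b * gegenD_gf z s 2 (a * u + b * v))" if "\<bar>u\<bar> \<le> 1" "\<bar>v\<bar> \<le> 1" for u v
    using Psi_eq[of t \<theta> \<phi> u v \<alpha> \<beta>, unfolded defs] Psi_deriv_eq[of t \<theta> \<phi> u v \<alpha> \<beta>, unfolded defs] less[OF that]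
    by simp_all
  note sums = weighted_integral_sums[OF s z ab]
  \<comment> \<open>Every integral becomes the sum of such a series; adding integrals means adding
    the arrays \<open>m\<close>.\<close>
  define S where "S m k = (\<Sum>x\<in>triples k. z ^ k * triple_coeff s a b x * m (fst (snd x)) (snd (snd x)))"
    for m :: "nat \<Rightarrow> nat \<Rightarrow> real" and k
  have S_add: "S m k + S m' k = S (\<lambda>i j. m i j + m' i j) k" for m m' k
    by (simp add: S_def sum.distrib distrib_left)
  note meas = Psi_measurable[where \<alpha> = \<alpha> and \<beta> = \<beta> and t = t and \<theta> = \<theta> and \<phi> = \<phi>]
  have P00: "S (\<lambda>i j. K * Pi_moment \<gamma> i * Pi_moment \<delta> j) sums (\<integral>(u, v). ?P u v \<partial>(dPi \<gamma> \<Otimes>\<^sub>M dPi \<delta>))"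
    if \<gamma>\<delta>: "\<gamma> \<ge> - 1 / 2" "\<delta> \<ge> - 1 / 2" for \<gamma> \<delta>
  proof -
    have "(\<lambda>k. \<Sum>x\<in>triples k. z ^ k * triple_coeff s a b x *
        ((\<integral>u. deriv_power 0 (fst (snd x)) u * K \<partial>dPi \<gamma>) * (\<integral>v. deriv_power 0 (snd (snd x)) v * 1 \<partial>dPi \<delta>)))
      sums (\<integral>(u, v). ?P u v \<partial>(dPi \<gamma> \<Otimes>\<^sub>M dPi \<delta>))"
    proof (rule sums)
      show "(\<lambda>(u, v). ?P u v) \<in> borel_measurable (dPi \<gamma> \<Otimes>\<^sub>M dPi \<delta>)"
        by (rule meas(1)[OF id_measurable_dPi id_measurable_dPi])
      show "?P u v = a ^ 0 * b ^ 0 * gegenD_gf z s (0 + 0) (a * u + b * v) * (K * 1)"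
        if "\<bar>u\<bar> \<le> 1" "\<bar>v\<bar> \<le> 1" for u v using P[OF that] by simp
    qed (use \<gamma>\<delta> in \<open>simp_all only: sigma_finite_dPi id_measurable_dPi AE_dPi deriv_power_dPi(1) le0\<close>)
    then show ?thesis unfolding deriv_power_dPi(2)[OF \<gamma>\<delta>(1)] deriv_power_dPi(2)[OF \<gamma>\<delta>(2)] S_def[abs_def] by simp
  qed
  have P10: "S (\<lambda>i j. K * (Pi_moment \<alpha> i - Pi_moment (- 1 / 2) i) * Pi_moment \<delta> j) sums
      (\<integral>(u, v). - ?Pu u v * Pi_fun \<alpha> u \<partial>(lborel_I \<Otimes>\<^sub>M dPi \<delta>))"
    if \<alpha>: "\<alpha> < - 1 / 2" and \<delta>: "\<delta> \<ge> - 1 / 2" for \<delta>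
  proof -
    have "(\<lambda>k. \<Sum>x\<in>triples k. z ^ k * triple_coeff s a b x *
        ((\<integral>u. deriv_power 1 (fst (snd x)) u * (- K * Pi_fun \<alpha> u) \<partial>lborel_I) * (\<integral>v. deriv_power 0 (snd (snd x)) v * 1 \<partial>dPi \<delta>)))
      sums (\<integral>(u, v). - ?Pu u v * Pi_fun \<alpha> u \<partial>(lborel_I \<Otimes>\<^sub>M dPi \<delta>))"
    proof (rule sums)
      have "(\<lambda>p. - (case p of (u, v) \<Rightarrow> ?Pu u v) * Pi_fun \<alpha> (fst p)) \<in> borel_measurable (lborel_I \<Otimes>\<^sub>M dPi \<delta>)"
        by (intro borel_measurable_times borel_measurable_uminus meas(2) id_measurable_lborel_I id_measurable_dPi
            measurable_compose[OF measurable_fst Pi_fun_measurable_lborel_I])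
      then show "(\<lambda>(u, v). - ?Pu u v * Pi_fun \<alpha> u) \<in> borel_measurable (lborel_I \<Otimes>\<^sub>M dPi \<delta>)"
        by (simp add: case_prod_unfold)
      show "- ?Pu u v * Pi_fun \<alpha> u = a ^ 1 * b ^ 0 * gegenD_gf z s (1 + 0) (a * u + b * v) * (- K * Pi_fun \<alpha> u * 1)"
        if "\<bar>u\<bar> \<le> 1" "\<bar>v\<bar> \<le> 1" for u v using P[OF that] by simp
    qed (use \<alpha> \<delta> assms(1) in \<open>simp_all only: sigma_finite_dPi sigma_finite_lborel_I id_measurable_dPi id_measurable_lborel_I
        AE_dPi AE_lborel_I deriv_power_dPi(1) deriv_power_Pi_fun(1) order.refl le0\<close>)
    then show ?thesis
      unfolding deriv_power_dPi(2)[OF \<delta>] deriv_power_Pi_fun(2)[OF assms(1) \<alpha>] S_def[abs_def] by (simp add: algebra_simps)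
  qed
  have P01: "S (\<lambda>i j. K * Pi_moment \<gamma> i * (Pi_moment \<beta> j - Pi_moment (- 1 / 2) j)) sums
      (\<integral>(u, v). - ?Pv u v * Pi_fun \<beta> v \<partial>(dPi \<gamma> \<Otimes>\<^sub>M lborel_I))"
    if \<beta>: "\<beta> < - 1 / 2" and \<gamma>: "\<gamma> \<ge> - 1 / 2" for \<gamma>
  proof -
    have "(\<lambda>k. \<Sum>x\<in>triples k. z ^ k * triple_coeff s a b x *
        ((\<integral>u. deriv_power 0 (fst (snd x)) u * 1 \<partial>dPi \<gamma>) * (\<integral>v. deriv_power 1 (snd (snd x)) v * (- K * Pi_fun \<beta> v) \<partial>lborel_I)))
      sums (\<integral>(u, v). - ?Pv u v * Pi_fun \<beta> v \<partial>(dPi \<gamma> \<Otimes>\<^sub>M lborel_I))"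
    proof (rule sums)
      have "(\<lambda>p. - (case p of (u, v) \<Rightarrow> ?Pv u v) * Pi_fun \<beta> (snd p)) \<in> borel_measurable (dPi \<gamma> \<Otimes>\<^sub>M lborel_I)"
        by (intro borel_measurable_times borel_measurable_uminus meas(3) id_measurable_lborel_I id_measurable_dPi
            measurable_compose[OF measurable_snd Pi_fun_measurable_lborel_I])
      then show "(\<lambda>(u, v). - ?Pv u v * Pi_fun \<beta> v) \<in> borel_measurable (dPi \<gamma> \<Otimes>\<^sub>M lborel_I)"
        by (simp add: case_prod_unfold)
      show "- ?Pv u v * Pi_fun \<beta> v = a ^ 0 * b ^ 1 * gegenD_gf z s (0 + 1) (a * u + b * v) * (1 * (- K * Pi_fun \<beta> v))"
        if "\<bar>u\<bar> \<le> 1" "\<bar>v\<bar> \<le> 1" for u v using P[OF that] by simp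
    qed (use \<beta> \<gamma> assms(2) in \<open>simp_all only: sigma_finite_dPi sigma_finite_lborel_I id_measurable_dPi id_measurable_lborel_I
        AE_dPi AE_lborel_I deriv_power_dPi(1) deriv_power_Pi_fun(1) order.refl le0\<close>)
    then show ?thesis
      unfolding deriv_power_dPi(2)[OF \<gamma>] deriv_power_Pi_fun(2)[OF assms(2) \<beta>] S_def[abs_def] by (simp add: algebra_simps)
  qed
  have P11: "S (\<lambda>i j. K * (Pi_moment \<alpha> i - Pi_moment (- 1 / 2) i) * (Pi_moment \<beta> j - Pi_moment (- 1 / 2) j)) sums
      (\<integral>(u, v). ?Puv u v * Pi_fun \<alpha> u * Pi_fun \<beta> v \<partial>(lborel_I \<Otimes>\<^sub>M lborel_I))"
    if \<alpha>: "\<alpha> < - 1 / 2" and \<beta>: "\<beta> < - 1 / 2"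
  proof -
    have "(\<lambda>k. \<Sum>x\<in>triples k. z ^ k * triple_coeff s a b x *
        ((\<integral>u. deriv_power 1 (fst (snd x)) u * (K * Pi_fun \<alpha> u) \<partial>lborel_I) * (\<integral>v. deriv_power 1 (snd (snd x)) v * (1 * Pi_fun \<beta> v) \<partial>lborel_I)))
      sums (\<integral>(u, v). ?Puv u v * Pi_fun \<alpha> u * Pi_fun \<beta> v \<partial>(lborel_I \<Otimes>\<^sub>M lborel_I))"
    proof (rule sums)
      have [measurable]: "fst \<in> borel_measurable (lborel_I \<Otimes>\<^sub>M lborel_I)" "snd \<in> borel_measurable (lborel_I \<Otimes>\<^sub>M lborel_I)"
        using measurable_compose[OF measurable_fst id_measurable_lborel_I, of lborel_I]
          measurable_compose[OF measurable_snd id_measurable_lborel_I, of lborel_I] by simp_all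
      have "(\<lambda>p. K * (a * b * gegenD_gf z s 2 (a * fst p + b * snd p))) \<in> borel_measurable (lborel_I \<Otimes>\<^sub>M lborel_I)"
        unfolding gegenD_gf_def by measurable
      \<comment> \<open>The underlying space is the open square, where the closed form of
        \<open>Psi_uv\<close> holds at every point.\<close>
      also have "?this \<longleftrightarrow> (\<lambda>p. ?Puv (fst p) (snd p)) \<in> borel_measurable (lborel_I \<Otimes>\<^sub>M lborel_I)"
        by (rule measurable_cong) (auto simp: P space_pair_measure lborel_I_def space_restrict_space)
      finally have "(\<lambda>p. ?Puv (fst p) (snd p) * Pi_fun \<alpha> (fst p) * Pi_fun \<beta> (snd p)) \<in> borel_measurable (lborel_I \<Otimes>\<^sub>M lborel_I)"
        by (intro borel_measurable_times
            measurable_compose[OF measurable_fst Pi_fun_measurable_lborel_I] measurable_compose[OF measurable_snd Pi_fun_measurable_lborel_I])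
      then show "(\<lambda>(u, v). ?Puv u v * Pi_fun \<alpha> u * Pi_fun \<beta> v) \<in> borel_measurable (lborel_I \<Otimes>\<^sub>M lborel_I)"
        by (simp add: case_prod_unfold)
      show "?Puv u v * Pi_fun \<alpha> u * Pi_fun \<beta> v = a ^ 1 * b ^ 1 * gegenD_gf z s (1 + 1) (a * u + b * v) * (K * Pi_fun \<alpha> u * (1 * Pi_fun \<beta> v))"
        if "\<bar>u\<bar> \<le> 1" "\<bar>v\<bar> \<le> 1" for u v using P(4)[OF that] by (simp add: numeral_2_eq_2)
    qed (use \<alpha> \<beta> assms(1,2) in \<open>simp_all only: sigma_finite_lborel_I id_measurable_lborel_I
        AE_lborel_I deriv_power_Pi_fun(1) order.refl\<close>)
    then show ?thesis
      unfolding deriv_power_Pi_fun(2)[OF assms(1) \<alpha>] deriv_power_Pi_fun(2)[OF assms(2) \<beta>] S_def[abs_def] by (simp add: algebra_simps)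
  qed
  \<comment> \<open>Division by K > 0 reduces the array with the full moments to
    \<open>jacobi_poisson_eq\<close>.\<close>
  have J: "jacobi_poisson \<alpha> \<beta> t \<theta> \<phi> = T" if "S m sums T" "\<And>i j. m i j = K * (Pi_moment \<alpha> i * Pi_moment \<beta> j)" for m T
  proof -
    have m: "m = (\<lambda>i j. K * (Pi_moment \<alpha> i * Pi_moment \<beta> j))" using that(2) by (simp add: fun_eq_iff)
    have "(\<lambda>k. S m k / K) sums (T / K)" using that(1) by (rule sums_divide)
    also have "(\<lambda>k. S m k / K) = (\<lambda>k. \<Sum>x\<in>triples k. z ^ k * triple_coeff s a b x *
        (Pi_moment \<alpha> (fst (snd x)) * Pi_moment \<beta> (snd (snd x))))"
      using K by (simp add: S_def[abs_def] m sum_divide_distrib mult.assoc)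
    finally have "jacobi_poisson \<alpha> \<beta> t \<theta> \<phi> = K * (T / K)"
      using jacobi_poisson_eq[OF assms(1,2), of t \<theta> \<phi>, unfolded defs] by blast
    then show ?thesis using K by simp
  qed
  show ?thesis
  proof (intro conjI impI; elim conjE)
    assume "\<alpha> \<ge> - 1 / 2" "\<beta> \<ge> - 1 / 2"
    from P00[OF this] show "jacobi_poisson \<alpha> \<beta> t \<theta> \<phi> = (\<integral>(u, v). ?P u v \<partial>(dPi \<alpha> \<Otimes>\<^sub>M dPi \<beta>))"
      by (rule J) simp
  next
    assume "\<alpha> < - 1 / 2" "- 1 / 2 \<le> \<beta>"
    \<comment> \<open>The moments of \<open>dPi (- 1 / 2)\<close> in u cancel, leaving those of
      \<alpha>.\<close>
    from sums_add[OF P10[OF this] P00[OF order.refl this(2)]]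
    show "jacobi_poisson \<alpha> \<beta> t \<theta> \<phi> =
        (\<integral>(u, v). - ?Pu u v * Pi_fun \<alpha> u \<partial>(lborel_I \<Otimes>\<^sub>M dPi \<beta>)) +
        (\<integral>(u, v). ?P u v \<partial>(dPi (- 1 / 2) \<Otimes>\<^sub>M dPi \<beta>))"
      unfolding S_add by (rule J) (simp add: algebra_simps)
  next
    assume "\<beta> < - 1 / 2" "- 1 / 2 \<le> \<alpha>"
    from sums_add[OF P01[OF this] P00[OF this(2) order.refl]]
    show "jacobi_poisson \<alpha> \<beta> t \<theta> \<phi> =
        (\<integral>(u, v). - ?Pv u v * Pi_fun \<beta> v \<partial>(dPi \<alpha> \<Otimes>\<^sub>M lborel_I)) +
        (\<integral>(u, v). ?P u v \<partial>(dPi \<alpha> \<Otimes>\<^sub>M dPi (- 1 / 2)))"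
      unfolding S_add by (rule J) (simp add: algebra_simps)
  next
    assume \<alpha>\<beta>: "\<alpha> < - 1 / 2" "\<beta> < - 1 / 2"
    have m: "(\<integral>(u, v). - ?Pu u v * Pi_fun \<alpha> u \<partial>N) = - (\<integral>(u, v). ?Pu u v * Pi_fun \<alpha> u \<partial>N)"
      "(\<integral>(u, v). - ?Pv u v * Pi_fun \<beta> v \<partial>N) = - (\<integral>(u, v). ?Pv u v * Pi_fun \<beta> v \<partial>N)" for N
      by (simp_all add: case_prod_unfold)
    \<comment> \<open>With A, B the moments of \<alpha>, \<beta> and H, H' those of -1/2:
      (A-H)(B-H') + (A-H)H' + H(B-H') + HH' = AB.\<close>
    from sums_add[OF sums_add[OF sums_add[OF P11[OF \<alpha>\<beta>] P10[OF \<alpha>\<beta>(1) order.refl]] P01[OF \<alpha>\<beta>(2) order.refl]]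
        P00[OF order.refl order.refl]]
    have "jacobi_poisson \<alpha> \<beta> t \<theta> \<phi> =
        (\<integral>(u, v). ?Puv u v * Pi_fun \<alpha> u * Pi_fun \<beta> v \<partial>(lborel_I \<Otimes>\<^sub>M lborel_I)) +
        (\<integral>(u, v). - ?Pu u v * Pi_fun \<alpha> u \<partial>(lborel_I \<Otimes>\<^sub>M dPi (- 1 / 2))) +
        (\<integral>(u, v). - ?Pv u v * Pi_fun \<beta> v \<partial>(dPi (- 1 / 2) \<Otimes>\<^sub>M lborel_I)) +
        (\<integral>(u, v). ?P u v \<partial>(dPi (- 1 / 2) \<Otimes>\<^sub>M dPi (- 1 / 2)))"
      unfolding S_add by (rule J) (simp add: algebra_simps)
    then show "jacobi_poisson \<alpha> \<beta> t \<theta> \<phi> =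
        (\<integral>(u, v). ?Puv u v * Pi_fun \<alpha> u * Pi_fun \<beta> v \<partial>(lborel_I \<Otimes>\<^sub>M lborel_I)) -
        (\<integral>(u, v). ?Pu u v * Pi_fun \<alpha> u \<partial>(lborel_I \<Otimes>\<^sub>M dPi (- 1 / 2))) -
        (\<integral>(u, v). ?Pv u v * Pi_fun \<beta> v \<partial>(dPi (- 1 / 2) \<Otimes>\<^sub>M lborel_I)) +
        (\<integral>(u, v). ?P u v \<partial>(dPi (- 1 / 2) \<Otimes>\<^sub>M dPi (- 1 / 2)))"
      unfolding m by simp
  qed
qed

end
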